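(* Let $\epsilon,k>0$. Let $f\in L^2(\Omega)$ and $\{f_h\}_{h>0}\subset L^1(\Omega)$ be such that $f_h\to f$ strongly in $L^1(\Omega)$ as $h\to0$. Let $\mathfrak{z}_h\in V_h^{\epsilon,k}$ be the unique solution of $$(\nabla\mathfrak{z}_h,\nabla(v_h-\mathfrak{z}_h))_\Omega\ge(f_h,v_h-\mathfrak{z}_h)_\Omega\qquad\forall\,v_h\in V_h^{\epsilon,k},$$ and let $\mathfrak{z}\in V^{\epsilon,k}$ be the unique solution of the variational inequality $$(\nabla\mathfrak{z},\nabla(v-\mathfrak{z}))_\Omega\ge(f,v-\mathfrak{z})_\Omega\qquad\forall\,v\in V^{\epsilon,k}.$$ Then $|\mathfrak{z}_h-\mathfrak{z}|_{1,\Omega}\to0$ as $h\to0$.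
   Context: $\Omega\subset\mathbb{R}^2$ is an open, bounded, polygonal, Lipschitz domain. $\{\mathcal{T}_h\}_{h>0}$ is a shape-regular family of simplicial triangulations of $\Omega$, $h$ being the mesh size. $V_h$ is the space of functions in $C^0(\overline\Omega)\cap H^1_0(\Omega)$ that are polynomials of degree at most $1$ on each $K\in\mathcal{T}_h$, and $\boldsymbol{x}_1,\dots,\boldsymbol{x}_n$ are the internal nodes of $\mathcal{T}_h$. Define $$V_h^{\epsilon,k}=\{v_h\in V_h: v_h(\boldsymbol{x}_i)\in[-\epsilon,k]\ \text{for all } i=1,\dots,n\},$$ $$V^{\epsilon,k}=\{v\in H^1_0(\Omega): -\epsilon\le v(\boldsymbol{x})\le k\ \text{a.e. in }\Omega\}.$$ $(f,g)_\Omega=\int_\Omega f\cdot g\,d\boldsymbol{x}$ (also used when $f\in L^1(\Omega)$ and $g\in L^\infty(\Omega)$), and $|v|_{1,\Omega}=\|\nabla v\|_{L^2(\Omega)}$. The parameters are understood with $\epsilon$ small compared with $k$ (in particular $\epsilon<k$). *)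

theory Defs
  imports "HOL-Analysis.Analysis"
begin

text \<open>
  Elements of function spaces are represented by total functions; values outside
  \<open>\<Omega>\<close> (or outside its closure, for continuous functions) are irrelevant, and
  functions that agree almost everywhere in \<open>\<Omega>\<close> are not identified.
\<close>

section \<open>Lebesgue spaces\<close>

definition L1_space :: "'a::euclidean_space set \<Rightarrow> ('a \<Rightarrow> real) set" where
  "L1_space \<Omega> = {f. integrable (lebesgue_on \<Omega>) f}"

definition L2_space :: "'a::euclidean_space set \<Rightarrow> ('a \<Rightarrow> 'b::euclidean_space) set" where
  "L2_space \<Omega> = {f \<in> borel_measurable (lebesgue_on \<Omega>).
                  integrable (lebesgue_on \<Omega>) (\<lambda>x. (norm (f x))\<^sup>2)}"

definition L1_norm :: "'a::euclidean_space set \<Rightarrow> ('a \<Rightarrow> real) \<Rightarrow> real" where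
  "L1_norm \<Omega> f = (\<integral>x. \<bar>f x\<bar> \<partial>lebesgue_on \<Omega>)"

definition L2_norm :: "'a::euclidean_space set \<Rightarrow> ('a \<Rightarrow> 'b::euclidean_space) \<Rightarrow> real" where
  "L2_norm \<Omega> f = sqrt (\<integral>x. (norm (f x))\<^sup>2 \<partial>lebesgue_on \<Omega>)"

text \<open>For real-valued functions the inner product in the integrand is multiplication.\<close>

definition pairing ::
  "'a::euclidean_space set \<Rightarrow> ('a \<Rightarrow> 'b::euclidean_space) \<Rightarrow> ('a \<Rightarrow> 'b) \<Rightarrow> real" where
  "pairing \<Omega> f g = (\<integral>x. f x \<bullet> g x \<partial>lebesgue_on \<Omega>)"

section \<open>Sobolev spaces\<close>

primrec C_k :: "nat \<Rightarrow> ('a::euclidean_space \<Rightarrow> real) \<Rightarrow> bool" where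
  "C_k 0 \<phi> \<longleftrightarrow> continuous_on UNIV \<phi>"
| "C_k (Suc m) \<phi> \<longleftrightarrow> (\<forall>x. \<phi> differentiable at x) \<and>
                    (\<forall>v. C_k m (\<lambda>x. frechet_derivative \<phi> (at x) v))"

definition test_functions :: "'a::euclidean_space set \<Rightarrow> ('a \<Rightarrow> real) set" where
  "test_functions \<Omega> = {\<phi>. (\<forall>m. C_k m \<phi>) \<and>
     compact (closure {x. \<phi> x \<noteq> 0}) \<and> closure {x. \<phi> x \<noteq> 0} \<subseteq> \<Omega>}"

definition has_weak_gradient ::
  "'a::euclidean_space set \<Rightarrow> ('a \<Rightarrow> real) \<Rightarrow> ('a \<Rightarrow> 'a) \<Rightarrow> bool" where
  "has_weak_gradient \<Omega> u g \<longleftrightarrow> (\<forall>\<phi>\<in>test_functions \<Omega>. \<forall>e\<in>Basis.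
     (\<integral>x. u x * frechet_derivative \<phi> (at x) e \<partial>lebesgue_on \<Omega>)
       = - (\<integral>x. (g x \<bullet> e) * \<phi> x \<partial>lebesgue_on \<Omega>))"

definition H1 :: "'a::euclidean_space set \<Rightarrow> ('a \<Rightarrow> real) set" where
  "H1 \<Omega> = {u \<in> L2_space \<Omega>. \<exists>g \<in> L2_space \<Omega>. has_weak_gradient \<Omega> u g}"

text \<open>
  On \<open>H1 \<Omega>\<close> the weak gradient is determined up to a null set; \<open>grad\<close> picks one
  representative, which is only ever used under an integral. It has no meaning
  for functions outside \<open>H1 \<Omega>\<close>.
\<close>

definition grad :: "'a::euclidean_space set \<Rightarrow> ('a \<Rightarrow> real) \<Rightarrow> 'a \<Rightarrow> 'a" where
  "grad \<Omega> u = (SOME g. g \<in> L2_space \<Omega> \<and> has_weak_gradient \<Omega> u g)"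

definition H1_seminorm :: "'a::euclidean_space set \<Rightarrow> ('a \<Rightarrow> real) \<Rightarrow> real" where
  "H1_seminorm \<Omega> u = L2_norm \<Omega> (grad \<Omega> u)"

definition H1_norm :: "'a::euclidean_space set \<Rightarrow> ('a \<Rightarrow> real) \<Rightarrow> real" where
  "H1_norm \<Omega> u = sqrt ((L2_norm \<Omega> u)\<^sup>2 + (H1_seminorm \<Omega> u)\<^sup>2)"

definition H1_0 :: "'a::euclidean_space set \<Rightarrow> ('a \<Rightarrow> real) set" where
  "H1_0 \<Omega> = {u \<in> H1 \<Omega>. \<exists>\<phi>. (\<forall>n::nat. \<phi> n \<in> test_functions \<Omega>) \<and>
     (\<lambda>n. H1_norm \<Omega> (\<lambda>x. \<phi> n x - u x)) \<longlonglongrightarrow> 0}"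

section \<open>Domains\<close>

definition polygonal :: "(real^2) set \<Rightarrow> bool" where
  "polygonal \<Omega> \<longleftrightarrow>
     (\<exists>S. finite S \<and> frontier \<Omega> = (\<Union>(a, b)\<in>S. closed_segment a b))"

text \<open>
  Near each boundary point, \<open>\<Omega>\<close> is the strict epigraph of a Lipschitz function
  in rotated coordinates: \<open>e\<close> is the vertical unit vector, \<open>y \<bullet> e\<close> the vertical
  coordinate of \<open>y\<close>, and \<open>y - (y \<bullet> e) *\<^sub>R e\<close> its horizontal part.
\<close>

definition lipschitz_boundary :: "'a::euclidean_space set \<Rightarrow> bool" where
  "lipschitz_boundary \<Omega> \<longleftrightarrow> (\<forall>x\<in>frontier \<Omega>. \<exists>r>0. \<exists>e L. \<exists>\<gamma>::'a \<Rightarrow> real.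
     norm e = 1 \<and> lipschitz_on L {z. z \<bullet> e = 0} \<gamma> \<and>
     \<Omega> \<inter> ball x r = {y \<in> ball x r. y \<bullet> e > \<gamma> (y - (y \<bullet> e) *\<^sub>R e)})"

section \<open>Triangulations\<close>

text \<open>
  The library's \<open>triangulation\<close> provides finiteness and the face-to-face property
  but admits simplices of any dimension. Here only the triangles are elements.
\<close>

definition triangulation_of :: "(real^2) set \<Rightarrow> (real^2) set set \<Rightarrow> bool" where
  "triangulation_of \<Omega> \<T> \<longleftrightarrow>
     triangulation \<T> \<and> (\<forall>K\<in>\<T>. 2 simplex K) \<and> \<Union>\<T> = closure \<Omega>"

definition mesh_size :: "(real^2) set set \<Rightarrow> real" where
  "mesh_size \<T> = Max (diameter ` \<T>)"

definition inball_diameter :: "(real^2) set \<Rightarrow> real" where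
  "inball_diameter K = 2 * Sup {r. 0 \<le> r \<and> (\<exists>c. cball c r \<subseteq> K)}"

definition shape_regular :: "(real^2) set set set \<Rightarrow> bool" where
  "shape_regular \<TT> \<longleftrightarrow>
     (\<exists>\<sigma>. \<forall>\<T>\<in>\<TT>. \<forall>K\<in>\<T>. diameter K / inball_diameter K \<le> \<sigma>)"

definition internal_nodes :: "(real^2) set \<Rightarrow> (real^2) set set \<Rightarrow> (real^2) set" where
  "internal_nodes \<Omega> \<T> = {x \<in> \<Omega>. \<exists>K\<in>\<T>. x extreme_point_of K}"

section \<open>Discrete and continuous admissible sets\<close>

definition P1_space :: "(real^2) set \<Rightarrow> (real^2) set set \<Rightarrow> (real^2 \<Rightarrow> real) set" where
  "P1_space \<Omega> \<T> = {v. continuous_on (closure \<Omega>) v \<and> v \<in> H1_0 \<Omega> \<and>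
     (\<forall>K\<in>\<T>. \<exists>a b. \<forall>x\<in>K. v x = a \<bullet> x + b)}"

definition P1_box ::
  "(real^2) set \<Rightarrow> (real^2) set set \<Rightarrow> real \<Rightarrow> real \<Rightarrow> (real^2 \<Rightarrow> real) set" where
  "P1_box \<Omega> \<T> \<epsilon> k = {v \<in> P1_space \<Omega> \<T>. \<forall>x\<in>internal_nodes \<Omega> \<T>. v x \<in> {-\<epsilon>..k}}"

definition H1_0_box :: "(real^2) set \<Rightarrow> real \<Rightarrow> real \<Rightarrow> (real^2 \<Rightarrow> real) set" where
  "H1_0_box \<Omega> \<epsilon> k = {v \<in> H1_0 \<Omega>. AE x in lebesgue_on \<Omega>. -\<epsilon> \<le> v x \<and> v x \<le> k}"

end

theory Submission
  imports Defs
begin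

text \<open>
  The convergence is an energy estimate between the two variational inequalities, fed with one good
  discrete competitor. Write \<open>a(u,v)\<close> for \<open>(\<nabla>u, \<nabla>v)\<close> and let \<open>w\<close> be any element of the discrete box.
  Testing the discrete inequality with \<open>w\<close> and the continuous one with \<open>z\<^sub>h\<close> and adding gives
  \<open>|z\<^sub>h - z|\<^sup>2 \<le> (f\<^sub>h - f, z\<^sub>h - w) + (f, z - w) + a(z\<^sub>h - z, w - z) + a(z, w - z)\<close>,
  with \<open>|\<cdot>|\<close> the seminorm. All functions in the boxes are bounded by \<open>max \<epsilon> k\<close>, so the first term is
  controlled by the \<open>L1\<close> distance of the data; the third is absorbed by Young's inequality; what remains
  is small if \<open>w\<close> is close to \<open>z\<close> (lemma \<open>energy_estimate\<close>). Two facts carry the argument.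

  First, \<open>z\<close> can be approximated in \<open>H1\<close> by elements of the discrete boxes. Test functions \<open>\<phi>\<^sub>n\<close>
  converge to \<open>z\<close>, but they need not respect the bounds \<open>-\<epsilon>\<close> and \<open>k\<close>; composing them with smooth clamps
  does not increase the norm of the gradient, and weak convergence together with this bound on the norms
  is strong convergence (\<open>box_approximation\<close>). The resulting \<open>C1\<close> functions with compact support are then
  interpolated on the meshes; uniform continuity of the gradient and shape regularity make the gradient
  of the interpolant uniformly close (\<open>interpolation\<close>). That the interpolant lies in \<open>H1_0\<close>, which
  is defined as a closure of test functions, follows by mollification: inside a triangle the mollified
  function eventually has exactly the gradient of the affine piece, so dominated convergence applies
  (\<open>locally_affine_compact_support_test_limit\<close>).

  Second, \<open>z\<^sub>h\<close> is admissible in the continuous inequality. The nodal constraint is imposed at internal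
  nodes only, so this needs that a function in \<open>H1_0\<close> which is continuous up to the boundary vanishes
  there (\<open>continuous_H1_0_zero_on_frontier\<close>). The extension by zero of an \<open>H1_0\<close> function satisfies
  \<open>\<integral> (V (x + v) - V x)\<^sup>2 \<le> C |v|\<^sup>2\<close>, which is incompatible with a jump across a piece of the boundary.

  Both the definition of \<open>grad\<close> by choice and the closure of test functions are handled through
  \<open>test_limit\<close>: limits of test functions whose classical gradients converge as well. The link to weak
  gradients rests on integration by parts, obtained from translation invariance of Lebesgue measure, and
  on the fundamental lemma of the calculus of variations.
\<close>

section \<open>Smooth functions\<close>

text \<open>
  Membership in \<open>C_k\<close> speaks about \<open>frechet_derivative\<close>, which is defined by choice; this rule
  allows any explicit derivative instead.
\<close>
lemma C_k_SucI:
  assumes "\<And>x. (f has_derivative f' x) (at x)" and "\<And>v. C_k m (\<lambda>x. f' x v)"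
  shows "C_k (Suc m) f"
proof -
  have "frechet_derivative f (at x) = f' x" for x
    using frechet_derivative_at[OF assms(1)] by simp
  then show ?thesis using assms by (auto simp: differentiable_def)
qed

lemma C_k_Suc_imp: "C_k (Suc m) f \<Longrightarrow> C_k m f"
proof (induction m arbitrary: f)
  case 0
  then show ?case
    by (auto intro!: differentiable_imp_continuous_on simp: differentiable_on_def differentiable_at_withinI)
next
  case (Suc m)
  then show ?case by (metis C_k.simps(2))
qed

lemma C_k_const: "C_k m (\<lambda>x. c)"
proof (induction m arbitrary: c)
  case (Suc m)
  then show ?case by (intro C_k_SucI[where f'="\<lambda>x v. 0"]) auto
qed auto

lemma C_k_inner: "C_k m (\<lambda>x. x \<bullet> v)"
proof (cases m)
  case 0
  then show ?thesis by (auto intro!: continuous_intros)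
next
  case (Suc n)
  have "C_k (Suc n) (\<lambda>x. x \<bullet> v)"
    by (rule C_k_SucI[where f'="\<lambda>x w. w \<bullet> v"]) (auto intro!: derivative_eq_intros C_k_const)
  then show ?thesis using Suc by simp
qed

lemma C_k_add: "C_k m f \<Longrightarrow> C_k m g \<Longrightarrow> C_k m (\<lambda>x. f x + g x)"
proof (induction m arbitrary: f g)
  case 0
  then show ?case by (auto intro!: continuous_intros)
next
  case (Suc m)
  show ?case
  proof (rule C_k_SucI)
    show "((\<lambda>x. f x + g x) has_derivative
       (\<lambda>v. frechet_derivative f (at x) v + frechet_derivative g (at x) v)) (at x)" for x
      using Suc.prems by (intro has_derivative_add) (auto simp: frechet_derivative_works[symmetric])
    show "C_k m (\<lambda>x. frechet_derivative f (at x) v + frechet_derivative g (at x) v)" for v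
      using Suc by auto
  qed
qed

lemma C_k_mult: "C_k m f \<Longrightarrow> C_k m g \<Longrightarrow> C_k m (\<lambda>x. f x * g x)"
proof (induction m arbitrary: f g)
  case 0
  then show ?case by (auto intro!: continuous_intros)
next
  case (Suc m)
  show ?case
  proof (rule C_k_SucI)
    show "((\<lambda>x. f x * g x) has_derivative
       (\<lambda>v. f x * frechet_derivative g (at x) v + frechet_derivative f (at x) v * g x)) (at x)" for x
      using Suc.prems by (intro has_derivative_mult) (auto simp: frechet_derivative_works[symmetric])
    show "C_k m (\<lambda>x. f x * frechet_derivative g (at x) v + frechet_derivative f (at x) v * g x)" for v
      using Suc.prems C_k_Suc_imp[OF Suc.prems(1)] C_k_Suc_imp[OF Suc.prems(2)]
      by (intro C_k_add Suc.IH) auto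
  qed
qed

text \<open>
  The derivatives of \<open>exp (-1/t)\<close> are combinations of the functions \<open>exp (-1/t) / t ^ n\<close>. This family,
  extended by zero, is closed under differentiation up to linear combinations, so smoothness of the bump
  function follows by one induction over all \<open>n\<close> at once.
\<close>
definition flat_exp :: "nat \<Rightarrow> real \<Rightarrow> real" where
  "flat_exp n t = (if t \<le> 0 then 0 else exp (- (1/t)) / t ^ n)"

lemma flat_exp_tendsto_0: "((\<lambda>t. flat_exp n t) \<longlongrightarrow> 0) (at 0)"
proof -
  have "((\<lambda>x::real. x ^ n / exp x) \<longlongrightarrow> 0) at_top"
    by (rule tendsto_power_div_exp_0)
  then have "((\<lambda>x. (inverse x) ^ n / exp (inverse x)) \<longlongrightarrow> 0) (at_right (0::real))"
    using filterlim_compose filterlim_inverse_at_top_right by blast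
  then have r: "(flat_exp n \<longlongrightarrow> 0) (at_right 0)"
    by (rule Lim_transform_eventually)
       (auto simp: flat_exp_def eventually_at_right_less divide_simps exp_minus
             intro!: eventually_at_rightI[of 0 1])
  have l: "(flat_exp n \<longlongrightarrow> 0) (at_left 0)"
    by (rule Lim_transform_eventually[OF tendsto_const])
       (auto simp: flat_exp_def intro!: eventually_at_leftI[of "-1" 0])
  show ?thesis using l r by (simp add: filterlim_split_at)
qed

lemma flat_exp_deriv:
  "(flat_exp n has_real_derivative (flat_exp (n + 2) t - real n * flat_exp (n + 1) t)) (at t)"
proof -
  consider "t < 0" | "t = 0" | "t > 0" by linarith
  then show ?thesis
  proof cases
    case 1
    have "((\<lambda>x. 0) has_real_derivative 0) (at t)" by simp
    then have "(flat_exp n has_real_derivative 0) (at t)"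
      by (rule has_field_derivative_transform_within_open[where S="{..<0}"]) (use 1 in \<open>auto simp: flat_exp_def\<close>)
    then show ?thesis using 1 by (simp add: flat_exp_def)
  next
    case 2
    have "((\<lambda>h. (flat_exp n (0 + h) - flat_exp n 0) / h) \<longlongrightarrow> 0) (at 0)"
      by (rule Lim_transform_eventually[OF flat_exp_tendsto_0[of "n+1"]])
         (auto simp: flat_exp_def eventually_at_filter)
    then show ?thesis using 2 by (simp add: DERIV_def flat_exp_def)
  next
    case 3
    have pw: "real n * t ^ (n - Suc 0) = real n * t ^ n / t"
      using 3 by (cases n) auto
    have "((\<lambda>t. exp (- (1/t)) / t ^ n) has_real_derivative
       ((exp (- (1/t)) * (1 / (t * t))) * t ^ n - exp (- (1/t)) * (real n * t ^ (n - Suc 0))) / (t ^ n * t ^ n)) (at t)"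
      using 3 by (auto intro!: derivative_eq_intros)
    also have "((exp (- (1/t)) * (1 / (t * t))) * t ^ n - exp (- (1/t)) * (real n * t ^ (n - Suc 0))) / (t ^ n * t ^ n)
        = flat_exp (n + 2) t - real n * flat_exp (n + 1) t"
      unfolding pw using 3 by (simp add: flat_exp_def field_simps)
    finally have "((\<lambda>t. exp (- (1/t)) / t ^ n) has_real_derivative
        (flat_exp (n + 2) t - real n * flat_exp (n + 1) t)) (at t)" .
    then show ?thesis
      by (rule has_field_derivative_transform_within_open[where S="{0<..}"]) (use 3 in \<open>auto simp: flat_exp_def\<close>)
  qed
qed

lemma C_k_flat_exp_compose:
  fixes c :: real
  shows "C_k m (\<lambda>x::'a::euclidean_space. flat_exp n (c - x \<bullet> x))"
proof (induction m arbitrary: n)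
  case 0
  have "isCont (flat_exp n) t" for t by (rule DERIV_isCont[OF flat_exp_deriv])
  then have *: "continuous_on UNIV (flat_exp n)" by (simp add: continuous_at_imp_continuous_on)
  show ?case by (auto intro!: continuous_on_compose2[OF *] continuous_intros)
next
  case (Suc m)
  show ?case
  proof (rule C_k_SucI)
    fix x :: 'a
    have "((\<lambda>x. c - x \<bullet> x) has_derivative (\<lambda>v. - 2 * (x \<bullet> v))) (at x)"
      by (auto intro!: derivative_eq_intros simp: inner_commute)
    from has_derivative_compose[OF this flat_exp_deriv[of n "c - x \<bullet> x", unfolded has_field_derivative_def]]
    show "((\<lambda>x. flat_exp n (c - x \<bullet> x)) has_derivative
       (\<lambda>v. (flat_exp (n + 2) (c - x \<bullet> x) + (- real n) * flat_exp (n + 1) (c - x \<bullet> x)) * (- 2 * (x \<bullet> v)))) (at x)"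
      by simp
  next
    show "C_k m (\<lambda>x. (flat_exp (n + 2) (c - x \<bullet> x) + (- real n) * flat_exp (n + 1) (c - x \<bullet> x)) * (- 2 * (x \<bullet> v)))" for v :: 'a
      by (intro C_k_mult C_k_add Suc.IH C_k_const C_k_inner)
  qed
qed

lemma integrable_lborel_compact_support:
  fixes f :: "'a::euclidean_space \<Rightarrow> 'b::euclidean_space"
  assumes "continuous_on UNIV f" "compact K" "\<And>x. x \<notin> K \<Longrightarrow> f x = 0"
  shows "integrable lborel f"
proof -
  have "integrable lborel (\<lambda>x. indicator K x *\<^sub>R f x)"
    using assms by (intro borel_integrable_compact) (auto intro: continuous_on_subset)
  also have "(\<lambda>x. indicator K x *\<^sub>R f x) = f" using assms(3) by (auto simp: indicator_def)
  finally show ?thesis .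
qed

text \<open>
  The bump is \<open>exp (-1 / (\<eta>\<^sup>2 - |x|\<^sup>2))\<close>, normalised by its integral.
\<close>
lemma mollifier_exists:
  assumes "\<eta> > 0"
  obtains \<rho> :: "'a::euclidean_space \<Rightarrow> real" where "\<And>m. C_k m \<rho>" "\<And>x. 0 \<le> \<rho> x"
    "\<And>x. \<eta> \<le> norm x \<Longrightarrow> \<rho> x = 0" "integrable lborel \<rho>" "(\<integral>x. \<rho> x \<partial>lborel) = 1"
proof -
  define b where "b = (\<lambda>x::'a. flat_exp 0 (\<eta>\<^sup>2 - x \<bullet> x))"
  have Cb: "C_k m b" for m unfolding b_def by (rule C_k_flat_exp_compose)
  have b0: "b x \<ge> 0" for x by (simp add: b_def flat_exp_def)
  have bz: "b x = 0" if "\<eta> \<le> norm x" for x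
  proof -
    have "\<eta>\<^sup>2 \<le> (norm x)\<^sup>2" using that assms by (intro power_mono) auto
    then show ?thesis by (auto simp: b_def flat_exp_def power2_norm_eq_inner)
  qed
  have bp: "b x > 0" if "norm x < \<eta>" for x
  proof -
    have "(norm x)\<^sup>2 < \<eta>\<^sup>2" using that assms by (intro power_strict_mono) auto
    then show ?thesis by (auto simp: b_def flat_exp_def power2_norm_eq_inner)
  qed
  have bi: "integrable lborel b"
    using Cb[of 0] by (intro integrable_lborel_compact_support[where K="cball 0 \<eta>"]) (auto intro!: bz)
  define I where "I = (\<integral>x. b x \<partial>lborel)"
  have "I \<noteq> 0"
  proof
    assume "I = 0"
    then have "AE x in lborel. b x = 0"
      using integral_nonneg_eq_0_iff_AE[OF bi] b0 by (simp add: I_def)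
    then have "AE x in lborel. x \<notin> ball (0::'a) \<eta>"
      by eventually_elim (use bp in force)
    then have "ball (0::'a) \<eta> \<in> null_sets lborel"
      by (subst (asm) AE_iff_null_sets[symmetric]) auto
    then have "measure lborel (ball (0::'a) \<eta>) = 0" by (simp add: null_sets_def measure_def)
    then show False using content_ball_pos[OF assms, of "0::'a"] by simp
  qed
  moreover have "I \<ge> 0" unfolding I_def using b0 by simp
  ultimately have "I > 0" by simp
  show ?thesis
  proof (rule that[of "\<lambda>x. (1/I) * b x"])
    show "C_k m (\<lambda>x. (1/I) * b x)" for m by (intro C_k_mult C_k_const Cb)
    show "(\<integral>x. (1/I) * b x \<partial>lborel) = 1" using \<open>I > 0\<close> I_def by simp
  qed (use \<open>I>0\<close> b0 bz bi in auto)
qed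

section \<open>Classical gradients\<close>

definition cgrad :: "('a::euclidean_space \<Rightarrow> real) \<Rightarrow> 'a \<Rightarrow> 'a" where
  "cgrad f x = (\<Sum>e\<in>Basis. frechet_derivative f (at x) e *\<^sub>R e)"

lemma cgrad_inner:
  assumes "f differentiable at x"
  shows "cgrad f x \<bullet> v = frechet_derivative f (at x) v"
proof -
  interpret bounded_linear "frechet_derivative f (at x)"
    using assms by (metis frechet_derivative_works has_derivative_bounded_linear)
  have "frechet_derivative f (at x) v = frechet_derivative f (at x) (\<Sum>e\<in>Basis. (v \<bullet> e) *\<^sub>R e)"
    by (simp add: euclidean_representation)
  also have "\<dots> = (\<Sum>e\<in>Basis. (v \<bullet> e) * frechet_derivative f (at x) e)"
    by (simp add: sum scaleR)
  finally show ?thesis by (simp add: cgrad_def inner_sum_left inner_sum_right inner_commute mult.commute)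
qed

lemma has_derivative_cgrad:
  assumes "f differentiable at x"
  shows "(f has_derivative (\<lambda>v. cgrad f x \<bullet> v)) (at x)"
  using assms by (simp add: cgrad_inner frechet_derivative_works[symmetric])

lemma cgrad_eqI:
  assumes "(f has_derivative (\<lambda>v. a \<bullet> v)) (at x)"
  shows "cgrad f x = a"
proof (rule euclidean_eqI)
  fix e :: 'a assume "e \<in> Basis"
  have "f differentiable at x" using assms by (auto simp: differentiable_def)
  then show "cgrad f x \<bullet> e = a \<bullet> e"
    using cgrad_inner frechet_derivative_at[OF assms] by metis
qed

lemma C_k_cgrad_continuous:
  assumes "C_k (Suc 0) f"
  shows "continuous_on S (cgrad f)"
proof -
  have "continuous_on UNIV (\<lambda>x. frechet_derivative f (at x) e)" for e using assms by simp
  then have "continuous_on UNIV (cgrad f)" unfolding cgrad_def by (intro continuous_intros)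
  then show ?thesis by (rule continuous_on_subset) simp
qed

lemma C_k_imp_continuous: "C_k m f \<Longrightarrow> continuous_on S f"
proof (induction m)
  case (Suc m)
  then show ?case by (metis C_k_Suc_imp)
qed (auto intro: continuous_on_subset)

lemma DERIV_along_line:
  assumes "(f has_derivative f') (at (x + t *\<^sub>R v))"
  shows "((\<lambda>t. f (x + t *\<^sub>R v)) has_real_derivative f' v) (at t)"
proof -
  have "((\<lambda>t. x + t *\<^sub>R v) has_derivative (\<lambda>s. s *\<^sub>R v)) (at t)"
    by (auto intro!: derivative_eq_intros)
  from has_derivative_compose[OF this assms]
  have "((\<lambda>t. f (x + t *\<^sub>R v)) has_derivative (\<lambda>s. f' (s *\<^sub>R v))) (at t)" .
  moreover have "f' (s *\<^sub>R v) = f' v * s" for s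
    using linear_scale[OF has_derivative_linear[OF assms]] by (simp add: mult.commute)
  ultimately show ?thesis by (simp add: has_field_derivative_def)
qed

text \<open>
  Differentiating along the direction of the gradient itself turns the Lipschitz bound into a bound on
  \<open>|\<nabla>f|\<^sup>2 / |\<nabla>f|\<close>.
\<close>
lemma cgrad_norm_le_lipschitz:
  assumes d: "f differentiable at x" and L: "\<And>x y. \<bar>f x - f y\<bar> \<le> L * norm (x - y)" "0 \<le> L"
  shows "norm (cgrad f x) \<le> L"
proof -
  define v where "v = cgrad f x"
  have "((\<lambda>t. f (x + t *\<^sub>R v)) has_real_derivative (v \<bullet> v)) (at 0)"
    using has_derivative_cgrad[OF d] by (intro DERIV_along_line) (simp add: v_def)
  then have "(\<lambda>h. \<bar>(f (x + h *\<^sub>R v) - f x) / h\<bar>) \<midarrow>0\<rightarrow> \<bar>v \<bullet> v\<bar>"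
    by (intro tendsto_rabs) (simp add: DERIV_def)
  moreover have "\<forall>\<^sub>F h in at 0. \<bar>(f (x + h *\<^sub>R v) - f x) / h\<bar> \<le> L * norm v"
    unfolding eventually_at_filter
  proof (rule eventuallyI, intro impI)
    fix h :: real assume "h \<noteq> 0"
    then show "\<bar>(f (x + h *\<^sub>R v) - f x) / h\<bar> \<le> L * norm v"
      using L(1)[of "x + h *\<^sub>R v" x] by (simp add: field_simps)
  qed
  ultimately have "\<bar>v \<bullet> v\<bar> \<le> L * norm v" by (rule tendsto_upperbound) simp
  then have "norm v * norm v \<le> L * norm v" by (simp add: power2_norm_eq_inner[symmetric] power2_eq_square)
  then show ?thesis using L(2) unfolding v_def[symmetric] by (cases "norm v = 0") auto
qed

section \<open>Mollification\<close>

definition mollifier :: "real \<Rightarrow> ('a::euclidean_space \<Rightarrow> real) \<Rightarrow> bool" where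
  "mollifier \<eta> \<rho> \<longleftrightarrow> (\<forall>m. C_k m \<rho>) \<and> (\<forall>x. 0 \<le> \<rho> x) \<and> (\<forall>x. \<eta> \<le> norm x \<longrightarrow> \<rho> x = 0)
     \<and> integrable lborel \<rho> \<and> (\<integral>x. \<rho> x \<partial>lborel) = 1"

definition convol :: "('a::euclidean_space \<Rightarrow> real) \<Rightarrow> ('a \<Rightarrow> real) \<Rightarrow> 'a \<Rightarrow> real" where
  "convol \<rho> V x = (\<integral>y. \<rho> (x - y) * V y \<partial>lborel)"

lemma convol_eq_integral:
  assumes "continuous_on UNIV \<rho>" "continuous_on UNIV V" "\<And>y. y \<notin> cbox a b \<Longrightarrow> V y = 0"
  shows "convol \<rho> V x = integral (cbox a b) (\<lambda>y. \<rho> (x - y) * V y)"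
proof -
  let ?f = "\<lambda>y. \<rho> (x - y) * V y"
  have c: "continuous_on UNIV ?f"
    by (intro continuous_intros continuous_on_compose2[OF assms(1)] assms(2)) auto
  have "set_integrable lborel (cbox a b) ?f"
    unfolding set_integrable_def
    using c by (intro borel_integrable_compact) (auto intro: continuous_on_subset)
  then have "(LINT y:cbox a b|lborel. ?f y) = integral (cbox a b) ?f"
    by (rule set_borel_integral_eq_integral)
  moreover have "(LINT y:cbox a b|lborel. ?f y) = convol \<rho> V x"
    unfolding set_lebesgue_integral_def convol_def
    by (intro Bochner_Integration.integral_cong) (auto simp: indicator_def assms(3))
  ultimately show ?thesis by simp
qed

lemma frechet_derivative_eq_cgrad:
  "\<rho> differentiable at x \<Longrightarrow> frechet_derivative \<rho> (at x) = (\<lambda>v. cgrad \<rho> x \<bullet> v)"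
  by (rule ext) (simp add: cgrad_inner)

text \<open>
  Differentiation under the integral sign puts all derivatives on the smooth kernel, so \<open>V\<close> need only
  be continuous. The box containing the support of \<open>V\<close> makes the domain of integration compact, which
  gives the uniform continuity of the derivative that the Leibniz rule rests on.
\<close>
lemma convol_has_derivative:
  fixes \<rho> :: "'a::euclidean_space \<Rightarrow> real"
  assumes \<rho>: "C_k (Suc 0) \<rho>" and V: "continuous_on UNIV V" "\<And>y. y \<notin> cbox a b \<Longrightarrow> V y = 0"
  shows "(convol \<rho> V has_derivative (\<lambda>v. convol (\<lambda>x. frechet_derivative \<rho> (at x) v) V x)) (at x)"
proof -
  have c0: "continuous_on UNIV \<rho>" using \<rho> by (rule C_k_imp_continuous)
  define fx where "fx = (\<lambda>x y. V y *\<^sub>R blinfun_inner_left (cgrad \<rho> (x - y)))"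
  have fxa: "blinfun_apply (fx x y) v = frechet_derivative \<rho> (at (x - y)) v * V y" for x y v
    using \<rho> by (simp add: fx_def scaleR_blinfun.rep_eq frechet_derivative_eq_cgrad inner_commute)
  have cfx: "continuous_on S (\<lambda>(x, y). fx x y)" for S
    unfolding fx_def split_beta
    by (intro continuous_intros continuous_on_compose2[OF C_k_cgrad_continuous[OF \<rho>, of UNIV]]
        continuous_on_compose2[OF V(1)] bounded_linear.continuous_on[OF bounded_linear_blinfun_inner_left]) auto
  have der: "((\<lambda>x. integral (cbox a b) (\<lambda>y. \<rho> (x - y) * V y)) has_derivative
          blinfun_apply (integral (cbox a b) (fx x))) (at x within UNIV)"
  proof (rule leibniz_rule)
    fix x t :: 'a
    have "((\<lambda>x. x - t) has_derivative (\<lambda>v. v)) (at x)" by (auto intro!: derivative_eq_intros)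
    moreover have "(\<rho> has_derivative frechet_derivative \<rho> (at (x - t))) (at (x - t))"
      using \<rho> by (simp add: frechet_derivative_works[symmetric])
    ultimately have "((\<lambda>x. \<rho> (x - t)) has_derivative frechet_derivative \<rho> (at (x - t))) (at x)"
      by (rule has_derivative_compose)
    then show "((\<lambda>x. \<rho> (x - t) * V t) has_derivative blinfun_apply (fx x t)) (at x within UNIV)"
      unfolding fxa[abs_def] by (rule has_derivative_mult_left)
  next
    show "(\<lambda>y. \<rho> (x - y) * V y) integrable_on cbox a b" for x
      by (intro integrable_continuous continuous_intros continuous_on_compose2[OF c0]
          continuous_on_subset[OF V(1)]) auto
  next
    show "continuous_on (UNIV \<times> cbox a b) (\<lambda>(x, t). fx x t)" by (rule cfx)
  qed auto
  have "blinfun_apply (integral (cbox a b) (fx x)) v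
      = convol (\<lambda>x. frechet_derivative \<rho> (at x) v) V x" for v
  proof -
    have "fx x integrable_on cbox a b"
      using continuous_on_compose2[OF cfx[of UNIV], of "cbox a b" "\<lambda>y. (x, y)"]
        continuous_on_Pair[OF continuous_on_const continuous_on_id]
      by (intro integrable_continuous) auto
    then have "blinfun_apply (integral (cbox a b) (fx x)) v
       = integral (cbox a b) (\<lambda>y. frechet_derivative \<rho> (at (x - y)) v * V y)"
      by (subst blinfun_apply_integral) (auto simp: fxa)
    also have "\<dots> = convol (\<lambda>x. frechet_derivative \<rho> (at x) v) V x"
      using \<rho> V by (intro convol_eq_integral[symmetric]) auto
    finally show ?thesis .
  qed
  then have "blinfun_apply (integral (cbox a b) (fx x))
      = (\<lambda>v. convol (\<lambda>x. frechet_derivative \<rho> (at x) v) V x)" by (rule ext)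
  moreover have "convol \<rho> V = (\<lambda>x. integral (cbox a b) (\<lambda>y. \<rho> (x - y) * V y))"
    using convol_eq_integral[OF c0 V] by auto
  ultimately show ?thesis using der by simp
qed

lemma C_k_convol:
  fixes \<rho> :: "'a::euclidean_space \<Rightarrow> real"
  assumes "\<And>m. C_k m \<rho>" and V: "continuous_on UNIV V" "\<And>y. y \<notin> cbox a b \<Longrightarrow> V y = 0"
  shows "C_k m (convol \<rho> V)"
  using assms(1)
proof (induction m arbitrary: \<rho>)
  case 0
  have "C_k (Suc 0) \<rho>" by (rule 0)
  then have "\<And>x. convol \<rho> V differentiable at x"
    using convol_has_derivative[OF _ V] unfolding differentiable_def by blast
  then show ?case
    by (auto intro!: differentiable_imp_continuous_on simp: differentiable_on_def differentiable_at_withinI)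
next
  case (Suc m)
  have "C_k (Suc 0) \<rho>" by (rule Suc)
  then show ?case
    by (rule C_k_SucI[OF convol_has_derivative[OF _ V]])
       (use Suc.prems in \<open>auto intro!: Suc.IH dest: C_k.simps(2)[THEN iffD1, rotated]\<close>)
qed

lemma lborel_integral_reflect:
  fixes f :: "'a::euclidean_space \<Rightarrow> real"
  assumes [measurable]: "f \<in> borel_measurable borel"
  shows "(\<integral>y. f (x - y) \<partial>lborel) = (\<integral>y. f y \<partial>lborel)"
proof -
  have "(\<integral>y. f y \<partial>lborel) = (\<integral>y. f y \<partial>(distr lborel borel (\<lambda>y. x + (-1) *\<^sub>R y)))"
    by (subst lborel_affine[of "-1" x]) (simp_all add: density_1)
  also have "\<dots> = (\<integral>y. f (x - y) \<partial>lborel)" by (subst integral_distr) auto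
  finally show ?thesis by simp
qed

lemma lborel_integral_translate:
  fixes f :: "'a::euclidean_space \<Rightarrow> real"
  assumes [measurable]: "f \<in> borel_measurable borel"
  shows "(\<integral>y. f (c + y) \<partial>lborel) = (\<integral>y. f y \<partial>lborel)"
proof -
  have "(\<integral>y. f y \<partial>lborel) = (\<integral>y. f y \<partial>(distr lborel borel ((+) c)))"
    by (simp add: lborel_distr_plus)
  also have "\<dots> = (\<integral>y. f (c + y) \<partial>lborel)" by (subst integral_distr) auto
  finally show ?thesis by simp
qed

lemma lborel_integrable_translate:
  fixes f :: "'a::euclidean_space \<Rightarrow> real"
  assumes "integrable lborel f"
  shows "integrable lborel (\<lambda>y. f (c + y))"
proof -
  have "integrable (distr lborel borel ((+) c)) f"
    using assms by (simp add: lborel_distr_plus)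
  then show ?thesis by (subst (asm) integrable_distr_eq) (use assms in auto)
qed

lemma convol_commute:
  assumes "continuous_on UNIV \<rho>" "continuous_on UNIV V"
  shows "convol \<rho> V x = (\<integral>y. \<rho> y * V (x - y) \<partial>lborel)"
proof -
  have "continuous_on UNIV (\<lambda>y. \<rho> y * V (x - y))"
    by (intro continuous_intros assms continuous_on_compose2[OF assms(2)]) auto
  then have "(\<lambda>y. \<rho> y * V (x - y)) \<in> borel_measurable borel"
    by (rule borel_measurable_continuous_onI)
  from lborel_integral_reflect[OF this, of x] show ?thesis by (simp add: convol_def)
qed

context
  fixes \<eta> :: real and \<rho> :: "'a::euclidean_space \<Rightarrow> real"
  assumes mol: "mollifier \<eta> \<rho>"
begin

lemma mollifier_integrable_mult:
  assumes "continuous_on UNIV W"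
  shows "integrable lborel (\<lambda>y. \<rho> y * W y)"
proof (rule integrable_lborel_compact_support[where K="cball 0 \<eta>"])
  have "continuous_on UNIV \<rho>" using mol C_k_imp_continuous unfolding mollifier_def by blast
  then show "continuous_on UNIV (\<lambda>y. \<rho> y * W y)" by (intro continuous_intros assms)
qed (use mol in \<open>auto simp: mollifier_def\<close>)

text \<open>
  A mollifier is a probability density on the ball of radius \<open>\<eta>\<close>, so integrals against it are averages.
  Estimates of mollified functions and of their increments are instances of this bound.
\<close>
lemma mollifier_average_bound:
  assumes "continuous_on UNIV W" and d: "\<And>y. norm y < \<eta> \<Longrightarrow> \<bar>W y\<bar> \<le> d"
  shows "\<bar>\<integral>y. \<rho> y * W y \<partial>lborel\<bar> \<le> d"
proof -
  have "\<bar>\<integral>y. \<rho> y * W y \<partial>lborel\<bar> \<le> (\<integral>y. \<bar>\<rho> y * W y\<bar> \<partial>lborel)"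
    by (rule integral_abs_bound)
  also have "\<dots> \<le> (\<integral>y. \<rho> y * d \<partial>lborel)"
  proof (rule integral_mono)
    show "\<bar>\<rho> y * W y\<bar> \<le> \<rho> y * d" for y
      using mol d[of y] unfolding mollifier_def
      by (cases "norm y < \<eta>") (auto simp: abs_mult intro!: mult_left_mono)
    show "integrable lborel (\<lambda>y. \<bar>\<rho> y * W y\<bar>)" "integrable lborel (\<lambda>y. \<rho> y * d)"
      using mollifier_integrable_mult[OF assms(1)] mol by (auto simp: mollifier_def)
  qed
  also have "\<dots> = d" using mol by (simp add: mollifier_def)
  finally show ?thesis .
qed

lemma convol_eq_average:
  assumes "continuous_on UNIV V"
  shows "convol \<rho> V x = (\<integral>y. \<rho> y * V (x - y) \<partial>lborel)"
  using mol assms C_k_imp_continuous unfolding mollifier_def by (intro convol_commute) blast+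

lemma convol_close:
  assumes V: "continuous_on UNIV V" and d: "\<And>y. norm y < \<eta> \<Longrightarrow> \<bar>V (x - y) - c\<bar> \<le> d"
  shows "\<bar>convol \<rho> V x - c\<bar> \<le> d"
proof -
  have cV: "continuous_on UNIV (\<lambda>y. V (x - y))"
    by (intro continuous_on_compose2[OF V] continuous_intros) auto
  have \<rho>1: "integrable lborel \<rho>" "(\<integral>x. \<rho> x \<partial>lborel) = 1"
    using mol by (auto simp: mollifier_def)
  have "convol \<rho> V x - c = (\<integral>y. \<rho> y * V (x - y) \<partial>lborel) - (\<integral>y. \<rho> y * c \<partial>lborel)"
    unfolding convol_eq_average[OF V] integral_mult_left_zero \<rho>1 by simp
  also have "\<dots> = (\<integral>y. \<rho> y * (V (x - y) - c) \<partial>lborel)"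
    unfolding right_diff_distrib
    by (intro Bochner_Integration.integral_diff[symmetric] mollifier_integrable_mult cV continuous_on_const)
  finally show ?thesis
    by (simp only:) (intro mollifier_average_bound continuous_intros cV d)
qed

lemma convol_lipschitz:
  assumes V: "continuous_on UNIV V" and L: "\<And>x y. \<bar>V x - V y\<bar> \<le> L * norm (x - y)"
  shows "\<bar>convol \<rho> V x - convol \<rho> V x'\<bar> \<le> L * norm (x - x')"
proof -
  have cV: "continuous_on UNIV (\<lambda>y. V (x - y))" for x
    by (intro continuous_on_compose2[OF V] continuous_intros) auto
  have "convol \<rho> V x - convol \<rho> V x' = (\<integral>y. \<rho> y * (V (x - y) - V (x' - y)) \<partial>lborel)"
    unfolding convol_eq_average[OF V]
    by (subst Bochner_Integration.integral_diff[symmetric])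
       (auto intro!: mollifier_integrable_mult cV simp: algebra_simps)
  moreover have "\<bar>V (x - y) - V (x' - y)\<bar> \<le> L * norm (x - x')" for y
    using L[of "x - y" "x' - y"] by simp
  ultimately show ?thesis
    by (simp only:) (intro mollifier_average_bound continuous_intros cV)
qed

text \<open>
  Averaging translates of an affine function gives the same affine function up to a constant. Hence
  mollification reproduces gradients exactly at points that are well inside an affine piece.
\<close>
lemma cgrad_convol_affine:
  assumes V: "continuous_on UNIV V" and r: "\<eta> < r"
    and aff: "\<And>u. u \<in> ball x0 r \<Longrightarrow> V u = a \<bullet> u + b"
  shows "cgrad (convol \<rho> V) x0 = a"
proof (rule cgrad_eqI)
  define c where "c = b - (\<integral>y. \<rho> y * (a \<bullet> y) \<partial>lborel)"
  have eq: "convol \<rho> V x = a \<bullet> x + c" if x: "x \<in> ball x0 (r - \<eta>)" for x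
  proof -
    have "convol \<rho> V x = (\<integral>y. \<rho> y * ((a \<bullet> x + b) - a \<bullet> y) \<partial>lborel)"
      unfolding convol_eq_average[OF V]
    proof (rule Bochner_Integration.integral_cong)
      fix y
      show "\<rho> y * V (x - y) = \<rho> y * ((a \<bullet> x + b) - a \<bullet> y)"
      proof (cases "\<eta> \<le> norm y")
        case True then show ?thesis using mol by (simp add: mollifier_def)
      next
        case False
        have "dist x0 (x - y) \<le> dist x0 x + dist x (x - y)" by (rule dist_triangle)
        then have "x - y \<in> ball x0 r" using x False by (simp add: dist_norm)
        then show ?thesis by (simp add: aff inner_diff_right)
      qed
    qed simp
    also have "\<dots> = (\<integral>y. \<rho> y * (a \<bullet> x + b) - \<rho> y * (a \<bullet> y) \<partial>lborel)"
      by (simp add: algebra_simps)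
    also have "\<dots> = (\<integral>y. \<rho> y * (a \<bullet> x + b) \<partial>lborel) - (\<integral>y. \<rho> y * (a \<bullet> y) \<partial>lborel)"
      by (intro Bochner_Integration.integral_diff mollifier_integrable_mult continuous_intros)
    also have "\<dots> = a \<bullet> x + c" using mol by (simp add: c_def mollifier_def)
    finally show ?thesis .
  qed
  have "((\<lambda>x. a \<bullet> x + c) has_derivative (\<lambda>v. a \<bullet> v)) (at x0)"
    by (auto intro!: derivative_eq_intros)
  then show "(convol \<rho> V has_derivative (\<lambda>v. a \<bullet> v)) (at x0)"
    by (rule has_derivative_transform_within_open[where s="ball x0 (r - \<eta>)"]) (use r eq in auto)
qed

end

section \<open>The Hilbert space of square-integrable functions\<close>

lemma L2_spaceD:
  assumes "f \<in> L2_space \<Omega>"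
  shows "f \<in> borel_measurable (lebesgue_on \<Omega>)" "integrable (lebesgue_on \<Omega>) (\<lambda>x. (norm (f x))\<^sup>2)"
  using assms by (auto simp: L2_space_def)

lemma L2_inner_integrable:
  fixes f g :: "'a::euclidean_space \<Rightarrow> 'b::euclidean_space"
  assumes "f \<in> L2_space \<Omega>" "g \<in> L2_space \<Omega>"
  shows "integrable (lebesgue_on \<Omega>) (\<lambda>x. f x \<bullet> g x)"
proof (rule Bochner_Integration.integrable_bound)
  show "integrable (lebesgue_on \<Omega>) (\<lambda>x. (norm (f x))\<^sup>2 + (norm (g x))\<^sup>2)"
    by (intro Bochner_Integration.integrable_add L2_spaceD(2) assms)
  have [measurable]: "f \<in> borel_measurable (lebesgue_on \<Omega>)" "g \<in> borel_measurable (lebesgue_on \<Omega>)"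
    using assms L2_spaceD by auto
  show "(\<lambda>x. f x \<bullet> g x) \<in> borel_measurable (lebesgue_on \<Omega>)" by measurable
  have "\<bar>f x \<bullet> g x\<bar> \<le> (norm (f x))\<^sup>2 + (norm (g x))\<^sup>2" for x
  proof -
    have "\<bar>f x \<bullet> g x\<bar> \<le> norm (f x) * norm (g x)" by (rule Cauchy_Schwarz_ineq2)
    also have "\<dots> \<le> (norm (f x))\<^sup>2 + (norm (g x))\<^sup>2"
    proof -
      have "0 \<le> norm (f x) * norm (g x)" by simp
      moreover have "2 * (norm (f x) * norm (g x)) \<le> (norm (f x))\<^sup>2 + (norm (g x))\<^sup>2"
        using sum_squares_bound[of "norm (f x)" "norm (g x)"] by simp
      ultimately show ?thesis by linarith
    qed
    finally show ?thesis .
  qed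
  then show "AE x in lebesgue_on \<Omega>. norm (f x \<bullet> g x) \<le> norm ((norm (f x))\<^sup>2 + (norm (g x))\<^sup>2)"
    by auto
qed

lemma L2_add:
  fixes f g :: "'a::euclidean_space \<Rightarrow> 'b::euclidean_space"
  assumes "f \<in> L2_space \<Omega>" "g \<in> L2_space \<Omega>"
  shows "(\<lambda>x. f x + g x) \<in> L2_space \<Omega>"
proof -
  have "integrable (lebesgue_on \<Omega>) (\<lambda>x. (norm (f x))\<^sup>2 + 2 * (f x \<bullet> g x) + (norm (g x))\<^sup>2)"
    by (intro Bochner_Integration.integrable_add integrable_mult_right L2_spaceD(2) assms
        L2_inner_integrable[OF assms])
  also have "(\<lambda>x. (norm (f x))\<^sup>2 + 2 * (f x \<bullet> g x) + (norm (g x))\<^sup>2) = (\<lambda>x. (norm (f x + g x))\<^sup>2)"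
    by (auto simp: power2_norm_eq_inner inner_simps inner_commute)
  finally have "integrable (lebesgue_on \<Omega>) (\<lambda>x. (norm (f x + g x))\<^sup>2)" .
  moreover have "(\<lambda>x. f x + g x) \<in> borel_measurable (lebesgue_on \<Omega>)"
    by (intro borel_measurable_add L2_spaceD(1) assms)
  ultimately show ?thesis by (simp add: L2_space_def)
qed

lemma L2_scale:
  fixes f :: "'a::euclidean_space \<Rightarrow> 'b::euclidean_space"
  assumes "f \<in> L2_space \<Omega>"
  shows "(\<lambda>x. c *\<^sub>R f x) \<in> L2_space \<Omega>"
  using assms by (auto simp: L2_space_def power_mult_distrib)

lemma L2_diff:
  fixes f g :: "'a::euclidean_space \<Rightarrow> 'b::euclidean_space"
  assumes "f \<in> L2_space \<Omega>" "g \<in> L2_space \<Omega>"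
  shows "(\<lambda>x. f x - g x) \<in> L2_space \<Omega>"
  using L2_add[OF assms(1) L2_scale[OF assms(2), of "-1"]] by simp

lemma L2_norm_eq_sqrt_pairing: "L2_norm \<Omega> f = sqrt (pairing \<Omega> f f)"
  by (simp add: L2_norm_def pairing_def power2_norm_eq_inner)

lemma pairing_self_nonneg: "0 \<le> pairing \<Omega> f f"
  by (simp add: pairing_def)

lemma L2_norm_square: "(L2_norm \<Omega> f)\<^sup>2 = pairing \<Omega> f f"
  by (simp add: L2_norm_eq_sqrt_pairing pairing_self_nonneg)

lemma L2_norm_nonneg [simp]: "0 \<le> L2_norm \<Omega> f"
  by (simp add: L2_norm_eq_sqrt_pairing pairing_self_nonneg)

lemma pairing_commute: "pairing \<Omega> f g = pairing \<Omega> g f"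
  by (simp add: pairing_def inner_commute)

lemma pairing_add_right:
  fixes f g h :: "'a::euclidean_space \<Rightarrow> 'b::euclidean_space"
  assumes "f \<in> L2_space \<Omega>" "g \<in> L2_space \<Omega>" "h \<in> L2_space \<Omega>"
  shows "pairing \<Omega> f (\<lambda>x. g x + h x) = pairing \<Omega> f g + pairing \<Omega> f h"
  using assms by (simp add: pairing_def inner_add_right L2_inner_integrable)

lemma pairing_diff_right:
  fixes f g h :: "'a::euclidean_space \<Rightarrow> 'b::euclidean_space"
  assumes "f \<in> L2_space \<Omega>" "g \<in> L2_space \<Omega>" "h \<in> L2_space \<Omega>"
  shows "pairing \<Omega> f (\<lambda>x. g x - h x) = pairing \<Omega> f g - pairing \<Omega> f h"
  using assms by (simp add: pairing_def inner_diff_right L2_inner_integrable)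

lemma pairing_add_left:
  fixes f g h :: "'a::euclidean_space \<Rightarrow> 'b::euclidean_space"
  assumes "f \<in> L2_space \<Omega>" "g \<in> L2_space \<Omega>" "h \<in> L2_space \<Omega>"
  shows "pairing \<Omega> (\<lambda>x. g x + h x) f = pairing \<Omega> g f + pairing \<Omega> h f"
  using assms by (simp add: pairing_def inner_add_left L2_inner_integrable)

lemma pairing_diff_left:
  fixes f g h :: "'a::euclidean_space \<Rightarrow> 'b::euclidean_space"
  assumes "f \<in> L2_space \<Omega>" "g \<in> L2_space \<Omega>" "h \<in> L2_space \<Omega>"
  shows "pairing \<Omega> (\<lambda>x. g x - h x) f = pairing \<Omega> g f - pairing \<Omega> h f"
  using assms by (simp add: pairing_def inner_diff_left L2_inner_integrable)

lemma L2_norm_minus_commute: "L2_norm \<Omega> (\<lambda>x. f x - g x) = L2_norm \<Omega> (\<lambda>x. g x - f x)"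
  by (simp add: L2_norm_def norm_minus_commute)

text \<open>
  The usual discriminant argument, for the quadratic polynomial \<open>t \<mapsto> |f - t g|\<^sup>2\<close>.
\<close>
lemma L2_Cauchy_Schwarz:
  fixes f g :: "'a::euclidean_space \<Rightarrow> 'b::euclidean_space"
  assumes f: "f \<in> L2_space \<Omega>" and g: "g \<in> L2_space \<Omega>"
  shows "\<bar>pairing \<Omega> f g\<bar> \<le> L2_norm \<Omega> f * L2_norm \<Omega> g"
proof -
  define A B C where "A = pairing \<Omega> f f" and "B = pairing \<Omega> f g" and "C = pairing \<Omega> g g"
  have q: "0 \<le> A - 2 * t * B + t\<^sup>2 * C" for t
  proof -
    have i: "integrable (lebesgue_on \<Omega>) (\<lambda>x. f x \<bullet> f x)" "integrable (lebesgue_on \<Omega>) (\<lambda>x. f x \<bullet> g x)"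
      "integrable (lebesgue_on \<Omega>) (\<lambda>x. g x \<bullet> g x)" using f g L2_inner_integrable by auto
    have "0 \<le> (\<integral>x. (norm (f x - t *\<^sub>R g x))\<^sup>2 \<partial>lebesgue_on \<Omega>)" by simp
    also have "\<dots> = (\<integral>x. f x \<bullet> f x - 2 * t * (f x \<bullet> g x) + t\<^sup>2 * (g x \<bullet> g x) \<partial>lebesgue_on \<Omega>)"
    proof (rule Bochner_Integration.integral_cong)
      fix x
      show "(norm (f x - t *\<^sub>R g x))\<^sup>2 = f x \<bullet> f x - 2 * t * (f x \<bullet> g x) + t\<^sup>2 * (g x \<bullet> g x)"
        unfolding power2_norm_eq_inner
        by (simp add: inner_diff_left inner_diff_right inner_commute[of "g x" "f x"] power2_eq_square
              algebra_simps)
    qed simp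
    also have "\<dots> = A - 2 * t * B + t\<^sup>2 * C"
      unfolding A_def B_def C_def pairing_def using i by simp
    finally show ?thesis .
  qed
  have C0: "C \<ge> 0" unfolding C_def by (rule pairing_self_nonneg)
  have "B\<^sup>2 \<le> A * C"
  proof (cases "C = 0")
    case True
    have "B = 0"
    proof (rule ccontr)
      assume "B \<noteq> 0"
      then show False using q[of "(A + 1) / (2 * B)"] True by simp
    qed
    then show ?thesis using True by simp
  next
    case False
    have "A - 2 * (B / C) * B + (B / C)\<^sup>2 * C = A - B\<^sup>2 / C"
      using False by (simp add: power2_eq_square)
    then have "B\<^sup>2 / C \<le> A" using q[of "B / C"] by linarith
    then show ?thesis using False C0 by (simp add: pos_divide_le_eq)
  qed
  then have "sqrt (B\<^sup>2) \<le> sqrt (A * C)" by (rule real_sqrt_le_mono)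
  then show ?thesis by (simp add: real_sqrt_mult L2_norm_eq_sqrt_pairing A_def B_def C_def)
qed

lemma L2_norm_triangle:
  fixes f g :: "'a::euclidean_space \<Rightarrow> 'b::euclidean_space"
  assumes f: "f \<in> L2_space \<Omega>" and g: "g \<in> L2_space \<Omega>"
  shows "L2_norm \<Omega> (\<lambda>x. f x + g x) \<le> L2_norm \<Omega> f + L2_norm \<Omega> g"
proof (rule power2_le_imp_le)
  have fg: "(\<lambda>x. f x + g x) \<in> L2_space \<Omega>" using f g by (rule L2_add)
  have "(L2_norm \<Omega> (\<lambda>x. f x + g x))\<^sup>2 = (L2_norm \<Omega> f)\<^sup>2 + 2 * pairing \<Omega> f g + (L2_norm \<Omega> g)\<^sup>2"
    unfolding L2_norm_square
    using f g fg by (simp add: pairing_add_right pairing_add_left pairing_commute[of \<Omega> g f])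
  also have "\<dots> \<le> (L2_norm \<Omega> f)\<^sup>2 + 2 * (L2_norm \<Omega> f * L2_norm \<Omega> g) + (L2_norm \<Omega> g)\<^sup>2"
    using L2_Cauchy_Schwarz[OF f g] by linarith
  finally show "(L2_norm \<Omega> (\<lambda>x. f x + g x))\<^sup>2 \<le> (L2_norm \<Omega> f + L2_norm \<Omega> g)\<^sup>2"
    by (simp add: power2_sum)
qed simp

lemma L2_norm_diff_triangle:
  fixes f g h :: "'a::euclidean_space \<Rightarrow> 'b::euclidean_space"
  assumes "f \<in> L2_space \<Omega>" "g \<in> L2_space \<Omega>" "h \<in> L2_space \<Omega>"
  shows "L2_norm \<Omega> (\<lambda>x. f x - h x) \<le> L2_norm \<Omega> (\<lambda>x. f x - g x) + L2_norm \<Omega> (\<lambda>x. g x - h x)"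
  using L2_norm_triangle[OF L2_diff[OF assms(1,2)] L2_diff[OF assms(2,3)]] by simp

lemma L2_norm_cong_AE:
  assumes "f \<in> borel_measurable (lebesgue_on \<Omega>)" "g \<in> borel_measurable (lebesgue_on \<Omega>)"
    "AE x in lebesgue_on \<Omega>. f x = g x"
  shows "L2_norm \<Omega> f = L2_norm \<Omega> g"
proof -
  have "(\<integral>x. (norm (f x))\<^sup>2 \<partial>lebesgue_on \<Omega>) = (\<integral>x. (norm (g x))\<^sup>2 \<partial>lebesgue_on \<Omega>)"
    using assms by (intro integral_cong_AE) auto
  then show ?thesis by (simp add: L2_norm_def)
qed

lemma pairing_cong_AE:
  fixes f g f' g' :: "'a::euclidean_space \<Rightarrow> 'b::euclidean_space"
  assumes "f \<in> L2_space \<Omega>" "g \<in> L2_space \<Omega>" "f' \<in> L2_space \<Omega>" "g' \<in> L2_space \<Omega>"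
    "AE x in lebesgue_on \<Omega>. f x = f' x" "AE x in lebesgue_on \<Omega>. g x = g' x"
  shows "pairing \<Omega> f g = pairing \<Omega> f' g'"
  unfolding pairing_def
  by (intro integral_cong_AE borel_measurable_inner) (use assms L2_spaceD(1) in \<open>auto\<close>)

lemma L2_norm_mono:
  assumes "f \<in> L2_space \<Omega>" "g \<in> L2_space \<Omega>" "AE x in lebesgue_on \<Omega>. norm (f x) \<le> norm (g x)"
  shows "L2_norm \<Omega> f \<le> L2_norm \<Omega> g"
proof -
  have "(\<integral>x. (norm (f x))\<^sup>2 \<partial>lebesgue_on \<Omega>) \<le> (\<integral>x. (norm (g x))\<^sup>2 \<partial>lebesgue_on \<Omega>)"
    using assms(3) by (intro integral_mono_AE L2_spaceD(2) assms) (auto intro: power_mono)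
  then show ?thesis by (simp add: L2_norm_def)
qed

lemma L2_mono:
  fixes f :: "'a::euclidean_space \<Rightarrow> 'b::euclidean_space" and g :: "'a \<Rightarrow> 'c::euclidean_space"
  assumes "f \<in> borel_measurable (lebesgue_on \<Omega>)" "g \<in> L2_space \<Omega>"
    "AE x in lebesgue_on \<Omega>. norm (f x) \<le> norm (g x)"
  shows "f \<in> L2_space \<Omega>"
proof -
  have "integrable (lebesgue_on \<Omega>) (\<lambda>x. (norm (f x))\<^sup>2)"
  proof (rule Bochner_Integration.integrable_bound[OF L2_spaceD(2)[OF assms(2)]])
    show "AE x in lebesgue_on \<Omega>. norm ((norm (f x))\<^sup>2) \<le> norm ((norm (g x))\<^sup>2)"
      using assms(3) by eventually_elim (auto intro: power_mono)
  qed (use assms(1) in auto)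
  then show ?thesis using assms(1) by (simp add: L2_space_def)
qed

lemma
  fixes f :: "'a::euclidean_space \<Rightarrow> 'b::euclidean_space"
  assumes \<Omega>: "\<Omega> \<in> lmeasurable" and m: "f \<in> borel_measurable (lebesgue_on \<Omega>)"
    and B: "AE x in lebesgue_on \<Omega>. norm (f x) \<le> B" "0 \<le> B"
  shows L2_bounded: "f \<in> L2_space \<Omega>"
    and L2_norm_bounded: "L2_norm \<Omega> f \<le> B * sqrt (measure lebesgue \<Omega>)"
proof -
  interpret finite_measure "lebesgue_on \<Omega>" using \<Omega> by (rule finite_measure_lebesgue_on)
  have le: "AE x in lebesgue_on \<Omega>. (norm (f x))\<^sup>2 \<le> B\<^sup>2"
    using B(1) by eventually_elim (auto intro: power_mono)
  have i: "integrable (lebesgue_on \<Omega>) (\<lambda>x. (norm (f x))\<^sup>2)"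
    by (rule integrable_const_bound[where B="B\<^sup>2"]) (use le m in auto)
  then show "f \<in> L2_space \<Omega>" using m by (simp add: L2_space_def)
  have "(\<integral>x. (norm (f x))\<^sup>2 \<partial>lebesgue_on \<Omega>) \<le> (\<integral>x. B\<^sup>2 \<partial>lebesgue_on \<Omega>)"
    using i le by (intro integral_mono_AE) auto
  also have "\<dots> = B\<^sup>2 * measure lebesgue \<Omega>"
    using \<Omega> by (simp add: measure_restrict_space mult.commute)
  finally have "sqrt (\<integral>x. (norm (f x))\<^sup>2 \<partial>lebesgue_on \<Omega>) \<le> sqrt (B\<^sup>2 * measure lebesgue \<Omega>)"
    by (rule real_sqrt_le_mono)
  then show "L2_norm \<Omega> f \<le> B * sqrt (measure lebesgue \<Omega>)"
    using B(2) by (simp add: L2_norm_def real_sqrt_mult)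
qed

lemma pairing_tendsto:
  fixes f g :: "'a::euclidean_space \<Rightarrow> 'b::euclidean_space"
  assumes "\<And>n. u n \<in> L2_space \<Omega>" "f \<in> L2_space \<Omega>" "g \<in> L2_space \<Omega>"
    and "(\<lambda>n. L2_norm \<Omega> (\<lambda>x. u n x - f x)) \<longlonglongrightarrow> 0"
  shows "(\<lambda>n. pairing \<Omega> (u n) g) \<longlonglongrightarrow> pairing \<Omega> f g"
proof -
  have "(\<lambda>n. pairing \<Omega> (u n) g - pairing \<Omega> f g) \<longlonglongrightarrow> 0"
  proof (rule Lim_null_comparison[OF always_eventually])
    show "\<forall>n. norm (pairing \<Omega> (u n) g - pairing \<Omega> f g)
        \<le> L2_norm \<Omega> (\<lambda>x. u n x - f x) * L2_norm \<Omega> g"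
      using L2_Cauchy_Schwarz[OF L2_diff[OF assms(1,2)] assms(3)] assms(1-3)
      by (simp add: pairing_diff_left)
    show "(\<lambda>n. L2_norm \<Omega> (\<lambda>x. u n x - f x) * L2_norm \<Omega> g) \<longlonglongrightarrow> 0"
      using tendsto_mult_right[OF assms(4), of "L2_norm \<Omega> g"] by simp
  qed
  then show ?thesis by (simp add: LIM_zero_iff)
qed

lemma L2_norm_tendsto:
  fixes f :: "'a::euclidean_space \<Rightarrow> 'b::euclidean_space"
  assumes "\<And>n. u n \<in> L2_space \<Omega>" "f \<in> L2_space \<Omega>"
    and "(\<lambda>n. L2_norm \<Omega> (\<lambda>x. u n x - f x)) \<longlonglongrightarrow> 0"
  shows "(\<lambda>n. L2_norm \<Omega> (u n)) \<longlonglongrightarrow> L2_norm \<Omega> f"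
proof -
  have "(\<lambda>n. L2_norm \<Omega> (u n) - L2_norm \<Omega> f) \<longlonglongrightarrow> 0"
  proof (rule Lim_null_comparison[OF always_eventually])
    show "\<forall>n. norm (L2_norm \<Omega> (u n) - L2_norm \<Omega> f) \<le> L2_norm \<Omega> (\<lambda>x. u n x - f x)"
    proof
      fix n
      have "L2_norm \<Omega> (u n) \<le> L2_norm \<Omega> (\<lambda>x. u n x - f x) + L2_norm \<Omega> f"
        using L2_norm_triangle[OF L2_diff[OF assms(1,2)] assms(2), of n] by simp
      moreover have "L2_norm \<Omega> f \<le> L2_norm \<Omega> (\<lambda>x. f x - u n x) + L2_norm \<Omega> (u n)"
        using L2_norm_triangle[OF L2_diff[OF assms(2) assms(1)[of n]] assms(1)[of n]] by simp
      ultimately show "norm (L2_norm \<Omega> (u n) - L2_norm \<Omega> f) \<le> L2_norm \<Omega> (\<lambda>x. u n x - f x)"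
        by (simp add: L2_norm_minus_commute[of \<Omega> f])
    qed
  qed (rule assms(3))
  then show ?thesis by (simp add: LIM_zero_iff)
qed

text \<open>
  Weak convergence tested only against functions that approximate the limit itself, together with a
  norm bound, forces strong convergence: in \<open>|p n - g|\<^sup>2 = |p n|\<^sup>2 - 2 (p n, g) + |g|\<^sup>2\<close> the right side is at
  most \<open>|q n|\<^sup>2 - 2 (p n, g) + |g|\<^sup>2\<close>, which tends to zero.
\<close>
lemma L2_strong_of_weak:
  fixes p q :: "nat \<Rightarrow> 'a::euclidean_space \<Rightarrow> 'b::euclidean_space"
  assumes p: "\<And>n. p n \<in> L2_space \<Omega>" and q: "\<And>n. q n \<in> L2_space \<Omega>" and g: "g \<in> L2_space \<Omega>"
    and le: "\<And>n. L2_norm \<Omega> (p n) \<le> L2_norm \<Omega> (q n)"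
    and qg: "(\<lambda>n. L2_norm \<Omega> (\<lambda>x. q n x - g x)) \<longlonglongrightarrow> 0"
    and weak: "\<And>m. (\<lambda>n. pairing \<Omega> (p n) (q m)) \<longlonglongrightarrow> pairing \<Omega> g (q m)"
  shows "(\<lambda>n. L2_norm \<Omega> (\<lambda>x. p n x - g x)) \<longlonglongrightarrow> 0"
proof -
  have qn: "(\<lambda>n. L2_norm \<Omega> (q n)) \<longlonglongrightarrow> L2_norm \<Omega> g" using q g qg by (rule L2_norm_tendsto)
  then obtain C where C: "\<And>n. L2_norm \<Omega> (q n) \<le> C" "C > 0"
    using convergent_imp_Bseq[OF convergentI[OF qn]] by (auto simp: Bseq_def)
  have pg: "(\<lambda>n. pairing \<Omega> (p n) g) \<longlonglongrightarrow> pairing \<Omega> g g"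
  proof (rule LIMSEQ_I)
    fix r :: real assume r: "r > 0"
    obtain m where m: "L2_norm \<Omega> (\<lambda>x. q m x - g x) < r / (3 * (C + L2_norm \<Omega> g))"
      using order_tendstoD(2)[OF qg, of "r / (3 * (C + L2_norm \<Omega> g))"] r C(2)
      by (auto simp: eventually_sequentially add_pos_nonneg)
    let ?d = "L2_norm \<Omega> (\<lambda>x. q m x - g x)"
    have Cg: "0 < C + L2_norm \<Omega> g" using C(2) by (simp add: add_pos_nonneg)
    then have d: "(C + L2_norm \<Omega> g) * ?d < r / 3" using m by (simp add: field_simps)
    obtain N where N: "\<And>n. n \<ge> N \<Longrightarrow> \<bar>pairing \<Omega> (p n) (q m) - pairing \<Omega> g (q m)\<bar> < r / 3"
      using LIMSEQ_D[OF weak[of m], of "r/3"] r by auto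
    show "\<exists>N. \<forall>n\<ge>N. norm (pairing \<Omega> (p n) g - pairing \<Omega> g g) < r"
    proof (intro exI[of _ N] allI impI)
      fix n assume "n \<ge> N"
      have 1: "\<bar>pairing \<Omega> (p n) (q m) - pairing \<Omega> (p n) g\<bar> \<le> C * ?d"
      proof -
        have "\<bar>pairing \<Omega> (p n) (\<lambda>x. q m x - g x)\<bar> \<le> L2_norm \<Omega> (p n) * ?d"
          by (rule L2_Cauchy_Schwarz[OF p L2_diff[OF q g]])
        also have "\<dots> \<le> C * ?d" using le[of n] C(1)[of n] by (intro mult_right_mono) auto
        finally show ?thesis using p q g by (simp add: pairing_diff_right)
      qed
      have 2: "\<bar>pairing \<Omega> g (q m) - pairing \<Omega> g g\<bar> \<le> L2_norm \<Omega> g * ?d"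
        using L2_Cauchy_Schwarz[OF g L2_diff[OF q g], of m] q g by (simp add: pairing_diff_right)
      have "C * ?d + L2_norm \<Omega> g * ?d < r / 3" using d by (simp add: algebra_simps)
      then show "norm (pairing \<Omega> (p n) g - pairing \<Omega> g g) < r"
        using 1 2 N[OF \<open>n \<ge> N\<close>] r unfolding real_norm_def by linarith
    qed
  qed
  have "(\<lambda>n. (L2_norm \<Omega> (q n))\<^sup>2 - 2 * pairing \<Omega> (p n) g + pairing \<Omega> g g) \<longlonglongrightarrow>
      (L2_norm \<Omega> g)\<^sup>2 - 2 * pairing \<Omega> g g + pairing \<Omega> g g"
    by (intro tendsto_intros qn pg)
  then have lim: "(\<lambda>n. (L2_norm \<Omega> (q n))\<^sup>2 - 2 * pairing \<Omega> (p n) g + pairing \<Omega> g g) \<longlonglongrightarrow> 0"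
    by (simp add: L2_norm_square)
  have "(\<lambda>n. (L2_norm \<Omega> (\<lambda>x. p n x - g x))\<^sup>2) \<longlonglongrightarrow> 0"
  proof (rule Lim_null_comparison[OF always_eventually lim], rule allI)
    fix n
    have "(L2_norm \<Omega> (\<lambda>x. p n x - g x))\<^sup>2 = (L2_norm \<Omega> (p n))\<^sup>2 - 2 * pairing \<Omega> (p n) g + pairing \<Omega> g g"
      unfolding L2_norm_square using p g L2_diff[OF p g, of n]
      by (simp add: pairing_diff_right pairing_diff_left pairing_commute[of \<Omega> g "p n"])
    also have "\<dots> \<le> (L2_norm \<Omega> (q n))\<^sup>2 - 2 * pairing \<Omega> (p n) g + pairing \<Omega> g g"
      using le[of n] by (simp add: power_mono)
    finally show "norm ((L2_norm \<Omega> (\<lambda>x. p n x - g x))\<^sup>2) \<le> \<dots>" by simp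
  qed
  from tendsto_real_sqrt[OF this] show ?thesis by simp
qed

section \<open>Integration by parts\<close>

lemma
  fixes f :: "'a::euclidean_space \<Rightarrow> 'b::euclidean_space"
  assumes "\<Omega> \<in> sets lebesgue" "f \<in> borel_measurable borel" "\<And>x. x \<notin> \<Omega> \<Longrightarrow> f x = 0"
  shows integral_lebesgue_on_eq_lborel: "(\<integral>x. f x \<partial>lebesgue_on \<Omega>) = (\<integral>x. f x \<partial>lborel)"
    and integrable_lebesgue_on_iff_lborel: "integrable (lebesgue_on \<Omega>) f \<longleftrightarrow> integrable lborel f"
proof -
  have eq: "(\<lambda>x. indicator \<Omega> x *\<^sub>R f x) = f" using assms(3) by (auto simp: indicator_def)
  show "(\<integral>x. f x \<partial>lebesgue_on \<Omega>) = (\<integral>x. f x \<partial>lborel)"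
    using assms by (subst integral_restrict_space) (auto simp: eq integral_completion)
  show "integrable (lebesgue_on \<Omega>) f \<longleftrightarrow> integrable lborel f"
    using assms by (subst integrable_restrict_space) (auto simp: eq integrable_completion)
qed

lemma borel_measurable_lebesgue_on_continuous:
  fixes f :: "'a::euclidean_space \<Rightarrow> 'b::euclidean_space"
  assumes "continuous_on UNIV f"
  shows "f \<in> borel_measurable (lebesgue_on \<Omega>)"
proof -
  have "f \<in> borel_measurable borel" using assms by (rule borel_measurable_continuous_onI)
  then have "f \<in> borel_measurable lebesgue" by (simp add: measurable_completion)
  then show ?thesis by (rule measurable_restrict_space1)
qed

text \<open>
  Integration by parts, interpolation and composition with the clamps need only one derivative,
  so they are carried out in this larger class.
\<close>
definition C1_compact :: "'a::euclidean_space set \<Rightarrow> ('a \<Rightarrow> real) set" where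
  "C1_compact \<Omega> = {\<psi>. C_k (Suc 0) \<psi> \<and> compact (closure {x. \<psi> x \<noteq> 0}) \<and> closure {x. \<psi> x \<noteq> 0} \<subseteq> \<Omega>}"

lemma test_functions_subset_C1_compact: "test_functions \<Omega> \<subseteq> C1_compact \<Omega>"
  by (auto simp: test_functions_def C1_compact_def simp del: C_k.simps)

lemma frechet_derivative_zero_outside_support:
  assumes "x \<notin> closure {x. \<psi> x \<noteq> 0}"
  shows "frechet_derivative \<psi> (at x) = (\<lambda>v. 0)"
proof -
  have "(\<psi> has_derivative (\<lambda>v. 0)) (at x)"
    by (rule has_derivative_transform_within_open[where s="- closure {x. \<psi> x \<noteq> 0}" and f="\<lambda>x. 0"])
       (use assms closure_subset[of "{x. \<psi> x \<noteq> 0}"] in auto)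
  then show ?thesis using frechet_derivative_at by metis
qed

lemma cgrad_zero_outside_support:
  "x \<notin> closure {x. \<psi> x \<noteq> 0} \<Longrightarrow> cgrad \<psi> x = 0"
  by (simp add: cgrad_def frechet_derivative_zero_outside_support)

lemma C1_compact_zero:
  assumes "\<psi> \<in> C1_compact \<Omega>" "x \<notin> \<Omega>"
  shows "\<psi> x = 0" "cgrad \<psi> x = 0" "frechet_derivative \<psi> (at x) v = 0"
proof -
  have x: "x \<notin> closure {x. \<psi> x \<noteq> 0}" using assms by (auto simp: C1_compact_def)
  then show "\<psi> x = 0" using closure_subset[of "{x. \<psi> x \<noteq> 0}"] by auto
  show "cgrad \<psi> x = 0" by (rule cgrad_zero_outside_support[OF x])
  show "frechet_derivative \<psi> (at x) v = 0" by (simp add: frechet_derivative_zero_outside_support[OF x])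
qed

lemma bounded_of_compact_support:
  fixes f :: "'a::euclidean_space \<Rightarrow> 'b::euclidean_space"
  assumes "continuous_on UNIV f" "compact K" "\<And>x. x \<notin> K \<Longrightarrow> f x = 0"
  obtains B where "B > 0" "\<And>x. norm (f x) \<le> B"
proof -
  have "compact (f ` K)"
    using assms by (intro compact_continuous_image) (auto intro: continuous_on_subset)
  then obtain B where "B > 0" "\<And>x. x \<in> K \<Longrightarrow> norm (f x) \<le> B"
    using bounded_pos[of "f ` K"] compact_imp_bounded by auto
  then show ?thesis using that[of B] assms(3) by (metis less_le norm_zero)
qed

lemma C1_increment_bound:
  assumes "\<And>x. f differentiable at x" "\<And>x. \<bar>frechet_derivative f (at x) v\<bar> \<le> B"
  shows "\<bar>f (x + t *\<^sub>R v) - f x\<bar> \<le> B * \<bar>t\<bar>"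
proof -
  have d: "((\<lambda>t. f (x + t *\<^sub>R v)) has_real_derivative frechet_derivative f (at (x + t *\<^sub>R v)) v) (at t within UNIV)" for t
    by (rule DERIV_along_line[OF frechet_derivative_works[THEN iffD1, OF assms(1)]])
  have "norm (f (x + t *\<^sub>R v) - f (x + 0 *\<^sub>R v)) \<le> B * norm (t - 0)"
    by (rule field_differentiable_bound[OF _ d]) (use assms(2) in auto)
  then show ?thesis by simp
qed

text \<open>
  Both passages to the limit under an integral of difference quotients, here and in the translation
  estimate below, use this dominated pointwise convergence.
\<close>
lemma difference_quotients:
  fixes \<xi> :: "'a::euclidean_space \<Rightarrow> real"
  assumes C1: "C_k (Suc 0) \<xi>" and K: "compact (closure {x. \<xi> x \<noteq> 0})"
  obtains B R where "\<And>n x. \<bar>(\<xi> (x + (1 / real (Suc n)) *\<^sub>R e) - \<xi> x) * real (Suc n)\<bar> \<le> indicator (cball 0 R) x *\<^sub>R B"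
    "\<And>x. (\<lambda>n. (\<xi> (x + (1 / real (Suc n)) *\<^sub>R e) - \<xi> x) * real (Suc n)) \<longlonglongrightarrow> frechet_derivative \<xi> (at x) e"
proof -
  let ?K = "closure {x. \<xi> x \<noteq> 0}"
  let ?D = "\<lambda>x. frechet_derivative \<xi> (at x) e"
  have d: "\<xi> differentiable at x" for x using C1 by simp
  have cD: "continuous_on UNIV ?D" using C1 by simp
  have D0: "?D x = 0" if "x \<notin> ?K" for x by (simp add: frechet_derivative_zero_outside_support[OF that])
  obtain B where B': "B > 0" "\<And>x. norm (?D x) \<le> B"
    using bounded_of_compact_support[OF cD K D0] by blast
  then have B: "B > 0" "\<And>x. \<bar>?D x\<bar> \<le> B" by simp_all
  have \<xi>0: "\<xi> x = 0" if "x \<notin> ?K" for x using that closure_subset[of "{x. \<xi> x \<noteq> 0}"] by auto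
  obtain R where R: "\<And>x. x \<in> ?K \<Longrightarrow> norm x \<le> R"
    using compact_imp_bounded[OF K] unfolding bounded_iff by blast
  define t where "t = (\<lambda>n::nat. 1 / real (Suc n))"
  have t: "t n > 0" "t n \<le> 1" for n by (auto simp: t_def)
  have t0: "t \<longlonglongrightarrow> 0" unfolding t_def by (rule lim_1_over_n[THEN LIMSEQ_Suc])
  have eq: "(\<xi> (x + (1 / real (Suc n)) *\<^sub>R e) - \<xi> x) * real (Suc n) = (\<xi> (x + t n *\<^sub>R e) - \<xi> x) / t n" for n x
    by (simp add: t_def)
  show ?thesis
  proof (rule that[of "R + norm e" B], unfold eq)
    fix x
    have "((\<lambda>t. \<xi> (x + t *\<^sub>R e)) has_real_derivative ?D x) (at 0)"
      using DERIV_along_line[of \<xi> _ x 0, OF frechet_derivative_works[THEN iffD1, OF d]] by simp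
    then have *: "((\<lambda>h. (\<xi> (x + h *\<^sub>R e) - \<xi> x) / h) \<longlongrightarrow> ?D x) (at 0)" by (simp add: DERIV_def)
    have "filterlim t (at 0) sequentially"
      using t t0 by (auto simp: filterlim_at less_imp_neq[symmetric])
    from filterlim_compose[OF * this] show "(\<lambda>n. (\<xi> (x + t n *\<^sub>R e) - \<xi> x) / t n) \<longlonglongrightarrow> ?D x" .
    fix n
    have "\<bar>\<xi> (x + t n *\<^sub>R e) - \<xi> x\<bar> \<le> B * \<bar>t n\<bar>" by (rule C1_increment_bound[OF d B(2)])
    then have 1: "\<bar>(\<xi> (x + t n *\<^sub>R e) - \<xi> x) / t n\<bar> \<le> B" using t[of n] by (simp add: field_simps)
    have 2: "(\<xi> (x + t n *\<^sub>R e) - \<xi> x) / t n = 0" if x: "x \<notin> cball 0 (R + norm e)"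
    proof -
      have nx: "norm x > R + norm e" using x by simp
      have "norm (t n *\<^sub>R e) \<le> norm e" using t[of n] by (simp add: mult_left_le_one_le)
      then have "norm (x + t n *\<^sub>R e) > R" using nx norm_diff_ineq[of x "t n *\<^sub>R e"] by linarith
      moreover have "norm x > R" using nx norm_ge_zero[of e] by linarith
      ultimately have "x \<notin> ?K" "x + t n *\<^sub>R e \<notin> ?K" using R[of x] R[of "x + t n *\<^sub>R e"] not_le by blast+
      then have "\<xi> x = 0" "\<xi> (x + t n *\<^sub>R e) = 0" using \<xi>0 by blast+
      then show ?thesis by simp
    qed
    show "\<bar>(\<xi> (x + t n *\<^sub>R e) - \<xi> x) / t n\<bar> \<le> indicator (cball 0 (R + norm e)) x *\<^sub>R B"
      using 1 2 by (cases "x \<in> cball 0 (R + norm e)") auto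
  qed
qed

text \<open>
  The integral of \<open>(\<xi> (x + t e) - \<xi> x) / t\<close> vanishes for every \<open>t\<close> by translation invariance; let
  \<open>t\<close> tend to zero under the integral.
\<close>
lemma integral_frechet_derivative_zero:
  fixes \<xi> :: "'a::euclidean_space \<Rightarrow> real"
  assumes C1: "C_k (Suc 0) \<xi>" and K: "compact (closure {x. \<xi> x \<noteq> 0})"
  shows "(\<integral>x. frechet_derivative \<xi> (at x) e \<partial>lborel) = 0"
proof -
  define s where "s = (\<lambda>n x. (\<xi> (x + (1 / real (Suc n)) *\<^sub>R e) - \<xi> x) * real (Suc n))"
  obtain B R where s: "\<And>n x. \<bar>s n x\<bar> \<le> indicator (cball 0 R) x *\<^sub>R B"
    "\<And>x. (\<lambda>n. s n x) \<longlonglongrightarrow> frechet_derivative \<xi> (at x) e"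
  proof (rule difference_quotients[OF C1 K, of e])
    fix B R
    assume "\<And>n x. \<bar>(\<xi> (x + (1 / real (Suc n)) *\<^sub>R e) - \<xi> x) * real (Suc n)\<bar> \<le> indicator (cball 0 R) x *\<^sub>R B"
      and "\<And>x. (\<lambda>n. (\<xi> (x + (1 / real (Suc n)) *\<^sub>R e) - \<xi> x) * real (Suc n)) \<longlonglongrightarrow> frechet_derivative \<xi> (at x) e"
    then show ?thesis by (intro that[of R B]) (simp_all only: s_def)
  qed
  have c\<xi>: "continuous_on UNIV \<xi>" using C1 by (rule C_k_imp_continuous)
  then have [measurable]: "\<xi> \<in> borel_measurable borel" by (rule borel_measurable_continuous_onI)
  have "continuous_on UNIV (\<lambda>x. frechet_derivative \<xi> (at x) e)" using C1 by simp
  then have [measurable]: "(\<lambda>x. frechet_derivative \<xi> (at x) e) \<in> borel_measurable borel"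
    by (rule borel_measurable_continuous_onI)
  have i\<xi>: "integrable lborel \<xi>"
    by (rule integrable_lborel_compact_support[OF c\<xi> K])
       (use closure_subset[of "{x. \<xi> x \<noteq> 0}"] in auto)
  have s_int: "(\<integral>x. s n x \<partial>lborel) = 0" for n
  proof -
    let ?v = "(1 / real (Suc n)) *\<^sub>R e"
    have "integrable lborel (\<lambda>x. \<xi> (?v + x))" by (rule lborel_integrable_translate[OF i\<xi>])
    then have "(\<integral>x. \<xi> (?v + x) - \<xi> x \<partial>lborel) = 0"
      using i\<xi> lborel_integral_translate[of \<xi> ?v] by simp
    then show ?thesis unfolding s_def by (simp add: add.commute del: of_nat_Suc)
  qed
  have "(\<lambda>n. \<integral>x. s n x \<partial>lborel) \<longlonglongrightarrow> (\<integral>x. frechet_derivative \<xi> (at x) e \<partial>lborel)"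
  proof (rule integral_dominated_convergence[where w="\<lambda>x. indicator (cball 0 R) x *\<^sub>R B"])
    show "integrable lborel (\<lambda>x::'a. indicator (cball 0 R) x *\<^sub>R B)"
      by (intro borel_integrable_compact) auto
    show "AE x in lborel. (\<lambda>n. s n x) \<longlonglongrightarrow> frechet_derivative \<xi> (at x) e" using s(2) by simp
    show "AE x in lborel. norm (s n x) \<le> indicator (cball 0 R) x *\<^sub>R B" for n
      by (rule AE_I2, unfold real_norm_def, rule s(1))
  qed (auto simp: s_def)
  then show ?thesis by (simp add: s_int LIMSEQ_const_iff)
qed

text \<open>
  The product \<open>\<psi> \<xi>\<close> has compact support, so the integral of its derivative vanishes.
\<close>
lemma integral_by_parts:
  fixes \<psi> \<xi> :: "'a::euclidean_space \<Rightarrow> real"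
  assumes \<Omega>: "open \<Omega>" and \<psi>: "\<psi> \<in> C1_compact \<Omega>" and \<xi>: "C_k (Suc 0) \<xi>"
  shows "(\<integral>x. \<psi> x * frechet_derivative \<xi> (at x) e \<partial>lebesgue_on \<Omega>)
    = - (\<integral>x. frechet_derivative \<psi> (at x) e * \<xi> x \<partial>lebesgue_on \<Omega>)"
proof -
  let ?K = "closure {x. \<psi> x \<noteq> 0}"
  have C\<psi>: "C_k (Suc 0) \<psi>" and K: "compact ?K" using \<psi> by (auto simp: C1_compact_def)
  have c: "continuous_on UNIV \<psi>" "continuous_on UNIV \<xi>" using C\<psi> \<xi> C_k_imp_continuous by blast+
  have cd: "continuous_on UNIV (\<lambda>x. frechet_derivative \<psi> (at x) e)"
    "continuous_on UNIV (\<lambda>x. frechet_derivative \<xi> (at x) e)" using C\<psi> \<xi> by auto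
  have ms: "\<Omega> \<in> sets lebesgue" using \<Omega> by simp
  have i1: "integrable lborel (\<lambda>x. \<psi> x * frechet_derivative \<xi> (at x) e)"
    by (rule integrable_lborel_compact_support[OF _ K])
       (use closure_subset[of "{x. \<psi> x \<noteq> 0}"] in \<open>auto intro!: continuous_intros c cd\<close>)
  have i2: "integrable lborel (\<lambda>x. frechet_derivative \<psi> (at x) e * \<xi> x)"
    by (rule integrable_lborel_compact_support[OF _ K])
       (auto intro!: continuous_intros c cd simp: frechet_derivative_zero_outside_support)
  have "C_k (Suc 0) (\<lambda>x. \<psi> x * \<xi> x)" using C\<psi> \<xi> by (rule C_k_mult)
  moreover have "compact (closure {x. \<psi> x * \<xi> x \<noteq> 0})"
  proof -
    have "closure {x. \<psi> x * \<xi> x \<noteq> 0} \<subseteq> ?K" by (rule closure_mono) auto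
    then have "?K \<inter> closure {x. \<psi> x * \<xi> x \<noteq> 0} = closure {x. \<psi> x * \<xi> x \<noteq> 0}" by (rule inf.absorb2)
    then show ?thesis using compact_Int_closed[OF K closed_closure, of "{x. \<psi> x * \<xi> x \<noteq> 0}"] by simp
  qed
  ultimately have "(\<integral>x. frechet_derivative (\<lambda>x. \<psi> x * \<xi> x) (at x) e \<partial>lborel) = 0"
    by (rule integral_frechet_derivative_zero)
  moreover have "frechet_derivative (\<lambda>x. \<psi> x * \<xi> x) (at x) e
      = \<psi> x * frechet_derivative \<xi> (at x) e + frechet_derivative \<psi> (at x) e * \<xi> x" for x
  proof -
    have "(\<psi> has_derivative frechet_derivative \<psi> (at x)) (at x)" "(\<xi> has_derivative frechet_derivative \<xi> (at x)) (at x)"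
      using C\<psi> \<xi> by (auto intro: frechet_derivative_works[THEN iffD1])
    from frechet_derivative_at[OF has_derivative_mult[OF this], symmetric] show ?thesis by (rule fun_cong)
  qed
  ultimately have "(\<integral>x. \<psi> x * frechet_derivative \<xi> (at x) e \<partial>lborel)
      + (\<integral>x. frechet_derivative \<psi> (at x) e * \<xi> x \<partial>lborel) = 0"
    using i1 i2 by simp
  moreover have "(\<integral>x. \<psi> x * frechet_derivative \<xi> (at x) e \<partial>lebesgue_on \<Omega>)
      = (\<integral>x. \<psi> x * frechet_derivative \<xi> (at x) e \<partial>lborel)"
    by (rule integral_lebesgue_on_eq_lborel[OF ms])
       (auto simp: C1_compact_zero[OF \<psi>] intro!: borel_measurable_continuous_onI continuous_intros c cd)
  moreover have "(\<integral>x. frechet_derivative \<psi> (at x) e * \<xi> x \<partial>lebesgue_on \<Omega>)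
      = (\<integral>x. frechet_derivative \<psi> (at x) e * \<xi> x \<partial>lborel)"
    by (rule integral_lebesgue_on_eq_lborel[OF ms])
       (auto simp: C1_compact_zero[OF \<psi>] intro!: borel_measurable_continuous_onI continuous_intros c cd)
  ultimately show ?thesis by simp
qed

lemma C1_compact_L2:
  assumes \<Omega>: "open \<Omega>" "bounded \<Omega>" and \<psi>: "\<psi> \<in> C1_compact \<Omega>"
  shows "\<psi> \<in> L2_space \<Omega>" "cgrad \<psi> \<in> L2_space \<Omega>"
proof -
  let ?K = "closure {x. \<psi> x \<noteq> 0}"
  have C\<psi>: "C_k (Suc 0) \<psi>" and K: "compact ?K" using \<psi> by (auto simp: C1_compact_def)
  have m: "\<Omega> \<in> lmeasurable" using \<Omega> by (simp add: lmeasurable_open)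
  have c: "continuous_on UNIV \<psi>" using C\<psi> by (rule C_k_imp_continuous)
  have c': "continuous_on UNIV (cgrad \<psi>)" using C\<psi> by (rule C_k_cgrad_continuous)
  have \<psi>0: "\<psi> x = 0" if "x \<notin> ?K" for x using that closure_subset[of "{x. \<psi> x \<noteq> 0}"] by auto
  obtain B where B: "B > 0" "\<And>x. norm (\<psi> x) \<le> B"
    using bounded_of_compact_support[OF c K \<psi>0] by blast
  obtain B' where B': "B' > 0" "\<And>x. norm (cgrad \<psi> x) \<le> B'"
    using bounded_of_compact_support[OF c' K cgrad_zero_outside_support] by blast
  show "\<psi> \<in> L2_space \<Omega>"
    using B by (intro L2_bounded[OF m borel_measurable_lebesgue_on_continuous[OF c], of B]) auto
  show "cgrad \<psi> \<in> L2_space \<Omega>"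
    using B' by (intro L2_bounded[OF m borel_measurable_lebesgue_on_continuous[OF c'], of B']) auto
qed

section \<open>Approximation by test functions and the fundamental lemma\<close>

lemma convol_test_function:
  fixes V :: "'a::euclidean_space \<Rightarrow> real"
  assumes V: "continuous_on UNIV V" "compact K" "\<And>x. x \<notin> K \<Longrightarrow> V x = 0" and \<Omega>: "open \<Omega>" "K \<subseteq> \<Omega>"
  obtains d where "d > 0" "\<And>\<eta> \<rho>. \<eta> < d \<Longrightarrow> mollifier \<eta> \<rho> \<Longrightarrow> convol \<rho> V \<in> test_functions \<Omega>"
proof -
  obtain d where d: "d > 0" "(\<Union>x\<in>K. cball x d) \<subseteq> \<Omega>"
    using compact_subset_open_imp_cball_epsilon_subset[OF V(2) \<Omega>] by metis
  obtain a b where ab: "K \<subseteq> cbox a b"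
    using bounded_subset_cbox_symmetric[OF compact_imp_bounded[OF V(2)]] by metis
  define N where "N = {x + y | x y. x \<in> K \<and> y \<in> cball (0::'a) d}"
  have N: "compact N" unfolding N_def by (intro compact_sums V(2)) auto
  have N\<Omega>: "N \<subseteq> \<Omega>"
  proof
    fix z assume "z \<in> N"
    then obtain x y where "z = x + y" "x \<in> K" "norm y \<le> d" by (auto simp: N_def)
    then have "z \<in> cball x d" by (simp add: dist_norm)
    then show "z \<in> \<Omega>" using d(2) \<open>x \<in> K\<close> by blast
  qed
  have "convol \<rho> V \<in> test_functions \<Omega>" if \<eta>: "\<eta> < d" and mol: "mollifier \<eta> \<rho>" for \<eta> \<rho>
  proof -
    have z: "convol \<rho> V x = 0" if x: "x \<notin> N" for x
    proof -
      have "V (x - y) = 0" if "norm y < \<eta>" for y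
      proof (rule V(3))
        show "x - y \<notin> K"
        proof
          assume "x - y \<in> K"
          then have "(x - y) + y \<in> N" unfolding N_def using that \<eta> by fastforce
          then show False using x by simp
        qed
      qed
      then have "\<bar>convol \<rho> V x - 0\<bar> \<le> 0" by (intro convol_close[OF mol V(1)]) auto
      then show ?thesis by simp
    qed
    have s: "closure {x. convol \<rho> V x \<noteq> 0} \<subseteq> N"
      by (rule closure_minimal) (use z N compact_imp_closed in auto)
    have "C_k m (convol \<rho> V)" for m
      using mol ab V by (intro C_k_convol[where a=a and b=b]) (auto simp: mollifier_def)
    moreover have "compact (closure {x. convol \<rho> V x \<noteq> 0})"
      using compact_Int_closed[OF N closed_closure, of "{x. convol \<rho> V x \<noteq> 0}"] inf.absorb2[OF s] by simp
    ultimately show ?thesis using s N\<Omega> by (auto simp: test_functions_def)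
  qed
  then show ?thesis using that d(1) by blast
qed

lemma uniform_mollification:
  fixes V :: "'a::euclidean_space \<Rightarrow> real"
  assumes V: "continuous_on UNIV V" "compact K" "\<And>x. x \<notin> K \<Longrightarrow> V x = 0" and \<Omega>: "open \<Omega>" "K \<subseteq> \<Omega>"
    and "e > 0"
  obtains d where "d > 0"
    "\<And>\<eta> \<rho>. \<eta> < d \<Longrightarrow> mollifier \<eta> \<rho> \<Longrightarrow> convol \<rho> V \<in> test_functions \<Omega> \<and> (\<forall>x. \<bar>convol \<rho> V x - V x\<bar> \<le> e)"
proof -
  obtain d where d: "d > 0" "\<And>\<eta> \<rho>. \<eta> < d \<Longrightarrow> mollifier \<eta> \<rho> \<Longrightarrow> convol \<rho> V \<in> test_functions \<Omega>"
    using convol_test_function[OF V \<Omega>] by metis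
  define N where "N = {x + y | x y. x \<in> K \<and> y \<in> cball (0::'a) 1}"
  have N: "compact N" unfolding N_def by (intro compact_sums V(2)) auto
  have "uniformly_continuous_on N V"
    using V(1) N by (intro compact_uniformly_continuous) (auto intro: continuous_on_subset)
  then obtain d' where d': "d' > 0" "\<And>x y. x \<in> N \<Longrightarrow> y \<in> N \<Longrightarrow> dist y x < d' \<Longrightarrow> dist (V y) (V x) < e"
    unfolding uniformly_continuous_on_def using \<open>e > 0\<close> by metis
  show ?thesis
  proof (rule that[of "min d (min d' 1)"])
    fix \<eta> and \<rho> :: "'a \<Rightarrow> real" assume \<eta>: "\<eta> < min d (min d' 1)" and mol: "mollifier \<eta> \<rho>"
    have "\<bar>convol \<rho> V x - V x\<bar> \<le> e" for x
    proof (rule convol_close[OF mol V(1)])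
      fix y :: 'a assume y: "norm y < \<eta>"
      have near: "u \<in> N" if "w \<in> K" "norm (u - w) \<le> 1" for u w
      proof -
        have "w + (u - w) \<in> N" unfolding N_def using that by fastforce
        then show ?thesis by simp
      qed
      show "\<bar>V (x - y) - V x\<bar> \<le> e"
      proof (cases "x \<in> K \<or> x - y \<in> K")
        case True
        then have "x \<in> N" "x - y \<in> N"
          using near[of x x] near[of x "x - y"] near[of "x - y" x] near[of "x - y" "x - y"] y \<eta>
          by (auto simp: norm_minus_commute)
        then have "dist (V (x - y)) (V x) < e" using d'(2)[of x "x - y"] y \<eta> by (auto simp: dist_norm)
        then show ?thesis by (simp add: dist_norm)
      qed (use V(3) \<open>e > 0\<close> in auto)
    qed
    then show "convol \<rho> V \<in> test_functions \<Omega> \<and> (\<forall>x. \<bar>convol \<rho> V x - V x\<bar> \<le> e)"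
      using d(2)[OF _ mol] \<eta> by auto
  qed (use d d' in auto)
qed

lemma L2_imp_integrable:
  fixes g :: "'a::euclidean_space \<Rightarrow> real"
  assumes "\<Omega> \<in> lmeasurable" "g \<in> L2_space \<Omega>"
  shows "integrable (lebesgue_on \<Omega>) g"
proof -
  have "(\<lambda>x. 1::real) \<in> L2_space \<Omega>" by (rule L2_bounded[OF assms(1), of _ 1]) auto
  from L2_inner_integrable[OF assms(2) this] show ?thesis by simp
qed

text \<open>
  From test functions to continuous functions with compact support, by uniform mollification.
\<close>
lemma annihilates_continuous:
  fixes g V :: "'a::euclidean_space \<Rightarrow> real"
  assumes \<Omega>: "open \<Omega>" "bounded \<Omega>" and g: "g \<in> L2_space \<Omega>"
    and ann: "\<And>\<phi>. \<phi> \<in> test_functions \<Omega> \<Longrightarrow> (\<integral>x. g x * \<phi> x \<partial>lebesgue_on \<Omega>) = 0"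
    and V: "continuous_on UNIV V" "compact K" "\<And>x. x \<notin> K \<Longrightarrow> V x = 0" "K \<subseteq> \<Omega>"
  shows "(\<integral>x. g x * V x \<partial>lebesgue_on \<Omega>) = 0"
proof -
  have m: "\<Omega> \<in> lmeasurable" using \<Omega> by (simp add: lmeasurable_open)
  have gi: "integrable (lebesgue_on \<Omega>) g" using m g by (rule L2_imp_integrable)
  have V2: "V \<in> L2_space \<Omega>"
  proof -
    obtain B where "B > 0" "\<And>x. norm (V x) \<le> B"
      using bounded_of_compact_support[OF V(1-3)] by blast
    then show ?thesis
      by (intro L2_bounded[OF m borel_measurable_lebesgue_on_continuous[OF V(1)], of B]) auto
  qed
  have "\<bar>\<integral>x. g x * V x \<partial>lebesgue_on \<Omega>\<bar> \<le> 0 + e" if e: "e > 0" for e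
  proof -
    define I where "I = (\<integral>x. \<bar>g x\<bar> \<partial>lebesgue_on \<Omega>) + 1"
    have I: "I > 0" unfolding I_def by (rule add_nonneg_pos) auto
    obtain d where d: "d > 0" "\<And>\<eta> \<rho>. \<eta> < d \<Longrightarrow> mollifier \<eta> \<rho> \<Longrightarrow>
        convol \<rho> V \<in> test_functions \<Omega> \<and> (\<forall>x. \<bar>convol \<rho> V x - V x\<bar> \<le> e / I)"
      using uniform_mollification[OF V(1-3) \<Omega>(1) V(4), of "e / I"] e I by (metis divide_pos_pos)
    obtain \<rho> :: "'a \<Rightarrow> real" where \<rho>: "mollifier (d/2) \<rho>"
      using mollifier_exists[of "d/2"] d(1) unfolding mollifier_def by (metis half_gt_zero)
    define W where "W = convol \<rho> V"
    have W: "W \<in> test_functions \<Omega>" "\<And>x. \<bar>W x - V x\<bar> \<le> e / I"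
      using d(2)[OF _ \<rho>] d(1) by (auto simp: W_def)
    have W2: "W \<in> L2_space \<Omega>" using C1_compact_L2[OF \<Omega>] W(1) test_functions_subset_C1_compact by blast
    have "(\<integral>x. g x * V x \<partial>lebesgue_on \<Omega>) = (\<integral>x. g x * V x \<partial>lebesgue_on \<Omega>) - (\<integral>x. g x * W x \<partial>lebesgue_on \<Omega>)"
      using ann[OF W(1)] by simp
    also have "\<dots> = (\<integral>x. g x * (V x - W x) \<partial>lebesgue_on \<Omega>)"
      using L2_inner_integrable[OF g V2] L2_inner_integrable[OF g W2] by (simp add: right_diff_distrib)
    finally have "\<bar>\<integral>x. g x * V x \<partial>lebesgue_on \<Omega>\<bar> = \<bar>\<integral>x. g x * (V x - W x) \<partial>lebesgue_on \<Omega>\<bar>" by simp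
    also have "\<dots> \<le> (\<integral>x. \<bar>g x * (V x - W x)\<bar> \<partial>lebesgue_on \<Omega>)" by (rule integral_abs_bound)
    also have "\<dots> \<le> (\<integral>x. \<bar>g x\<bar> * (e / I) \<partial>lebesgue_on \<Omega>)"
    proof (rule integral_mono)
      show "integrable (lebesgue_on \<Omega>) (\<lambda>x. \<bar>g x * (V x - W x)\<bar>)"
        using L2_inner_integrable[OF g L2_diff[OF V2 W2]] by simp
      show "\<bar>g x * (V x - W x)\<bar> \<le> \<bar>g x\<bar> * (e / I)" for x
        unfolding abs_mult using W(2)[of x] by (intro mult_left_mono) auto
    qed (use gi in simp)
    also have "\<dots> = (I - 1) * (e / I)" by (simp add: I_def)
    also have "\<dots> \<le> e" using I e by (simp add: field_simps)
    finally show ?thesis by simp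
  qed
  then have "\<bar>\<integral>x. g x * V x \<partial>lebesgue_on \<Omega>\<bar> \<le> 0" by (rule field_le_epsilon)
  then show ?thesis by simp
qed

text \<open>
  From continuous functions to indicators of open sets, by the truncated multiples
  \<open>min 1 (max 0 (n d - 1))\<close> of the distance \<open>d\<close> to the complement; subtracting \<open>1\<close> makes their supports
  compact in \<open>U\<close>.
\<close>
lemma annihilates_open:
  fixes g :: "'a::euclidean_space \<Rightarrow> real"
  assumes \<Omega>: "open \<Omega>" "bounded \<Omega>" and g: "g \<in> L2_space \<Omega>"
    and ann: "\<And>\<phi>. \<phi> \<in> test_functions \<Omega> \<Longrightarrow> (\<integral>x. g x * \<phi> x \<partial>lebesgue_on \<Omega>) = 0"
    and U: "open U" "U \<subseteq> \<Omega>"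
  shows "(\<integral>x. g x * indicator U x \<partial>lebesgue_on \<Omega>) = 0"
proof -
  have m: "\<Omega> \<in> lmeasurable" using \<Omega> by (simp add: lmeasurable_open)
  have gi: "integrable (lebesgue_on \<Omega>) g" using m g by (rule L2_imp_integrable)
  have U': "closed (- U)" "- U \<noteq> {}"
  proof -
    show "closed (- U)" using U(1) by (rule closed_Compl)
    have "bounded U" using U(2) \<Omega>(2) bounded_subset by blast
    then have "U \<noteq> UNIV" using not_bounded_UNIV[where 'a='a] by auto
    then show "- U \<noteq> {}" by auto
  qed
  define \<delta> where "\<delta> = (\<lambda>x. infdist x (- U))"
  have \<delta>0: "\<delta> x = 0" if "x \<notin> U" for x using that by (simp add: \<delta>_def)
  have \<delta>pos: "\<delta> x > 0" if "x \<in> U" for x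
    unfolding \<delta>_def using infdist_pos_not_in_closed[OF U'] that by blast
  have c\<delta>: "continuous_on UNIV \<delta>" unfolding \<delta>_def by (intro continuous_on_infdist continuous_on_id)
  define V where "V = (\<lambda>n x. min 1 (max 0 (real n * \<delta> x - 1)))"
  have cV: "continuous_on UNIV (V n)" for n unfolding V_def by (intro continuous_intros c\<delta>)
  have zero: "(\<integral>x. g x * V n x \<partial>lebesgue_on \<Omega>) = 0" for n
  proof (cases "n = 0")
    case False
    define K where "K = {x. 1 / real n \<le> \<delta> x}"
    have KU: "K \<subseteq> U"
    proof
      fix x assume "x \<in> K"
      then have "\<delta> x > 0" using False by (auto simp: K_def intro: less_le_trans[of _ "1 / real n"])
      then show "x \<in> U" using \<delta>0 by force
    qed
    have "closed K" unfolding K_def by (intro closed_Collect_le continuous_intros c\<delta>)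
    moreover have "bounded K" using KU U(2) \<Omega>(2) bounded_subset by blast
    ultimately have "compact K" by (simp add: compact_eq_bounded_closed)
    moreover have "V n x = 0" if "x \<notin> K" for x
      using that False by (auto simp: K_def V_def field_simps)
    ultimately show ?thesis
      using annihilates_continuous[OF \<Omega> g ann cV, of K] KU U(2) by blast
  qed (simp add: V_def)
  have "(\<lambda>n. \<integral>x. g x * V n x \<partial>lebesgue_on \<Omega>) \<longlonglongrightarrow> (\<integral>x. g x * indicator U x \<partial>lebesgue_on \<Omega>)"
  proof (rule integral_dominated_convergence[where w="\<lambda>x. \<bar>g x\<bar>"])
    show "integrable (lebesgue_on \<Omega>) (\<lambda>x. \<bar>g x\<bar>)" using gi by simp
    have gm: "g \<in> borel_measurable (lebesgue_on \<Omega>)" using g L2_spaceD by blast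
    show "(\<lambda>x. g x * V n x) \<in> borel_measurable (lebesgue_on \<Omega>)" for n
      using gm borel_measurable_lebesgue_on_continuous[OF cV] by (rule borel_measurable_times)
    have "(indicator U :: 'a \<Rightarrow> real) \<in> borel_measurable lebesgue"
      using borel_open[OF U(1)] by (intro borel_measurable_indicator) auto
    then have "(indicator U :: 'a \<Rightarrow> real) \<in> borel_measurable (lebesgue_on \<Omega>)"
      by (rule measurable_restrict_space1)
    with gm show "(\<lambda>x. g x * indicator U x) \<in> borel_measurable (lebesgue_on \<Omega>)"
      by (rule borel_measurable_times)
    show "AE x in lebesgue_on \<Omega>. norm (g x * V n x) \<le> \<bar>g x\<bar>" for n
      by (rule AE_I2) (auto simp: V_def abs_mult intro!: mult_left_le)
    show "AE x in lebesgue_on \<Omega>. (\<lambda>n. g x * V n x) \<longlonglongrightarrow> g x * indicator U x"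
    proof (intro AE_I2 tendsto_mult tendsto_const)
      fix x
      show "(\<lambda>n. V n x) \<longlonglongrightarrow> indicator U x"
      proof (cases "x \<in> U")
        case True
        obtain k where k: "real k * \<delta> x > 2" using \<delta>pos[OF True] reals_Archimedean3 by blast
        have "\<forall>\<^sub>F n in sequentially. V n x = 1"
        proof (rule eventually_sequentiallyI[of k])
          fix n assume "n \<ge> k"
          then have "real k * \<delta> x \<le> real n * \<delta> x" using \<delta>pos[OF True] by (intro mult_right_mono) auto
          then show "V n x = 1" using k by (simp add: V_def)
        qed
        then show ?thesis using True by (simp add: tendsto_eventually)
      qed (simp add: V_def \<delta>0)
    qed
  qed
  then show ?thesis by (simp add: zero LIMSEQ_const_iff)
qed

text \<open>
  The positivity set of \<open>g\<close> is an open set up to small measure, and over open sets \<open>g\<close> integrates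
  to zero.
\<close>
lemma annihilates_nonpos:
  fixes g :: "'a::euclidean_space \<Rightarrow> real"
  assumes \<Omega>: "open \<Omega>" "bounded \<Omega>" and g: "g \<in> L2_space \<Omega>"
    and ann: "\<And>\<phi>. \<phi> \<in> test_functions \<Omega> \<Longrightarrow> (\<integral>x. g x * \<phi> x \<partial>lebesgue_on \<Omega>) = 0"
  shows "AE x in lebesgue_on \<Omega>. g x \<le> 0"
proof -
  have m: "\<Omega> \<in> lmeasurable" using \<Omega> by (simp add: lmeasurable_open)
  have gm[measurable]: "g \<in> borel_measurable (lebesgue_on \<Omega>)" using g L2_spaceD by blast
  have ms: "\<Omega> \<in> sets lebesgue" using m by auto
  define S where "S = {x \<in> \<Omega>. g x > 0}"
  have "{x \<in> space (lebesgue_on \<Omega>). g x > 0} \<in> sets (lebesgue_on \<Omega>)" by measurable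
  then have S: "S \<in> sets lebesgue" "S \<in> sets (lebesgue_on \<Omega>)"
    using ms by (auto simp: S_def sets_restrict_space_iff)
  define h where "h = (\<lambda>A x. g x * indicator A x)"
  have L2ind: "(indicator A :: 'a \<Rightarrow> real) \<in> L2_space \<Omega>"
    "L2_norm \<Omega> (indicator A :: 'a \<Rightarrow> real) = sqrt (measure lebesgue A)"
    if "A \<in> sets lebesgue" "A \<subseteq> \<Omega>" for A
  proof -
    have Am: "A \<in> sets (lebesgue_on \<Omega>)" using that ms by (auto simp: sets_restrict_space_iff)
    then show "(indicator A :: 'a \<Rightarrow> real) \<in> L2_space \<Omega>"
      by (intro L2_bounded[OF m, of _ 1]) auto
    have "(\<integral>x. (norm (indicator A x :: real))\<^sup>2 \<partial>lebesgue_on \<Omega>) = (\<integral>x. indicator A x \<partial>lebesgue_on \<Omega>)"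
      by (rule Bochner_Integration.integral_cong) (auto simp: indicator_def)
    also have "\<dots> = measure lebesgue A"
      using that ms Am by (simp add: measure_restrict_space inf.absorb1)
    finally show "L2_norm \<Omega> (indicator A :: 'a \<Rightarrow> real) = sqrt (measure lebesgue A)"
      by (simp add: L2_norm_def)
  qed
  have "\<bar>\<integral>x. h S x \<partial>lebesgue_on \<Omega>\<bar> \<le> 0 + e" if e: "e > 0" for e
  proof -
    define c where "c = L2_norm \<Omega> g + 1"
    have c: "c > 0" by (simp add: c_def add_nonneg_pos)
    obtain T where T: "open T" "S \<subseteq> T" "T - S \<in> lmeasurable" "emeasure lebesgue (T - S) < ennreal ((e/c)\<^sup>2)"
      using sets_lebesgue_outer_open[OF S(1), of "(e/c)\<^sup>2"] e c by (metis divide_pos_pos zero_less_power)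
    \<comment> \<open>over the open set \<open>?A\<close> the integral vanishes, so the integral over \<open>S\<close> is minus that over the small rest \<open>?R\<close>\<close>
    let ?A = "T \<inter> \<Omega>" and ?R = "T \<inter> \<Omega> - S"
    have A: "?A \<in> sets lebesgue" "?R \<in> sets lebesgue" "?A \<subseteq> \<Omega>" "?R \<subseteq> \<Omega>"
      using borel_open[OF T(1)] ms S(1) by (auto intro!: sets.Diff sets.Int)
    have "S \<subseteq> \<Omega>" by (auto simp: S_def)
    then have "h S x = h ?A x - h ?R x" for x
      using T(2) by (cases "x \<in> S"; cases "x \<in> ?A") (auto simp: h_def indicator_def)
    then have "(\<integral>x. h S x \<partial>lebesgue_on \<Omega>) = (\<integral>x. h ?A x \<partial>lebesgue_on \<Omega>) - (\<integral>x. h ?R x \<partial>lebesgue_on \<Omega>)"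
      using L2_inner_integrable[OF g L2ind(1)[OF A(1,3)]] L2_inner_integrable[OF g L2ind(1)[OF A(2,4)]]
      by (simp add: h_def)
    also have "(\<integral>x. h ?A x \<partial>lebesgue_on \<Omega>) = 0"
      unfolding h_def using T(1) \<Omega>(1) by (intro annihilates_open[OF \<Omega> g ann]) auto
    finally have "\<bar>\<integral>x. h S x \<partial>lebesgue_on \<Omega>\<bar> = \<bar>pairing \<Omega> g (indicator ?R)\<bar>"
      by (simp add: h_def pairing_def)
    also have "\<dots> \<le> L2_norm \<Omega> g * sqrt (measure lebesgue ?R)"
      using L2_Cauchy_Schwarz[OF g L2ind(1)[OF A(2,4)]] L2ind(2)[OF A(2,4)] by simp
    also have "\<dots> \<le> c * (e / c)"
    proof (rule mult_mono)
      have "measure lebesgue ?R \<le> measure lebesgue (T - S)"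
        using T(3) A(2) by (intro measure_mono_fmeasurable) auto
      also have "\<dots> \<le> (e/c)\<^sup>2"
        using T(3,4) e c by (simp add: emeasure_eq_measure2 ennreal_less_iff)
      finally have "sqrt (measure lebesgue ?R) \<le> sqrt ((e/c)\<^sup>2)" by (rule real_sqrt_le_mono)
      then show "sqrt (measure lebesgue ?R) \<le> e / c" using e c by simp
    qed (use c in \<open>auto simp: c_def\<close>)
    finally show ?thesis using c by simp
  qed
  then have "\<bar>\<integral>x. h S x \<partial>lebesgue_on \<Omega>\<bar> \<le> 0" by (rule field_le_epsilon)
  then have "(\<integral>x. h S x \<partial>lebesgue_on \<Omega>) = 0" by simp
  moreover have "integrable (lebesgue_on \<Omega>) (h S)"
    using L2_inner_integrable[OF g L2ind(1)[OF S(1)]] by (simp add: h_def S_def)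
  moreover have "AE x in lebesgue_on \<Omega>. 0 \<le> h S x"
    by (rule AE_I2) (auto simp: h_def S_def indicator_def)
  ultimately have "AE x in lebesgue_on \<Omega>. h S x = 0" using integral_nonneg_eq_0_iff_AE by blast
  moreover have "AE x in lebesgue_on \<Omega>. x \<in> \<Omega>" by (rule AE_I2) simp
  ultimately show ?thesis
    by eventually_elim (auto simp: h_def S_def indicator_def split: if_splits)
qed

lemma fundamental_lemma_of_variations:
  fixes g :: "'a::euclidean_space \<Rightarrow> real"
  assumes \<Omega>: "open \<Omega>" "bounded \<Omega>" and g: "g \<in> L2_space \<Omega>"
    and ann: "\<And>\<phi>. \<phi> \<in> test_functions \<Omega> \<Longrightarrow> (\<integral>x. g x * \<phi> x \<partial>lebesgue_on \<Omega>) = 0"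
  shows "AE x in lebesgue_on \<Omega>. g x = 0"
proof -
  have "AE x in lebesgue_on \<Omega>. g x \<le> 0" using assms by (rule annihilates_nonpos)
  moreover have "AE x in lebesgue_on \<Omega>. - g x \<le> 0"
    using L2_scale[OF g, of "-1"] ann by (intro annihilates_nonpos[OF \<Omega>]) auto
  ultimately show ?thesis by eventually_elim auto
qed

section \<open>Weak gradients as limits of classical gradients\<close>

lemma L2_component:
  fixes g :: "'a::euclidean_space \<Rightarrow> 'b::euclidean_space"
  assumes "g \<in> L2_space \<Omega>" "e \<in> Basis"
  shows "(\<lambda>x. g x \<bullet> e) \<in> L2_space \<Omega>"
proof (rule L2_mono[OF _ assms(1)])
  show "(\<lambda>x. g x \<bullet> e) \<in> borel_measurable (lebesgue_on \<Omega>)"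
    using L2_spaceD(1)[OF assms(1)] by (intro borel_measurable_inner) auto
  show "AE x in lebesgue_on \<Omega>. norm (g x \<bullet> e) \<le> norm (g x)"
    using Basis_le_norm[OF assms(2)] by auto
qed

text \<open>
  Closure under differentiation is what makes second derivatives of test functions available as test
  objects, see \<open>pairing_weak_gradient_test\<close>.
\<close>
lemma test_functions_derivative:
  assumes "\<phi> \<in> test_functions \<Omega>"
  shows "(\<lambda>x. frechet_derivative \<phi> (at x) e) \<in> test_functions \<Omega>"
proof -
  let ?K = "closure {x. \<phi> x \<noteq> 0}" and ?N = "closure {x. frechet_derivative \<phi> (at x) e \<noteq> 0}"
  have K: "compact ?K" "?K \<subseteq> \<Omega>" using assms by (auto simp: test_functions_def)
  have "?N \<subseteq> ?K"
  proof (rule closure_minimal)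
    show "{x. frechet_derivative \<phi> (at x) e \<noteq> 0} \<subseteq> ?K"
    proof
      fix x assume "x \<in> {x. frechet_derivative \<phi> (at x) e \<noteq> 0}"
      then show "x \<in> ?K" using frechet_derivative_zero_outside_support[of x \<phi>] by fastforce
    qed
  qed simp
  moreover from this have "compact ?N"
    using compact_Int_closed[OF K(1) closed_closure, of "{x. frechet_derivative \<phi> (at x) e \<noteq> 0}"] inf.absorb2
    by metis
  moreover have "C_k m (\<lambda>x. frechet_derivative \<phi> (at x) e)" for m
  proof -
    have "C_k (Suc m) \<phi>" using assms by (auto simp: test_functions_def simp del: C_k.simps)
    then show ?thesis by simp
  qed
  ultimately show ?thesis using K(2) by (auto simp: test_functions_def)
qed

lemma test_functions_C_k: "\<phi> \<in> test_functions \<Omega> \<Longrightarrow> C_k m \<phi>"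
  by (simp add: test_functions_def)

text \<open>
  The graph closure of the classical gradient on test functions. Being explicit about the gradient \<open>g\<close>,
  it avoids the choice in \<open>grad\<close>; it is equivalent to membership in \<open>H1_0\<close> by the last two lemmas of this
  section.
\<close>
definition test_limit :: "'a::euclidean_space set \<Rightarrow> ('a \<Rightarrow> real) \<Rightarrow> ('a \<Rightarrow> 'a) \<Rightarrow> bool" where
  "test_limit \<Omega> u g \<longleftrightarrow> u \<in> L2_space \<Omega> \<and> g \<in> L2_space \<Omega> \<and> (\<exists>\<phi>. (\<forall>n::nat. \<phi> n \<in> test_functions \<Omega>) \<and>
     (\<lambda>n. L2_norm \<Omega> (\<lambda>x. \<phi> n x - u x)) \<longlonglongrightarrow> 0 \<and> (\<lambda>n. L2_norm \<Omega> (\<lambda>x. cgrad (\<phi> n) x - g x)) \<longlonglongrightarrow> 0)"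

context
  fixes \<Omega> :: "'a::euclidean_space set"
  assumes \<Omega>: "open \<Omega>" "bounded \<Omega>"
begin

lemma test_function_L2:
  assumes "\<phi> \<in> test_functions \<Omega>"
  shows "\<phi> \<in> L2_space \<Omega>" "cgrad \<phi> \<in> L2_space \<Omega>" "(\<lambda>x. frechet_derivative \<phi> (at x) e) \<in> L2_space \<Omega>"
  using C1_compact_L2[OF \<Omega>] assms test_functions_derivative test_functions_subset_C1_compact by blast+

lemma weak_gradient_integrable:
  fixes u :: "'a \<Rightarrow> real" and g :: "'a \<Rightarrow> 'a"
  assumes "u \<in> L2_space \<Omega>" "g \<in> L2_space \<Omega>" "\<phi> \<in> test_functions \<Omega>" "e \<in> Basis"
  shows "integrable (lebesgue_on \<Omega>) (\<lambda>x. u x * frechet_derivative \<phi> (at x) e)"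
    "integrable (lebesgue_on \<Omega>) (\<lambda>x. (g x \<bullet> e) * \<phi> x)"
  using L2_inner_integrable[OF assms(1) test_function_L2(3)[OF assms(3)]]
    L2_inner_integrable[OF L2_component[OF assms(2,4)] test_function_L2(1)[OF assms(3)]] by auto

lemma weak_gradient_diff:
  assumes "u \<in> L2_space \<Omega>" "v \<in> L2_space \<Omega>" "g \<in> L2_space \<Omega>" "h \<in> L2_space \<Omega>"
    and "has_weak_gradient \<Omega> u g" "has_weak_gradient \<Omega> v h"
  shows "has_weak_gradient \<Omega> (\<lambda>x. u x - v x) (\<lambda>x. g x - h x)"
  unfolding has_weak_gradient_def
proof (intro ballI)
  fix \<phi> and e :: 'a assume \<phi>: "\<phi> \<in> test_functions \<Omega>" "e \<in> Basis"
  then show "(\<integral>x. (u x - v x) * frechet_derivative \<phi> (at x) e \<partial>lebesgue_on \<Omega>)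
      = - (\<integral>x. ((g x - h x) \<bullet> e) * \<phi> x \<partial>lebesgue_on \<Omega>)"
    using weak_gradient_integrable[OF assms(1,3) \<phi>] weak_gradient_integrable[OF assms(2,4) \<phi>] assms(5,6)
    by (simp add: left_diff_distrib inner_diff_left has_weak_gradient_def)
qed

lemma weak_gradient_unique:
  assumes "g \<in> L2_space \<Omega>" "h \<in> L2_space \<Omega>"
    and "has_weak_gradient \<Omega> u g" "has_weak_gradient \<Omega> u h"
  shows "AE x in lebesgue_on \<Omega>. g x = h x"
proof -
  have "AE x in lebesgue_on \<Omega>. (g x - h x) \<bullet> e = 0" if e: "e \<in> Basis" for e
  proof (rule fundamental_lemma_of_variations[OF \<Omega>])
    show "(\<lambda>x. (g x - h x) \<bullet> e) \<in> L2_space \<Omega>"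
      using L2_component[OF L2_diff[OF assms(1,2)] e] .
    fix \<phi> assume \<phi>: "\<phi> \<in> test_functions \<Omega>"
    have "(\<lambda>x. 0::real) \<in> L2_space \<Omega>" by (simp add: L2_space_def)
    from weak_gradient_integrable(2)[OF this assms(1) \<phi> e] weak_gradient_integrable(2)[OF this assms(2) \<phi> e]
    show "(\<integral>x. (g x - h x) \<bullet> e * \<phi> x \<partial>lebesgue_on \<Omega>) = 0"
      using assms(3,4) \<phi> e by (simp add: has_weak_gradient_def inner_diff_left left_diff_distrib)
  qed
  then have "AE x in lebesgue_on \<Omega>. \<forall>e\<in>Basis. (g x - h x) \<bullet> e = 0"
    by (simp add: AE_finite_all)
  then show ?thesis
    by eventually_elim (auto intro!: euclidean_eqI[where 'a='a] simp: inner_diff_left)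
qed

lemma H1_grad:
  assumes "u \<in> H1 \<Omega>"
  shows "u \<in> L2_space \<Omega>" "grad \<Omega> u \<in> L2_space \<Omega>" "has_weak_gradient \<Omega> u (grad \<Omega> u)"
proof -
  have "\<exists>g. g \<in> L2_space \<Omega> \<and> has_weak_gradient \<Omega> u g" using assms by (auto simp: H1_def)
  from someI_ex[OF this] show "grad \<Omega> u \<in> L2_space \<Omega>" "has_weak_gradient \<Omega> u (grad \<Omega> u)"
    unfolding grad_def by auto
  show "u \<in> L2_space \<Omega>" using assms by (simp add: H1_def)
qed

lemma grad_eq_AE:
  assumes "u \<in> L2_space \<Omega>" "g \<in> L2_space \<Omega>" "has_weak_gradient \<Omega> u g"
  shows "u \<in> H1 \<Omega>" "AE x in lebesgue_on \<Omega>. grad \<Omega> u x = g x"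
proof -
  show u: "u \<in> H1 \<Omega>" using assms by (auto simp: H1_def)
  show "AE x in lebesgue_on \<Omega>. grad \<Omega> u x = g x"
    using H1_grad(2,3)[OF u] assms by (intro weak_gradient_unique)
qed

lemma grad_diff_AE:
  assumes "u \<in> H1 \<Omega>" "v \<in> H1 \<Omega>"
  shows "(\<lambda>x. u x - v x) \<in> H1 \<Omega>"
    "AE x in lebesgue_on \<Omega>. grad \<Omega> (\<lambda>x. u x - v x) x = grad \<Omega> u x - grad \<Omega> v x"
  using grad_eq_AE[OF L2_diff L2_diff weak_gradient_diff] H1_grad[OF assms(1)] H1_grad[OF assms(2)] by auto

lemma C1_compact_weak_gradient:
  assumes "\<psi> \<in> C1_compact \<Omega>"
  shows "has_weak_gradient \<Omega> \<psi> (cgrad \<psi>)"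
  unfolding has_weak_gradient_def
proof (intro ballI)
  fix \<phi> and e :: 'a assume \<phi>: "\<phi> \<in> test_functions \<Omega>" "e \<in> Basis"
  have "\<psi> differentiable at x" for x using assms by (simp add: C1_compact_def)
  then show "(\<integral>x. \<psi> x * frechet_derivative \<phi> (at x) e \<partial>lebesgue_on \<Omega>)
      = - (\<integral>x. (cgrad \<psi> x \<bullet> e) * \<phi> x \<partial>lebesgue_on \<Omega>)"
    using integral_by_parts[OF \<Omega>(1) assms test_functions_C_k[OF \<phi>(1)]] by (simp add: cgrad_inner)
qed

text \<open>
  Both sides of the defining identity are \<open>L2\<close> products with a fixed function, hence continuous.
\<close>
lemma weak_gradient_limit:
  assumes "\<And>n. u n \<in> L2_space \<Omega>" "\<And>n. g n \<in> L2_space \<Omega>" "v \<in> L2_space \<Omega>" "h \<in> L2_space \<Omega>"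
    and "\<And>n. has_weak_gradient \<Omega> (u n) (g n)"
    and "(\<lambda>n. L2_norm \<Omega> (\<lambda>x. u n x - v x)) \<longlonglongrightarrow> 0" "(\<lambda>n. L2_norm \<Omega> (\<lambda>x. g n x - h x)) \<longlonglongrightarrow> 0"
  shows "has_weak_gradient \<Omega> v h"
  unfolding has_weak_gradient_def
proof (intro ballI)
  fix \<phi> and e :: 'a assume \<phi>: "\<phi> \<in> test_functions \<Omega>" "e \<in> Basis"
  have 1: "(\<lambda>n. pairing \<Omega> (u n) (\<lambda>x. frechet_derivative \<phi> (at x) e)) \<longlonglongrightarrow>
      pairing \<Omega> v (\<lambda>x. frechet_derivative \<phi> (at x) e)"
    using assms(1,3) test_function_L2(3)[OF \<phi>(1)] assms(6) by (rule pairing_tendsto)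
  have \<phi>e: "(\<lambda>x. \<phi> x *\<^sub>R e) \<in> L2_space \<Omega>"
  proof (rule L2_mono[OF _ test_function_L2(1)[OF \<phi>(1)]])
    show "(\<lambda>x. \<phi> x *\<^sub>R e) \<in> borel_measurable (lebesgue_on \<Omega>)"
      using L2_spaceD(1)[OF test_function_L2(1)[OF \<phi>(1)]] by (intro borel_measurable_scaleR) auto
  qed (use \<phi>(2) in auto)
  have 2: "(\<lambda>n. - pairing \<Omega> (g n) (\<lambda>x. \<phi> x *\<^sub>R e)) \<longlonglongrightarrow> - pairing \<Omega> h (\<lambda>x. \<phi> x *\<^sub>R e)"
    using assms(2,4) \<phi>e assms(7) by (intro tendsto_minus pairing_tendsto)
  have "pairing \<Omega> (u n) (\<lambda>x. frechet_derivative \<phi> (at x) e) = - pairing \<Omega> (g n) (\<lambda>x. \<phi> x *\<^sub>R e)" for n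
    using assms(5)[of n] \<phi> by (simp add: has_weak_gradient_def pairing_def mult.commute)
  then have "pairing \<Omega> v (\<lambda>x. frechet_derivative \<phi> (at x) e) = - pairing \<Omega> h (\<lambda>x. \<phi> x *\<^sub>R e)"
    using LIMSEQ_unique 1 2 by auto
  then show "(\<integral>x. v x * frechet_derivative \<phi> (at x) e \<partial>lebesgue_on \<Omega>)
      = - (\<integral>x. (h x \<bullet> e) * \<phi> x \<partial>lebesgue_on \<Omega>)"
    by (simp add: pairing_def mult.commute)
qed

text \<open>
  A second integration by parts moves both derivatives to the test function. This turns \<open>L2\<close> convergence
  of functions into weak convergence of their gradients.
\<close>
lemma pairing_weak_gradient_test:
  assumes g: "g \<in> L2_space \<Omega>" "has_weak_gradient \<Omega> u g" and \<phi>: "\<phi> \<in> test_functions \<Omega>"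
  shows "pairing \<Omega> g (cgrad \<phi>) = - (\<Sum>e\<in>Basis. pairing \<Omega> u
    (\<lambda>x. frechet_derivative (\<lambda>y. frechet_derivative \<phi> (at y) e) (at x) e))"
proof -
  let ?d = "\<lambda>e y. frechet_derivative \<phi> (at y) e"
  have d: "\<phi> differentiable at x" for x
    using test_functions_C_k[OF \<phi>, of "Suc 0"] by simp
  have "pairing \<Omega> g (cgrad \<phi>) = (\<integral>x. (\<Sum>e\<in>Basis. (g x \<bullet> e) * ?d e x) \<partial>lebesgue_on \<Omega>)"
    unfolding pairing_def
    by (subst euclidean_inner) (simp add: cgrad_inner d)
  also have "\<dots> = (\<Sum>e\<in>Basis. \<integral>x. (g x \<bullet> e) * ?d e x \<partial>lebesgue_on \<Omega>)"
  proof (rule Bochner_Integration.integral_sum)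
    fix e :: 'a assume e: "e \<in> Basis"
    show "integrable (lebesgue_on \<Omega>) (\<lambda>x. (g x \<bullet> e) * ?d e x)"
      using L2_inner_integrable[OF L2_component[OF g(1) e] test_function_L2(3)[OF \<phi>]] by simp
  qed
  also have "\<dots> = (\<Sum>e\<in>Basis. - pairing \<Omega> u (\<lambda>x. frechet_derivative (?d e) (at x) e))"
    using g(2) test_functions_derivative[OF \<phi>]
    by (intro sum.cong) (auto simp: has_weak_gradient_def pairing_def)
  finally show ?thesis by (simp add: sum_negf)
qed

text \<open>
  The limit \<open>g\<close> is a weak gradient of \<open>u\<close>, and weak gradients are unique almost everywhere, so the
  convergence of \<open>cgrad (\<phi> n)\<close> to \<open>g\<close> is convergence in \<open>H1_norm\<close>.
\<close>
lemma test_limit_imp_H1_0: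
  assumes "test_limit \<Omega> u g"
  shows "u \<in> H1_0 \<Omega>" "AE x in lebesgue_on \<Omega>. grad \<Omega> u x = g x"
proof -
  obtain \<phi> where u: "u \<in> L2_space \<Omega>" and g: "g \<in> L2_space \<Omega>" and \<phi>: "\<And>n::nat. \<phi> n \<in> test_functions \<Omega>"
    and l: "(\<lambda>n. L2_norm \<Omega> (\<lambda>x. \<phi> n x - u x)) \<longlonglongrightarrow> 0" "(\<lambda>n. L2_norm \<Omega> (\<lambda>x. cgrad (\<phi> n) x - g x)) \<longlonglongrightarrow> 0"
    using assms unfolding test_limit_def by blast
  have w\<phi>: "has_weak_gradient \<Omega> (\<phi> n) (cgrad (\<phi> n))" for n
    using \<phi> test_functions_subset_C1_compact by (blast intro: C1_compact_weak_gradient)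
  note L = test_function_L2[OF \<phi>]
  have w: "has_weak_gradient \<Omega> u g"
    by (rule weak_gradient_limit[OF _ _ u g w\<phi> l]) (use L in auto)
  show "AE x in lebesgue_on \<Omega>. grad \<Omega> u x = g x" by (rule grad_eq_AE(2)[OF u g w])
  have uH: "u \<in> H1 \<Omega>" by (rule grad_eq_AE(1)[OF u g w])
  have "H1_norm \<Omega> (\<lambda>x. \<phi> n x - u x)
      = sqrt ((L2_norm \<Omega> (\<lambda>x. \<phi> n x - u x))\<^sup>2 + (L2_norm \<Omega> (\<lambda>x. cgrad (\<phi> n) x - g x))\<^sup>2)" for n
  proof -
    have *: "(\<lambda>x. \<phi> n x - u x) \<in> L2_space \<Omega>" "(\<lambda>x. cgrad (\<phi> n) x - g x) \<in> L2_space \<Omega>"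
      "has_weak_gradient \<Omega> (\<lambda>x. \<phi> n x - u x) (\<lambda>x. cgrad (\<phi> n) x - g x)"
      using L u g w w\<phi> by (auto intro!: L2_diff weak_gradient_diff)
    have "L2_norm \<Omega> (grad \<Omega> (\<lambda>x. \<phi> n x - u x)) = L2_norm \<Omega> (\<lambda>x. cgrad (\<phi> n) x - g x)"
      using grad_eq_AE[OF *] *(2) by (intro L2_norm_cong_AE) (auto intro: L2_spaceD(1) H1_grad(2))
    then show ?thesis by (simp add: H1_norm_def H1_seminorm_def)
  qed
  moreover have "(\<lambda>n. sqrt ((L2_norm \<Omega> (\<lambda>x. \<phi> n x - u x))\<^sup>2 + (L2_norm \<Omega> (\<lambda>x. cgrad (\<phi> n) x - g x))\<^sup>2)) \<longlonglongrightarrow> sqrt (0\<^sup>2 + 0\<^sup>2)"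
    by (intro tendsto_intros l)
  ultimately have "(\<lambda>n. H1_norm \<Omega> (\<lambda>x. \<phi> n x - u x)) \<longlonglongrightarrow> 0" by simp
  then show "u \<in> H1_0 \<Omega>" using uH \<phi> unfolding H1_0_def by blast
qed

lemma H1_0_imp_test_limit:
  assumes "u \<in> H1_0 \<Omega>"
  shows "test_limit \<Omega> u (grad \<Omega> u)"
proof -
  have uH: "u \<in> H1 \<Omega>" using assms by (simp add: H1_0_def)
  note u = H1_grad[OF uH]
  obtain \<phi> where \<phi>: "\<And>n::nat. \<phi> n \<in> test_functions \<Omega>" and l: "(\<lambda>n. H1_norm \<Omega> (\<lambda>x. \<phi> n x - u x)) \<longlonglongrightarrow> 0"
    using assms unfolding H1_0_def by blast
  note L = test_function_L2[OF \<phi>]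
  have le: "L2_norm \<Omega> (\<lambda>x. \<phi> n x - u x) \<le> H1_norm \<Omega> (\<lambda>x. \<phi> n x - u x)" for n
    unfolding H1_norm_def by (rule real_le_rsqrt) simp
  have le': "L2_norm \<Omega> (\<lambda>x. cgrad (\<phi> n) x - grad \<Omega> u x) \<le> H1_norm \<Omega> (\<lambda>x. \<phi> n x - u x)" for n
  proof -
    have w\<phi>: "has_weak_gradient \<Omega> (\<phi> n) (cgrad (\<phi> n))"
      using \<phi> test_functions_subset_C1_compact by (blast intro: C1_compact_weak_gradient)
    have *: "(\<lambda>x. \<phi> n x - u x) \<in> L2_space \<Omega>" "(\<lambda>x. cgrad (\<phi> n) x - grad \<Omega> u x) \<in> L2_space \<Omega>"
      "has_weak_gradient \<Omega> (\<lambda>x. \<phi> n x - u x) (\<lambda>x. cgrad (\<phi> n) x - grad \<Omega> u x)"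
      using L u w\<phi> by (auto intro!: L2_diff weak_gradient_diff)
    have "L2_norm \<Omega> (grad \<Omega> (\<lambda>x. \<phi> n x - u x)) = L2_norm \<Omega> (\<lambda>x. cgrad (\<phi> n) x - grad \<Omega> u x)"
      using grad_eq_AE[OF *] *(2) by (intro L2_norm_cong_AE) (auto intro: L2_spaceD(1) H1_grad(2))
    then show ?thesis
      unfolding H1_norm_def H1_seminorm_def by (intro real_le_rsqrt) simp
  qed
  have "(\<lambda>n. L2_norm \<Omega> (\<lambda>x. \<phi> n x - u x)) \<longlonglongrightarrow> 0"
    by (rule Lim_null_comparison[OF always_eventually l]) (use le in simp)
  moreover have "(\<lambda>n. L2_norm \<Omega> (\<lambda>x. cgrad (\<phi> n) x - grad \<Omega> u x)) \<longlonglongrightarrow> 0"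
    by (rule Lim_null_comparison[OF always_eventually l]) (use le' in simp)
  ultimately show ?thesis unfolding test_limit_def using u \<phi> by blast
qed

end

section \<open>Approximation within the box\<close>

text \<open>
  A smoothing of \<open>min x c\<close>: replace \<open>|x - c|\<close> by \<open>sqrt ((x - c)\<^sup>2 + \<delta>\<^sup>2)\<close> in \<open>(x + c - |x - c|) / 2\<close>. The
  result is shifted to vanish at \<open>0\<close>, so that composition keeps supports compact. The shift is at most
  \<open>\<delta> / 2\<close>, and with \<open>c = k - \<delta> / 2\<close> the bound \<open>k\<close> is respected.
\<close>
lemma smooth_upper_clamp:
  assumes "k > 0" "0 < \<delta>" "\<delta> < k"
  obtains S S' :: "real \<Rightarrow> real" where
    "\<And>x. (S has_real_derivative S' x) (at x)" "continuous_on UNIV S'"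
    "\<And>x. 0 \<le> S' x" "\<And>x. S' x \<le> 1" "S 0 = 0" "\<And>x. S x \<le> k" "\<And>x. x \<le> k \<Longrightarrow> \<bar>S x - x\<bar> \<le> \<delta>"
proof -
  define c where "c = k - \<delta> / 2"
  define r where "r = (\<lambda>x. sqrt ((x - c)\<^sup>2 + \<delta>\<^sup>2))"
  define S where "S = (\<lambda>x. (x + c - r x) / 2 - (c - r 0) / 2)"
  define S' where "S' = (\<lambda>x. (1 - (x - c) / r x) / 2)"
  have c: "c > 0" using assms by (simp add: c_def)
  have pos: "(x - c)\<^sup>2 + \<delta>\<^sup>2 > 0" for x using assms(2) by (simp add: add_nonneg_pos)
  have r0: "r x > 0" for x using pos by (simp add: r_def)
  have r1: "\<bar>x - c\<bar> \<le> r x" for x unfolding r_def by (rule real_le_rsqrt) simp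
  have r2: "r x \<le> \<bar>x - c\<bar> + \<delta>" for x unfolding r_def
    using assms(2) sqrt_add_le_add_sqrt[of "(x - c)\<^sup>2" "\<delta>\<^sup>2"] by simp
  show ?thesis
  proof (rule that)
    fix x
    have "((\<lambda>x. (x - c)\<^sup>2 + \<delta>\<^sup>2) has_real_derivative 2 * (x - c)) (at x)"
      by (auto intro!: derivative_eq_intros)
    from DERIV_chain2[OF DERIV_real_sqrt[OF pos] this]
    have "(r has_real_derivative (inverse (r x) / 2 * (2 * (x - c)))) (at x)"
      by (simp only: r_def)
    moreover have "inverse a / 2 * (2 * b) = b / a" for a b :: real
      by (cases "a = 0") (simp_all add: field_simps)
    ultimately have "(r has_real_derivative ((x - c) / r x)) (at x)" by (simp only:)
    then show "(S has_real_derivative S' x) (at x)"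
      unfolding S_def S'_def by (auto intro!: derivative_eq_intros)
    have "(x - c) / r x \<le> 1" "- 1 \<le> (x - c) / r x"
      using r0[of x] r1[of x] by (auto simp: divide_le_eq le_divide_eq)
    then show "0 \<le> S' x" "S' x \<le> 1" unfolding S'_def by auto
    have "x - c \<le> r x" "r 0 \<le> c + \<delta>" "k = c + \<delta> / 2"
      using r1[of x] r2[of 0] c by (auto simp: c_def)
    then show "S x \<le> k" unfolding S_def by argo
    show "S 0 = 0" by (simp add: S_def)
    show "\<bar>S x - x\<bar> \<le> \<delta>" if "x \<le> k"
    proof -
      have 1: "0 \<le> (r 0 - c) / 2" "(r 0 - c) / 2 \<le> \<delta> / 2" using r1[of 0] r2[of 0] c by auto
      have 2: "0 \<le> (x - c + r x) / 2" "(x - c + r x) / 2 \<le> \<delta>"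
        using r1[of x] r2[of x] that assms(2) by (auto simp: c_def abs_if split: if_splits)
      have "S x - x = (r 0 - c) / 2 - (x - c + r x) / 2" by (simp add: S_def field_simps)
      then show ?thesis using 1 2 by linarith
    qed
  next
    show "continuous_on UNIV S'" unfolding S'_def
      using r0 assms(2) by (intro continuous_intros) (auto simp: r_def less_imp_neq[symmetric] intro!: continuous_intros)
  qed
qed

lemma DERIV_between_0_1:
  assumes "\<And>x::real. (S has_real_derivative S' x) (at x)" "\<And>x. 0 \<le> S' x" "\<And>x. S' x \<le> 1"
  shows "x \<le> y \<Longrightarrow> S x \<le> S y" "\<bar>S x - S y\<bar> \<le> \<bar>x - y\<bar>"
proof -
  show "x \<le> y \<Longrightarrow> S x \<le> S y"
    using DERIV_nonneg_imp_nondecreasing[of x y S] assms by metis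
  have d: "(S has_field_derivative S' x) (at x within UNIV)" for x using assms(1) by simp
  have "norm (S x - S y) \<le> 1 * norm (x - y)"
    by (rule field_differentiable_bound[OF _ d]) (use assms in auto)
  then show "\<bar>S x - S y\<bar> \<le> \<bar>x - y\<bar>" by simp
qed

text \<open>
  The lower bound is obtained by reflecting a second upper clamp; since clamps fix \<open>0\<close> and are monotone
  and nonexpansive, applying it preserves the upper bound.
\<close>
lemma smooth_box_clamp:
  assumes "\<epsilon> > 0" "k > 0" "0 < \<delta>" "\<delta> < \<epsilon>" "\<delta> < k"
  obtains T T' :: "real \<Rightarrow> real" where
    "\<And>x. (T has_real_derivative T' x) (at x)" "continuous_on UNIV T'"
    "\<And>x. 0 \<le> T' x" "\<And>x. T' x \<le> 1" "T 0 = 0" "\<And>x. - \<epsilon> \<le> T x" "\<And>x. T x \<le> k"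
    "\<And>x. - \<epsilon> \<le> x \<Longrightarrow> x \<le> k \<Longrightarrow> \<bar>T x - x\<bar> \<le> 2 * \<delta>"
proof -
  obtain S S' where S: "\<And>x. (S has_real_derivative S' x) (at x)" "continuous_on UNIV S'"
    "\<And>x. 0 \<le> S' x" "\<And>x. S' x \<le> 1" "S 0 = 0" "\<And>x. S x \<le> k" "\<And>x. x \<le> k \<Longrightarrow> \<bar>S x - x\<bar> \<le> \<delta>"
    using smooth_upper_clamp[of k \<delta>] assms by metis
  obtain R R' where R: "\<And>x. (R has_real_derivative R' x) (at x)" "continuous_on UNIV R'"
    "\<And>x. 0 \<le> R' x" "\<And>x. R' x \<le> 1" "R 0 = 0" "\<And>x. R x \<le> \<epsilon>" "\<And>x. x \<le> \<epsilon> \<Longrightarrow> \<bar>R x - x\<bar> \<le> \<delta>"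
    using smooth_upper_clamp[of \<epsilon> \<delta>] assms by metis
  note Sm = DERIV_between_0_1[OF S(1,3,4)] and Rm = DERIV_between_0_1[OF R(1,3,4)]
  have Sc: "continuous_on UNIV S" using S(1) by (meson DERIV_isCont continuous_at_imp_continuous_on)
  show ?thesis
  proof (rule that[of "\<lambda>x. - R (- S x)" "\<lambda>x. R' (- S x) * S' x"])
    fix x
    show "((\<lambda>x. - R (- S x)) has_real_derivative R' (- S x) * S' x) (at x)"
      using DERIV_chain2[OF R(1) DERIV_minus[OF S(1)], of x] by (auto intro!: derivative_eq_intros)
    show "0 \<le> R' (- S x) * S' x" "R' (- S x) * S' x \<le> 1"
      using R(3,4) S(3,4) by (auto intro: mult_le_one)
    show "- \<epsilon> \<le> - R (- S x)" using R(6) by simp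
    show "- R (- S x) \<le> k"
    proof (cases "- S x \<ge> 0")
      case True
      then have "R (- S x) \<ge> 0" using Rm(1)[of 0 "- S x"] R(5) by simp
      then show ?thesis using assms by simp
    next
      case False
      then show ?thesis using Rm(2)[of "- S x" 0] R(5) S(6)[of x] by simp
    qed
    assume x: "- \<epsilon> \<le> x" "x \<le> k"
    have "- S x \<le> \<epsilon>"
    proof (cases "x \<ge> 0")
      case True
      then show ?thesis using Sm(1)[of 0 x] S(5) assms by simp
    next
      case False
      then show ?thesis using Sm(2)[of x 0] S(5) x by simp
    qed
    then have "\<bar>R (- S x) - (- S x)\<bar> \<le> \<delta>" by (rule R(7))
    then show "\<bar>- R (- S x) - x\<bar> \<le> 2 * \<delta>" using S(7)[OF x(2)] by linarith
  next
    show "continuous_on UNIV (\<lambda>x. R' (- S x) * S' x)"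
      by (intro continuous_intros continuous_on_compose2[OF R(2)] S(2) Sc) auto
    show "- R (- S 0) = 0" using R S by simp
  qed
qed

lemma C1_compact_compose:
  assumes \<phi>: "\<phi> \<in> C1_compact \<Omega>"
    and T: "\<And>x. (T has_real_derivative T' x) (at x)" "continuous_on UNIV T'" "T 0 = 0"
  shows "(\<lambda>x. T (\<phi> x)) \<in> C1_compact \<Omega>" "cgrad (\<lambda>x. T (\<phi> x)) x = T' (\<phi> x) *\<^sub>R cgrad \<phi> x"
proof -
  have C: "C_k (Suc 0) \<phi>" using \<phi> by (simp add: C1_compact_def)
  then have dif: "\<phi> differentiable at x" for x by simp
  have c\<phi>: "continuous_on UNIV \<phi>" using C by (rule C_k_imp_continuous)
  have d: "((\<lambda>x. T (\<phi> x)) has_derivative (\<lambda>v. T' (\<phi> x) * frechet_derivative \<phi> (at x) v)) (at x)" for x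
    using has_derivative_compose[OF frechet_derivative_works[THEN iffD1, OF dif] T(1)[unfolded has_field_derivative_def]] .
  show "cgrad (\<lambda>x. T (\<phi> x)) x = T' (\<phi> x) *\<^sub>R cgrad \<phi> x"
    by (rule cgrad_eqI) (use d[of x] in \<open>simp add: cgrad_inner[OF dif]\<close>)
  have "C_k (Suc 0) (\<lambda>x. T (\<phi> x))"
  proof (rule C_k_SucI[OF d])
    have "continuous_on UNIV (\<lambda>x. frechet_derivative \<phi> (at x) v)" for v using C by simp
    then show "C_k 0 (\<lambda>x. T' (\<phi> x) * frechet_derivative \<phi> (at x) v)" for v
      using continuous_on_compose2[OF T(2) c\<phi>] by (auto intro!: continuous_intros)
  qed
  moreover have s: "closure {x. T (\<phi> x) \<noteq> 0} \<subseteq> closure {x. \<phi> x \<noteq> 0}"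
    by (rule closure_mono) (use T(3) in auto)
  moreover have K: "compact (closure {x. \<phi> x \<noteq> 0})" "closure {x. \<phi> x \<noteq> 0} \<subseteq> \<Omega>"
    using \<phi> by (auto simp: C1_compact_def)
  moreover have "compact (closure {x. T (\<phi> x) \<noteq> 0})"
    using compact_Int_closed[OF K(1) closed_closure, of "{x. T (\<phi> x) \<noteq> 0}"] inf.absorb2[OF s] by simp
  ultimately show "(\<lambda>x. T (\<phi> x)) \<in> C1_compact \<Omega>" by (auto simp: C1_compact_def simp del: C_k.simps)
qed

text \<open>
  The clamped functions \<open>\<psi> n\<close> still converge to \<open>z\<close> in \<open>L2\<close>, because the clamps are nonexpansive and
  almost fix the values of \<open>z\<close>. Their gradients are pointwise dominated by those of \<open>\<phi> n\<close> and converge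
  weakly when tested against \<open>cgrad (\<phi> m)\<close>, so \<open>L2_strong_of_weak\<close> gives strong convergence.
\<close>
lemma box_approximation:
  assumes \<Omega>: "open \<Omega>" "bounded \<Omega>" and \<epsilon>k: "\<epsilon> > 0" "k > 0" and z: "z \<in> H1_0_box \<Omega> \<epsilon> k" and "\<eta> > 0"
  obtains \<psi> where "\<psi> \<in> C1_compact \<Omega>" "\<And>x. - \<epsilon> \<le> \<psi> x \<and> \<psi> x \<le> k"
    "L2_norm \<Omega> (\<lambda>x. \<psi> x - z x) < \<eta>" "L2_norm \<Omega> (\<lambda>x. cgrad \<psi> x - grad \<Omega> z x) < \<eta>"
proof -
  have m: "\<Omega> \<in> lmeasurable" using \<Omega> by (simp add: lmeasurable_open)
  have zH: "z \<in> H1_0 \<Omega>" and zb: "AE x in lebesgue_on \<Omega>. - \<epsilon> \<le> z x \<and> z x \<le> k"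
    using z by (auto simp: H1_0_box_def)
  have "z \<in> H1 \<Omega>" using zH by (simp add: H1_0_def)
  note zL = H1_grad[OF \<Omega> this]
  obtain \<phi> where \<phi>: "\<And>n::nat. \<phi> n \<in> test_functions \<Omega>"
    and l: "(\<lambda>n. L2_norm \<Omega> (\<lambda>x. \<phi> n x - z x)) \<longlonglongrightarrow> 0" "(\<lambda>n. L2_norm \<Omega> (\<lambda>x. cgrad (\<phi> n) x - grad \<Omega> z x)) \<longlonglongrightarrow> 0"
    using H1_0_imp_test_limit[OF \<Omega> zH] unfolding test_limit_def by blast
  note L = test_function_L2[OF \<Omega> \<phi>]
  have \<phi>C: "\<phi> n \<in> C1_compact \<Omega>" for n using \<phi> test_functions_subset_C1_compact by blast
  \<comment> \<open>a null sequence of admissible clamp widths: \<open>n + 2\<close> keeps them strictly below \<open>\<epsilon>\<close> and \<open>k\<close>\<close>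
  define \<delta> where "\<delta> = (\<lambda>n::nat. min \<epsilon> k / real (n + 2))"
  have \<delta>: "\<delta> n > 0" "\<delta> n < \<epsilon>" "\<delta> n < k" for n
  proof -
    show "\<delta> n > 0" using \<epsilon>k by (simp add: \<delta>_def)
    have "a / real (n + 2) < a" if "a > 0" for a :: real
      using that by (simp add: field_simps add_pos_nonneg)
    from this[of "min \<epsilon> k"] have "\<delta> n < min \<epsilon> k" using \<epsilon>k unfolding \<delta>_def by simp
    then show "\<delta> n < \<epsilon>" "\<delta> n < k" by auto
  qed
  have \<delta>0: "\<delta> \<longlonglongrightarrow> 0"
    unfolding \<delta>_def by (intro real_tendsto_divide_at_top[OF tendsto_const] filterlim_compose[OF filterlim_real_sequentially] filterlim_add_const_nat_at_top)
  have "\<forall>n. \<exists>T T'. (\<forall>x. (T has_real_derivative T' x) (at x)) \<and> continuous_on UNIV T' \<and>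
    (\<forall>x. 0 \<le> T' x \<and> T' x \<le> 1) \<and> T 0 = 0 \<and> (\<forall>x. - \<epsilon> \<le> T x \<and> T x \<le> k) \<and>
    (\<forall>x. - \<epsilon> \<le> x \<and> x \<le> k \<longrightarrow> \<bar>T x - x\<bar> \<le> 2 * \<delta> n)"
  proof
    fix n
    show "\<exists>T T'. (\<forall>x. (T has_real_derivative T' x) (at x)) \<and> continuous_on UNIV T' \<and>
    (\<forall>x. 0 \<le> T' x \<and> T' x \<le> 1) \<and> T 0 = 0 \<and> (\<forall>x. - \<epsilon> \<le> T x \<and> T x \<le> k) \<and>
    (\<forall>x. - \<epsilon> \<le> x \<and> x \<le> k \<longrightarrow> \<bar>T x - x\<bar> \<le> 2 * \<delta> n)"
      by (rule smooth_box_clamp[OF \<epsilon>k \<delta>[of n]]) blast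
  qed
  then obtain T T' where T: "\<And>n x. (T n has_real_derivative T' n x) (at x)" "\<And>n. continuous_on UNIV (T' n)"
    "\<And>n x. 0 \<le> T' n x" "\<And>n x. T' n x \<le> 1" "\<And>n. T n 0 = 0" "\<And>n x. - \<epsilon> \<le> T n x \<and> T n x \<le> k"
    "\<And>n x. - \<epsilon> \<le> x \<Longrightarrow> x \<le> k \<Longrightarrow> \<bar>T n x - x\<bar> \<le> 2 * \<delta> n"
    by (metis (no_types, lifting))
  define \<psi> where "\<psi> = (\<lambda>n x. T n (\<phi> n x))"
  have \<psi>C: "\<psi> n \<in> C1_compact \<Omega>" for n
    unfolding \<psi>_def by (rule C1_compact_compose(1)[OF \<phi>C T(1,2,5)])
  have \<psi>g: "cgrad (\<psi> n) x = T' n (\<phi> n x) *\<^sub>R cgrad (\<phi> n) x" for n x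
    unfolding \<psi>_def by (rule C1_compact_compose(2)[OF \<phi>C T(1,2,5)])
  note \<psi>L = C1_compact_L2[OF \<Omega> \<psi>C]
  have l\<psi>: "(\<lambda>n. L2_norm \<Omega> (\<lambda>x. \<psi> n x - z x)) \<longlonglongrightarrow> 0"
  proof (rule Lim_null_comparison[OF always_eventually])
    show "\<forall>n. norm (L2_norm \<Omega> (\<lambda>x. \<psi> n x - z x))
      \<le> L2_norm \<Omega> (\<lambda>x. \<phi> n x - z x) + 2 * \<delta> n * sqrt (measure lebesgue \<Omega>)"
    proof
      fix n
      have a: "(\<lambda>x. \<bar>\<phi> n x - z x\<bar>) \<in> L2_space \<Omega>"
        using L2_diff[OF L(1)[of n] zL(1)] by (auto simp: L2_space_def intro: borel_measurable_abs)
      have an: "L2_norm \<Omega> (\<lambda>x. \<bar>\<phi> n x - z x\<bar>) = L2_norm \<Omega> (\<lambda>x. \<phi> n x - z x)" by (simp add: L2_norm_def)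
      have b: "(\<lambda>x. 2 * \<delta> n) \<in> L2_space \<Omega>" "L2_norm \<Omega> (\<lambda>x. 2 * \<delta> n) \<le> 2 * \<delta> n * sqrt (measure lebesgue \<Omega>)"
        using L2_bounded[OF m, of "\<lambda>x. 2 * \<delta> n" "2 * \<delta> n"] L2_norm_bounded[OF m, of "\<lambda>x. 2 * \<delta> n" "2 * \<delta> n"] \<delta>(1)[of n] by auto
      have "L2_norm \<Omega> (\<lambda>x. \<psi> n x - z x) \<le> L2_norm \<Omega> (\<lambda>x. \<bar>\<phi> n x - z x\<bar> + 2 * \<delta> n)"
      proof (rule L2_norm_mono[OF L2_diff[OF \<psi>L(1) zL(1)] L2_add[OF a b(1)]])
        show "AE x in lebesgue_on \<Omega>. norm (\<psi> n x - z x) \<le> norm (\<bar>\<phi> n x - z x\<bar> + 2 * \<delta> n)"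
          using zb
        proof eventually_elim
          fix x assume "- \<epsilon> \<le> z x \<and> z x \<le> k"
          then have "\<bar>T n (z x) - z x\<bar> \<le> 2 * \<delta> n" using T(7) by blast
          moreover have "\<bar>T n (\<phi> n x) - T n (z x)\<bar> \<le> \<bar>\<phi> n x - z x\<bar>"
            by (rule DERIV_between_0_1(2)[OF T(1,3,4)])
          ultimately show "norm (\<psi> n x - z x) \<le> norm (\<bar>\<phi> n x - z x\<bar> + 2 * \<delta> n)"
            unfolding \<psi>_def real_norm_def by linarith
        qed
      qed
      also have "\<dots> \<le> L2_norm \<Omega> (\<lambda>x. \<phi> n x - z x) + 2 * \<delta> n * sqrt (measure lebesgue \<Omega>)"
        using L2_norm_triangle[OF a b(1)] b(2) an by linarith
      finally show "norm (L2_norm \<Omega> (\<lambda>x. \<psi> n x - z x))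
        \<le> L2_norm \<Omega> (\<lambda>x. \<phi> n x - z x) + 2 * \<delta> n * sqrt (measure lebesgue \<Omega>)" by simp
    qed
    have "(\<lambda>n. L2_norm \<Omega> (\<lambda>x. \<phi> n x - z x) + 2 * \<delta> n * sqrt (measure lebesgue \<Omega>)) \<longlonglongrightarrow> 0 + 2 * 0 * sqrt (measure lebesgue \<Omega>)"
      by (intro tendsto_intros l \<delta>0)
    then show "(\<lambda>n. L2_norm \<Omega> (\<lambda>x. \<phi> n x - z x) + 2 * \<delta> n * sqrt (measure lebesgue \<Omega>)) \<longlonglongrightarrow> 0" by simp
  qed
  have lg: "(\<lambda>n. L2_norm \<Omega> (\<lambda>x. cgrad (\<psi> n) x - grad \<Omega> z x)) \<longlonglongrightarrow> 0"
  proof (rule L2_strong_of_weak[OF \<psi>L(2) L(2) zL(2) _ l(2)])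
    show "L2_norm \<Omega> (cgrad (\<psi> n)) \<le> L2_norm \<Omega> (cgrad (\<phi> n))" for n
      by (rule L2_norm_mono[OF \<psi>L(2) L(2)])
         (use T(3,4) in \<open>auto simp: \<psi>g intro!: mult_left_le_one_le\<close>)
    show "(\<lambda>n. pairing \<Omega> (cgrad (\<psi> n)) (cgrad (\<phi> m))) \<longlonglongrightarrow> pairing \<Omega> (grad \<Omega> z) (cgrad (\<phi> m))" for m
      unfolding pairing_weak_gradient_test[OF \<Omega> \<psi>L(2) C1_compact_weak_gradient[OF \<Omega> \<psi>C] \<phi>]
        pairing_weak_gradient_test[OF \<Omega> zL(2,3) \<phi>]
      by (intro tendsto_minus tendsto_sum pairing_tendsto[OF \<psi>L(1) zL(1) _ l\<psi>]
          test_function_L2(3)[OF \<Omega> test_functions_derivative[OF \<phi>]])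
  qed
  have "\<forall>\<^sub>F n in sequentially. L2_norm \<Omega> (\<lambda>x. \<psi> n x - z x) < \<eta> \<and> L2_norm \<Omega> (\<lambda>x. cgrad (\<psi> n) x - grad \<Omega> z x) < \<eta>"
    using order_tendstoD(2)[OF l\<psi> \<open>\<eta> > 0\<close>] order_tendstoD(2)[OF lg \<open>\<eta> > 0\<close>] by (rule eventually_conj)
  then obtain n where "L2_norm \<Omega> (\<lambda>x. \<psi> n x - z x) < \<eta>" "L2_norm \<Omega> (\<lambda>x. cgrad (\<psi> n) x - grad \<Omega> z x) < \<eta>"
    by (auto simp: eventually_sequentially)
  then show ?thesis using that[OF \<psi>C[of n]] T(6) by (auto simp: \<psi>_def)
qed

section \<open>Compactly supported, piecewise affine functions\<close>

lemma L2_dominated_convergence: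
  fixes u :: "nat \<Rightarrow> 'a::euclidean_space \<Rightarrow> 'b::euclidean_space"
  assumes \<Omega>: "\<Omega> \<in> lmeasurable"
    and m: "\<And>n. u n \<in> borel_measurable (lebesgue_on \<Omega>)" "v \<in> borel_measurable (lebesgue_on \<Omega>)"
    and B: "\<And>n x. norm (u n x) \<le> B" "\<And>x. norm (v x) \<le> B"
    and lim: "AE x in lebesgue_on \<Omega>. (\<lambda>n. u n x) \<longlonglongrightarrow> v x"
  shows "(\<lambda>n. L2_norm \<Omega> (\<lambda>x. u n x - v x)) \<longlonglongrightarrow> 0"
proof -
  interpret finite_measure "lebesgue_on \<Omega>" using \<Omega> by (rule finite_measure_lebesgue_on)
  have "(\<lambda>n. \<integral>x. (norm (u n x - v x))\<^sup>2 \<partial>lebesgue_on \<Omega>) \<longlonglongrightarrow> (\<integral>x. 0 \<partial>lebesgue_on \<Omega>)"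
  proof (rule integral_dominated_convergence[where w="\<lambda>x. (2 * B)\<^sup>2"
        and s="\<lambda>n x. (norm (u n x - v x))\<^sup>2" and f="\<lambda>x. 0"])
    show "AE x in lebesgue_on \<Omega>. (\<lambda>n. (norm (u n x - v x))\<^sup>2) \<longlonglongrightarrow> 0"
      using lim
    proof eventually_elim
      fix x assume "(\<lambda>n. u n x) \<longlonglongrightarrow> v x"
      then have "(\<lambda>n. norm (u n x - v x)) \<longlonglongrightarrow> 0"
        by (intro tendsto_norm_zero LIM_zero)
      from tendsto_power[OF this, of 2] show "(\<lambda>n. (norm (u n x - v x))\<^sup>2) \<longlonglongrightarrow> 0" by simp
    qed
    show "AE x in lebesgue_on \<Omega>. norm ((norm (u n x - v x))\<^sup>2) \<le> (2 * B)\<^sup>2" for n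
    proof (rule AE_I2)
      fix x
      have "norm (u n x - v x) \<le> 2 * B" using norm_triangle_ineq4[of "u n x" "v x"] B(1)[of n x] B(2)[of x] by linarith
      then have "(norm (u n x - v x))\<^sup>2 \<le> (2 * B)\<^sup>2" by (intro power_mono) auto
      then show "norm ((norm (u n x - v x))\<^sup>2) \<le> (2 * B)\<^sup>2" by simp
    qed
    show "(\<lambda>x. (norm (u n x - v x))\<^sup>2) \<in> borel_measurable (lebesgue_on \<Omega>)" for n
      using m(1)[of n] m(2) by auto
    show "integrable (lebesgue_on \<Omega>) (\<lambda>x. (2 * B)\<^sup>2)" by (rule integrable_const)
  qed simp
  then have "(\<lambda>n. \<integral>x. (norm (u n x - v x))\<^sup>2 \<partial>lebesgue_on \<Omega>) \<longlonglongrightarrow> 0" by simp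
  from tendsto_real_sqrt[OF this] show ?thesis by (simp add: L2_norm_def)
qed

text \<open>
  Mollify. The gradients of the mollified functions are bounded by the Lipschitz constant, and at each
  point of \<open>S\<close> they are eventually equal to the slope of the affine piece; so they converge in \<open>L2\<close>.
  Measurability of the limit is a by-product of this pointwise convergence.
\<close>
lemma locally_affine_compact_support_test_limit:
  fixes V :: "'a::euclidean_space \<Rightarrow> real"
  assumes \<Omega>: "open \<Omega>" "bounded \<Omega>"
    and L: "\<And>x y. \<bar>V x - V y\<bar> \<le> L * norm (x - y)"
    and K: "compact K" "\<And>x. x \<notin> K \<Longrightarrow> V x = 0" "K \<subseteq> \<Omega>"
    and S: "open S" "AE x in lebesgue_on \<Omega>. x \<in> S"
    and aff: "\<And>x. x \<in> S \<Longrightarrow> \<exists>r>0. \<exists>b. \<forall>u\<in>ball x r. V u = A x \<bullet> u + b"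
  shows "test_limit \<Omega> V (\<lambda>x. if x \<in> S then A x else 0)"
proof -
  have m: "\<Omega> \<in> lmeasurable" using \<Omega> by (simp add: lmeasurable_open)
  have L0: "L \<ge> 0"
  proof -
    obtain e :: 'a where "e \<in> Basis" using nonempty_Basis by blast
    then show ?thesis using order_trans[OF abs_ge_zero L[of e 0]] by simp
  qed
  have cV: "continuous_on UNIV V"
    by (rule lipschitz_on_continuous_on[of L]) (use L L0 in \<open>auto simp: lipschitz_on_def dist_norm\<close>)
  obtain B where B: "B > 0" "\<And>x. norm (V x) \<le> B"
    using bounded_of_compact_support[OF cV K(1,2)] by blast
  obtain d where d: "d > 0" "\<And>\<eta> \<rho>. \<eta> < d \<Longrightarrow> mollifier \<eta> \<rho> \<Longrightarrow> convol \<rho> V \<in> test_functions \<Omega>"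
    using convol_test_function[OF cV K(1,2) \<Omega>(1) K(3)] by metis
  \<comment> \<open>mollification radii tending to zero, all below \<open>d\<close>\<close>
  define \<eta> where "\<eta> = (\<lambda>n::nat. d / real (n + 2))"
  have \<eta>: "\<eta> n > 0" "\<eta> n < d" for n using d(1) by (auto simp: \<eta>_def field_simps add_pos_nonneg)
  have \<eta>0: "\<eta> \<longlonglongrightarrow> 0"
    unfolding \<eta>_def by (intro real_tendsto_divide_at_top[OF tendsto_const]
        filterlim_compose[OF filterlim_real_sequentially] filterlim_add_const_nat_at_top)
  have "\<forall>n. \<exists>\<rho>::'a \<Rightarrow> real. mollifier (\<eta> n) \<rho>"
    using mollifier_exists[OF \<eta>(1)] unfolding mollifier_def by metis
  then obtain \<rho> :: "nat \<Rightarrow> 'a \<Rightarrow> real" where \<rho>: "\<And>n. mollifier (\<eta> n) (\<rho> n)" by metis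
  define W where "W = (\<lambda>n. convol (\<rho> n) V)"
  have W: "W n \<in> test_functions \<Omega>" for n unfolding W_def using d(2) \<eta> \<rho> by blast
  have close: "\<bar>W n x - V x\<bar> \<le> L * \<eta> n" for n x
    unfolding W_def
  proof (rule convol_close[OF \<rho> cV])
    fix y :: 'a assume "norm y < \<eta> n"
    then have "L * norm y \<le> L * \<eta> n" using L0 by (intro mult_left_mono) auto
    then show "\<bar>V (x - y) - V x\<bar> \<le> L * \<eta> n" using L[of "x - y" x] by simp
  qed
  have WB: "norm (W n x) \<le> B" for n x
  proof -
    have "\<bar>convol (\<rho> n) V x - 0\<bar> \<le> B" by (rule convol_close[OF \<rho> cV]) (use B(2) in simp)
    then show ?thesis by (simp add: W_def)
  qed
  have Wdiff: "W n differentiable at x" for n x using test_functions_C_k[OF W, of "Suc 0"] by simp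
  have gL: "norm (cgrad (W n) x) \<le> L" for n x
    by (rule cgrad_norm_le_lipschitz[OF Wdiff _ L0]) (unfold W_def, rule convol_lipschitz[OF \<rho> cV L])
  have gA: "\<forall>\<^sub>F n in sequentially. cgrad (W n) x = A x" if x: "x \<in> S" for x
  proof -
    obtain r b where r: "r > 0" "\<And>u. u \<in> ball x r \<Longrightarrow> V u = A x \<bullet> u + b" using aff[OF x] by blast
    have "\<forall>\<^sub>F n in sequentially. \<eta> n < r" using order_tendstoD(2)[OF \<eta>0 r(1)] .
    then show ?thesis
      by eventually_elim (unfold W_def, rule cgrad_convol_affine[OF \<rho> cV _ r(2)])
  qed
  let ?g = "\<lambda>x. if x \<in> S then A x else 0"
  have cW: "continuous_on UNIV (W n)" for n using test_functions_C_k[OF W] by (rule C_k_imp_continuous)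
  have mW: "W n \<in> borel_measurable (lebesgue_on \<Omega>)" for n
    by (rule borel_measurable_lebesgue_on_continuous[OF cW])
  have mgW: "cgrad (W n) \<in> borel_measurable (lebesgue_on \<Omega>)" for n
    by (intro borel_measurable_lebesgue_on_continuous C_k_cgrad_continuous test_functions_C_k[OF W])
  have mV: "V \<in> borel_measurable (lebesgue_on \<Omega>)"
    by (rule borel_measurable_lebesgue_on_continuous[OF cV])
  have lg: "(\<lambda>n. indicator S x *\<^sub>R cgrad (W n) x) \<longlonglongrightarrow> ?g x" for x
    using tendsto_eventually[OF gA[of x]] by (cases "x \<in> S") auto
  have mg: "?g \<in> borel_measurable (lebesgue_on \<Omega>)"
  proof (rule borel_measurable_LIMSEQ_metric[OF _ lg])
    have "(indicator S :: 'a \<Rightarrow> real) \<in> borel_measurable lebesgue"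
      using borel_open[OF S(1)] by (intro borel_measurable_indicator) auto
    then have "(indicator S :: 'a \<Rightarrow> real) \<in> borel_measurable (lebesgue_on \<Omega>)"
      by (rule measurable_restrict_space1)
    then show "(\<lambda>x. indicator S x *\<^sub>R cgrad (W n) x) \<in> borel_measurable (lebesgue_on \<Omega>)" for n
      using mgW by (rule borel_measurable_scaleR)
  qed
  have AL: "norm (?g x) \<le> L" for x
  proof (rule Lim_bounded[OF tendsto_norm[OF lg[of x]]])
    show "\<forall>n\<ge>0. norm (indicator S x *\<^sub>R cgrad (W n) x) \<le> L"
      using gL L0 by (auto simp: indicator_def)
  qed
  have "(\<lambda>n. L2_norm \<Omega> (\<lambda>x. W n x - V x)) \<longlonglongrightarrow> 0"
  proof (rule L2_dominated_convergence[OF m mW mV WB B(2) AE_I2])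
    fix x
    have "(\<lambda>n. W n x - V x) \<longlonglongrightarrow> 0"
    proof (rule Lim_null_comparison[OF always_eventually])
      show "\<forall>n. norm (W n x - V x) \<le> L * \<eta> n" using close by simp
      show "(\<lambda>n. L * \<eta> n) \<longlonglongrightarrow> 0" using tendsto_mult_left[OF \<eta>0, of L] by simp
    qed
    then show "(\<lambda>n. W n x) \<longlonglongrightarrow> V x" by (simp add: LIM_zero_iff)
  qed
  moreover have "(\<lambda>n. L2_norm \<Omega> (\<lambda>x. cgrad (W n) x - ?g x)) \<longlonglongrightarrow> 0"
  proof (rule L2_dominated_convergence[OF m mgW mg gL AL])
    show "AE x in lebesgue_on \<Omega>. (\<lambda>n. cgrad (W n) x) \<longlonglongrightarrow> ?g x"
      using S(2) by eventually_elim (use gA in \<open>auto intro: tendsto_eventually\<close>)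
  qed
  moreover have "V \<in> L2_space \<Omega>" by (rule L2_bounded[OF m mV, of B]) (use B in auto)
  moreover have "?g \<in> L2_space \<Omega>" by (rule L2_bounded[OF m mg, of L]) (use AL L0 in auto)
  ultimately show ?thesis unfolding test_limit_def using W by blast
qed

section \<open>Affine functions on a simplex\<close>

lemma simplex_vertices:
  fixes K :: "'a::euclidean_space set"
  assumes "n simplex K"
  obtains C where "finite C" "\<not> affine_dependent C" "int (card C) = n + 1" "K = convex hull C"
    "{x. x extreme_point_of K} = C"
proof -
  obtain C where C: "finite C" "\<not> affine_dependent C" "int (card C) = n + 1" "K = convex hull C"
    using assms by (auto simp: simplex)
  then have "{x. x extreme_point_of K} = C"
    by (simp add: extreme_point_of_convex_hull_affine_independent)
  then show ?thesis using that C by blast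
qed

lemma simplex_compact_convex:
  fixes K :: "'a::euclidean_space set"
  assumes "n simplex K"
  shows "compact K" "convex K" "closed K"
proof -
  obtain C where C: "finite C" "K = convex hull C" using simplex_vertices[OF assms] by metis
  show "compact K" "convex K" unfolding C(2) by (auto intro: finite_imp_compact_convex_hull C(1))
  then show "closed K" by (simp add: compact_imp_closed)
qed

text \<open>
  Affine independence says that the differences to one vertex are linearly independent, so their images
  under a linear functional can be prescribed.
\<close>
lemma affine_interpolation:
  fixes \<psi> :: "'a::euclidean_space \<Rightarrow> real"
  assumes "\<not> affine_dependent C"
  obtains a b where "\<And>p. p \<in> C \<Longrightarrow> a \<bullet> p + b = \<psi> p"
proof (cases "C = {}")
  case False
  then obtain p0 where p0: "p0 \<in> C" by blast
  let ?D = "C - {p0}"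
  have "insert p0 ?D = C" using p0 by blast
  then have ind: "independent ((\<lambda>x. - p0 + x) ` ?D)"
    using assms affine_dependent_iff_dependent[of p0 ?D] by auto
  obtain f :: "'a \<Rightarrow> real" where f: "linear f" "\<And>x. x \<in> (\<lambda>x. - p0 + x) ` ?D \<Longrightarrow> f x = \<psi> (p0 + x) - \<psi> p0"
    using linear_independent_extend[OF ind, of "\<lambda>x. \<psi> (p0 + x) - \<psi> p0"] by blast
  \<comment> \<open>Riesz representation of the functional \<open>f\<close>\<close>
  define a where "a = adjoint f 1"
  have fa: "f x = a \<bullet> x" for x
    using adjoint_works[OF f(1), of x 1] by (simp add: a_def inner_commute)
  show ?thesis
  proof (rule that)
    fix p assume p: "p \<in> C"
    show "a \<bullet> p + (\<psi> p0 - a \<bullet> p0) = \<psi> p"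
    proof (cases "p = p0")
      case False
      then have "a \<bullet> (- p0 + p) = \<psi> (p0 + (- p0 + p)) - \<psi> p0" using f(2) p unfolding fa by blast
      then show ?thesis by (simp add: inner_diff_right)
    qed simp
  qed
qed (use that in blast)

text \<open>
  A compact convex set is the convex hull of its extreme points, and a slab is convex.
\<close>
lemma affine_bounds_from_extreme_points:
  fixes a :: "'a::euclidean_space"
  assumes K: "compact K" "convex K"
    and b: "\<And>p. p extreme_point_of K \<Longrightarrow> lo \<le> a \<bullet> p + b \<and> a \<bullet> p + b \<le> hi" and x: "x \<in> K"
  shows "lo \<le> a \<bullet> x + b \<and> a \<bullet> x + b \<le> hi"
proof -
  have "{x. x extreme_point_of K} \<subseteq> {x. lo - b \<le> a \<bullet> x} \<inter> {x. a \<bullet> x \<le> hi - b}"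
    using b by fastforce
  then have "convex hull {x. x extreme_point_of K} \<subseteq> {x. lo - b \<le> a \<bullet> x} \<inter> {x. a \<bullet> x \<le> hi - b}"
    by (intro hull_minimal convex_Int convex_halfspace_le convex_halfspace_ge)
  then have "x \<in> {x. lo - b \<le> a \<bullet> x} \<inter> {x. a \<bullet> x \<le> hi - b}"
    using x Krein_Milman_Minkowski[OF K] by blast
  then show ?thesis by auto
qed

lemma affine_eq_from_extreme_points:
  fixes a a' :: "'a::euclidean_space"
  assumes K: "compact K" "convex K"
    and eq: "\<And>p. p extreme_point_of K \<Longrightarrow> a \<bullet> p + b = a' \<bullet> p + b'" and x: "x \<in> K"
  shows "a \<bullet> x + b = a' \<bullet> x + b'"
proof -
  have "0 \<le> (a - a') \<bullet> x + (b - b') \<and> (a - a') \<bullet> x + (b - b') \<le> 0"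
  proof (rule affine_bounds_from_extreme_points[OF K _ x])
    fix p assume "p extreme_point_of K"
    from eq[OF this] show "0 \<le> (a - a') \<bullet> p + (b - b') \<and> (a - a') \<bullet> p + (b - b') \<le> 0"
      by (simp add: inner_diff_left)
  qed
  then show ?thesis by (simp add: inner_diff_left)
qed

text \<open>
  An increment is affine in each of its two end points; apply the previous bound twice.
\<close>
lemma affine_oscillation_bound:
  fixes d :: "'a::euclidean_space"
  assumes K: "compact K" "convex K"
    and b: "\<And>p q. p extreme_point_of K \<Longrightarrow> q extreme_point_of K \<Longrightarrow> \<bar>d \<bullet> (p - q)\<bar> \<le> M"
    and x: "x \<in> K" and y: "y \<in> K"
  shows "d \<bullet> (x - y) \<le> M"
proof -
  have 1: "- M \<le> d \<bullet> x + (- (d \<bullet> q)) \<and> d \<bullet> x + (- (d \<bullet> q)) \<le> M" if q: "q extreme_point_of K" for q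
  proof (rule affine_bounds_from_extreme_points[OF K _ x])
    fix p assume "p extreme_point_of K"
    from b[OF this q] show "- M \<le> d \<bullet> p + (- (d \<bullet> q)) \<and> d \<bullet> p + (- (d \<bullet> q)) \<le> M"
      unfolding inner_diff_right by linarith
  qed
  have "- M \<le> (- d) \<bullet> y + d \<bullet> x \<and> (- d) \<bullet> y + d \<bullet> x \<le> M"
  proof (rule affine_bounds_from_extreme_points[OF K _ y])
    fix q assume "q extreme_point_of K"
    from 1[OF this] show "- M \<le> (- d) \<bullet> q + d \<bullet> x \<and> (- d) \<bullet> q + d \<bullet> x \<le> M"
      unfolding inner_minus_left by linarith
  qed
  then show ?thesis by (simp add: inner_diff_right)
qed

text \<open>
  A disc of at least half the optimal radius serves the purpose of an optimal one and exists by the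
  definition of the supremum alone. Nonemptiness of the interior of a triangle makes the supremum positive.
\<close>
lemma inball_diameter_witness:
  fixes K :: "(real^2) set"
  assumes "2 simplex K"
  obtains c r where "r > 0" "cball c r \<subseteq> K" "inball_diameter K \<le> 4 * r" "inball_diameter K > 0"
proof -
  obtain C where C: "\<not> affine_dependent C" "int (card C) = 2 + 1" "K = convex hull C"
    using simplex_vertices[OF assms] by metis
  have "aff_dim K = 2"
    using aff_dim_affine_independent[OF C(1)] C(2) by (simp add: C(3) aff_dim_convex_hull)
  moreover have "convex K" "compact K" using simplex_compact_convex[OF assms] by auto
  moreover have "K \<noteq> {}" using \<open>aff_dim K = 2\<close> by auto
  ultimately have "interior K \<noteq> {}"
    using rel_interior_eq_empty[of K] by (simp add: interior_rel_interior_gen)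
  then obtain c0 r0 where r0: "r0 > 0" "cball c0 r0 \<subseteq> K"
    by (metis ex_in_conv interior_subset mem_interior_cball)
  define R where "R = {r. 0 \<le> r \<and> (\<exists>c. cball c r \<subseteq> K)}"
  have "r \<le> diameter K / 2" if r: "r \<in> R" for r
  proof -
    obtain c where c: "cball c r \<subseteq> K" "0 \<le> r" using r by (auto simp: R_def)
    have "diameter (cball c r) \<le> diameter K"
      using c(1) compact_imp_bounded[OF \<open>compact K\<close>] by (rule diameter_subset)
    then show ?thesis using c(2) by (simp add: diameter_cball)
  qed
  then have bdd: "bdd_above R" by (rule bdd_aboveI)
  have "r0 \<in> R" using r0 by (auto simp: R_def)
  then have "r0 \<le> Sup R" using bdd by (rule cSup_upper)
  then have pos: "Sup R > 0" using r0 by simp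
  then have "Sup R / 2 < Sup R" by simp
  then obtain r where r: "r \<in> R" "Sup R / 2 < r"
    using less_cSupE[of "Sup R / 2" R] \<open>r0 \<in> R\<close> by blast
  then obtain c where "cball c r \<subseteq> K" by (auto simp: R_def)
  moreover have "inball_diameter K = 2 * Sup R" by (simp add: inball_diameter_def R_def)
  ultimately show ?thesis using that[of r c] r pos by simp
qed

text \<open>
  On a triangle, the affine interpolant of a \<open>C1\<close> function differs in gradient from the function at
  \<open>x\<close> by a vector \<open>d\<close> whose increments between any two points of the triangle are at most the
  oscillation of the gradient times the diameter; an inscribed disc converts this into a bound on \<open>d\<close>.
\<close>
lemma interpolation_gradient_error:
  fixes K :: "(real^2) set" and \<psi> :: "real^2 \<Rightarrow> real"
  assumes K: "2 simplex K" and reg: "diameter K / inball_diameter K \<le> \<sigma>"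
    and diff: "\<And>y. \<psi> differentiable at y"
    and osc: "\<And>x y. x \<in> K \<Longrightarrow> y \<in> K \<Longrightarrow> norm (cgrad \<psi> y - cgrad \<psi> x) \<le> \<omega>" "\<omega> \<ge> 0"
    and ip: "\<And>p. p extreme_point_of K \<Longrightarrow> a \<bullet> p + b = \<psi> p" and x: "x \<in> K"
  shows "norm (a - cgrad \<psi> x) \<le> 2 * \<omega> * \<sigma>"
proof -
  note Kc = simplex_compact_convex[OF K]
  define d where "d = a - cgrad \<psi> x"
  define M where "M = \<omega> * diameter K"
  have vert: "\<bar>d \<bullet> (p - q)\<bar> \<le> M" if p: "p extreme_point_of K" and q: "q extreme_point_of K" for p q
  proof -
    have pq: "p \<in> K" "q \<in> K" using p q unfolding extreme_point_of_def by blast+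
    let ?f = "\<lambda>y. \<psi> y - cgrad \<psi> x \<bullet> y"
    have "norm (?f p - ?f q) \<le> \<omega> * norm (p - q)"
    proof (rule differentiable_bound[where f="?f" and S=K
          and f'="\<lambda>y v. cgrad \<psi> y \<bullet> v - cgrad \<psi> x \<bullet> v"])
      show "convex K" "p \<in> K" "q \<in> K" by (fact Kc(2) pq)+
    next
      fix y assume y: "y \<in> K"
      show "(?f has_derivative (\<lambda>v. cgrad \<psi> y \<bullet> v - cgrad \<psi> x \<bullet> v)) (at y within K)"
        by (rule has_derivative_at_withinI, rule has_derivative_diff, rule has_derivative_cgrad[OF diff])
           (rule bounded_linear_imp_has_derivative[OF bounded_linear_inner_right])
      show "onorm (\<lambda>v. cgrad \<psi> y \<bullet> v - cgrad \<psi> x \<bullet> v) \<le> \<omega>"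
      proof (rule onorm_le)
        fix v
        have "norm (cgrad \<psi> y \<bullet> v - cgrad \<psi> x \<bullet> v) \<le> norm (cgrad \<psi> y - cgrad \<psi> x) * norm v"
          using Cauchy_Schwarz_ineq2[of "cgrad \<psi> y - cgrad \<psi> x" v] by (simp add: inner_diff_left)
        also have "\<dots> \<le> \<omega> * norm v" using osc(1)[OF x y] by (intro mult_right_mono) auto
        finally show "norm (cgrad \<psi> y \<bullet> v - cgrad \<psi> x \<bullet> v) \<le> \<omega> * norm v" .
      qed
    qed
    also have "\<dots> \<le> M" unfolding M_def
      using diameter_bounded_bound[OF compact_imp_bounded[OF Kc(1)] pq] osc(2)
      by (intro mult_left_mono) (auto simp: dist_norm)
    finally have "\<bar>(\<psi> p - cgrad \<psi> x \<bullet> p) - (\<psi> q - cgrad \<psi> x \<bullet> q)\<bar> \<le> M" by simp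
    then show ?thesis
      using ip[OF p] ip[OF q] by (simp add: d_def inner_diff_left inner_diff_right algebra_simps)
  qed
  obtain c r where r: "r > 0" "cball c r \<subseteq> K" "inball_diameter K \<le> 4 * r" "inball_diameter K > 0"
    using inball_diameter_witness[OF K] by metis
  have \<sigma>: "\<sigma> \<ge> 0" "diameter K \<le> \<sigma> * inball_diameter K"
  proof -
    have "0 \<le> diameter K" by (rule diameter_ge_0[OF compact_imp_bounded[OF Kc(1)]])
    then have "0 \<le> diameter K / inball_diameter K" using r(4) by simp
    then show "\<sigma> \<ge> 0" using reg by linarith
    show "diameter K \<le> \<sigma> * inball_diameter K" using reg r(4) by (simp add: pos_divide_le_eq)
  qed
  have "norm d \<le> 2 * \<omega> * \<sigma>"
  proof (cases "d = 0")
    case False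
    \<comment> \<open>the two ends of the diameter of the disc in direction \<open>d\<close>\<close>
    define u where "u = (r / norm d) *\<^sub>R d"
    have nu: "norm u = r" using False r(1) by (simp add: u_def)
    have "c + u \<in> K" "c - u \<in> K" using r(2) nu by (auto simp: subset_iff dist_norm)
    from affine_oscillation_bound[OF Kc(1,2) vert this]
    have "d \<bullet> ((c + u) - (c - u)) \<le> M" by simp
    moreover have "d \<bullet> ((c + u) - (c - u)) = 2 * (d \<bullet> u)"
      unfolding inner_diff_right inner_add_right by simp
    moreover have "d \<bullet> u = r * norm d"
      using False by (simp add: u_def power2_norm_eq_inner[symmetric] power2_eq_square)
    ultimately have "2 * r * norm d \<le> M" by simp
    also have "M \<le> \<omega> * (\<sigma> * (4 * r))"
      unfolding M_def using \<sigma> osc(2) r(3) by (intro mult_left_mono) (auto intro: order_trans[OF _ mult_left_mono])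
    finally have "(2 * r) * norm d \<le> (2 * r) * (2 * \<omega> * \<sigma>)" by (simp add: algebra_simps)
    then show ?thesis using r(1) by simp
  qed (use osc(2) \<sigma>(1) in simp)
  then show ?thesis by (simp add: d_def)
qed

section \<open>The piecewise affine interpolant\<close>

text \<open>
  Two elements meet in a common face, whose extreme points are extreme points of both. There the two
  affine pieces take the same nodal values, so they agree on the face and the pieces fit together.
\<close>
lemma piecewise_affine_interpolant:
  fixes \<psi> :: "'a::euclidean_space \<Rightarrow> real"
  assumes T: "triangulation T"
  obtains w A B where "\<And>K x. K \<in> T \<Longrightarrow> x \<in> K \<Longrightarrow> w x = A K \<bullet> x + B K"
    "\<And>K p. K \<in> T \<Longrightarrow> p extreme_point_of K \<Longrightarrow> w p = \<psi> p" "\<And>x. x \<notin> \<Union>T \<Longrightarrow> w x = 0"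
proof -
  have simplex: "\<exists>n. n simplex K" if "K \<in> T" for K using T that by (auto simp: triangulation_def)
  have face: "(K \<inter> K') face_of K" if "K \<in> T" "K' \<in> T" for K K'
    using T that by (auto simp: triangulation_def)
  have "\<forall>K\<in>T. \<exists>ab. \<forall>p. p extreme_point_of K \<longrightarrow> fst ab \<bullet> p + snd ab = \<psi> p"
  proof
    fix K assume "K \<in> T"
    then obtain n where "n simplex K" using simplex by blast
    then obtain C where C: "\<not> affine_dependent C" "{x. x extreme_point_of K} = C"
      using simplex_vertices by metis
    obtain a b where "\<And>p. p \<in> C \<Longrightarrow> a \<bullet> p + b = \<psi> p" using affine_interpolation[OF C(1), of \<psi>] by blast
    then show "\<exists>ab. \<forall>p. p extreme_point_of K \<longrightarrow> fst ab \<bullet> p + snd ab = \<psi> p"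
      using C(2) by (intro exI[of _ "(a, b)"]) auto
  qed
  then obtain ab where ab: "\<And>K p. K \<in> T \<Longrightarrow> p extreme_point_of K \<Longrightarrow> fst (ab K) \<bullet> p + snd (ab K) = \<psi> p"
    by metis
  define w where "w = (\<lambda>x. if x \<in> \<Union>T then (let K = (SOME K. K \<in> T \<and> x \<in> K) in fst (ab K) \<bullet> x + snd (ab K)) else 0)"
  have w: "w x = fst (ab K) \<bullet> x + snd (ab K)" if K: "K \<in> T" "x \<in> K" for K x
  proof -
    define K' where "K' = (SOME K. K \<in> T \<and> x \<in> K)"
    have "K' \<in> T \<and> x \<in> K'" unfolding K'_def by (rule someI[of _ K]) (use K in blast)
    then have K': "K' \<in> T" "x \<in> K'" by auto
    have wx: "w x = fst (ab K') \<bullet> x + snd (ab K')" using K by (auto simp: w_def K'_def Let_def)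
    let ?F = "K \<inter> K'"
    have f: "?F face_of K" "?F face_of K'" using face[OF K(1) K'(1)] face[OF K'(1) K(1)] by (auto simp: Int_commute)
    have xF: "x \<in> ?F" using K(2) K'(2) by simp
    obtain n n' where "n simplex K" "n' simplex K'" using simplex K(1) K'(1) by blast
    then have "compact ?F" "convex ?F"
      using simplex_compact_convex[of n K] simplex_compact_convex[of n' K'] by (auto intro: compact_Int convex_Int)
    moreover have "fst (ab K') \<bullet> p + snd (ab K') = fst (ab K) \<bullet> p + snd (ab K)" if "p extreme_point_of ?F" for p
      using that ab[OF K(1), of p] ab[OF K'(1), of p] extreme_point_of_face[OF f(1), of p]
        extreme_point_of_face[OF f(2), of p] by metis
    ultimately have "fst (ab K') \<bullet> x + snd (ab K') = fst (ab K) \<bullet> x + snd (ab K)"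
      using xF by (rule affine_eq_from_extreme_points)
    then show ?thesis using wx by simp
  qed
  show ?thesis
  proof (rule that[OF w])
    show "w p = \<psi> p" if "K \<in> T" "p extreme_point_of K" for K p
    proof -
      have "p \<in> K" using that(2) unfolding extreme_point_of_def by blast
      then show ?thesis using w[OF that(1)] ab[OF that] by simp
    qed
    show "w x = 0" if "x \<notin> \<Union>T" for x using that by (auto simp: w_def)
  qed
qed

text \<open>
  A segment is covered by finitely many closed pieces on each of which the restriction is Lipschitz. The
  closed set \<open>N\<close> on which \<open>w\<close> vanishes completes the cover outside the mesh.
\<close>
lemma piecewise_affine_lipschitz:
  fixes w :: "'a::euclidean_space \<Rightarrow> real"
  assumes T: "finite T" "\<And>K. K \<in> T \<Longrightarrow> closed K" and N: "closed N" "N \<union> \<Union>T = UNIV" "\<And>x. x \<in> N \<Longrightarrow> w x = 0"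
    and aff: "\<And>K x. K \<in> T \<Longrightarrow> x \<in> K \<Longrightarrow> w x = A K \<bullet> x + B K"
    and L: "\<And>K. K \<in> T \<Longrightarrow> norm (A K) \<le> L" "L \<ge> 0"
  shows "\<bar>w x - w y\<bar> \<le> L * norm (x - y)"
proof -
  define g where "g = (\<lambda>t::real. y + t *\<^sub>R (x - y))"
  have cg: "continuous_on UNIV g" unfolding g_def by (intro continuous_intros)
  have "lipschitz_on (L * norm (x - y)) {0..1} (w \<circ> g)"
  proof (rule lipschitz_on_closed_Union[where I="insert N T" and U="\<lambda>i. g -` i"])
    fix i assume i: "i \<in> insert N T"
    show "closed (g -` i)"
      using i T(2) N(1) by (intro closed_vimage cg) auto
    show "lipschitz_on (L * norm (x - y)) (g -` i) (w \<circ> g)"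
    proof (rule lipschitz_onI)
      fix s t assume st: "s \<in> g -` i" "t \<in> g -` i"
      show "dist ((w \<circ> g) s) ((w \<circ> g) t) \<le> L * norm (x - y) * dist s t"
      proof (cases "i = N")
        case True
        then show ?thesis using st N(3) L(2) by simp
      next
        case False
        then have iT: "i \<in> T" using i by blast
        have "(w \<circ> g) s - (w \<circ> g) t = (s - t) * (A i \<bullet> (x - y))"
          using st aff[OF iT, of "g s"] aff[OF iT, of "g t"] by (simp add: g_def inner_add_right algebra_simps)
        then have "dist ((w \<circ> g) s) ((w \<circ> g) t) = \<bar>s - t\<bar> * \<bar>A i \<bullet> (x - y)\<bar>"
          by (simp only: dist_real_def abs_mult)
        also have "\<dots> \<le> \<bar>s - t\<bar> * (norm (A i) * norm (x - y))"
          by (intro mult_left_mono Cauchy_Schwarz_ineq2) auto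
        also have "\<dots> \<le> \<bar>s - t\<bar> * (L * norm (x - y))"
          using L(1)[OF iT] by (intro mult_left_mono mult_right_mono) auto
        finally show ?thesis by (simp add: dist_real_def mult.commute)
      qed
    qed (use L(2) in simp)
  next
    show "finite (insert N T)" using T(1) by simp
    show "0 \<le> L * norm (x - y)" using L(2) by simp
    show "{0..1} \<subseteq> (\<Union>i\<in>insert N T. g -` i)"
    proof
      fix t :: real
      have "g t \<in> N \<union> \<Union>T" using N(2) by blast
      then show "t \<in> (\<Union>i\<in>insert N T. g -` i)" by blast
    qed
  qed
  from lipschitz_onD[OF this, of 1 0] show ?thesis by (simp add: g_def dist_real_def)
qed

lemma AE_interior_of_elements:
  assumes \<Omega>: "open \<Omega>" and T: "finite T" "\<And>K. K \<in> T \<Longrightarrow> convex K" "\<And>K. K \<in> T \<Longrightarrow> closed K" "\<Omega> \<subseteq> \<Union>T"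
  shows "AE x in lebesgue_on \<Omega>. x \<in> (\<Union>K\<in>T. interior K)"
proof -
  let ?N = "\<Union>K\<in>T. frontier K"
  have "negligible ?N" using T negligible_convex_frontier by (intro negligible_Union) auto
  then have "AE x in lebesgue. x \<notin> ?N"
    unfolding negligible_iff_null_sets by (rule AE_not_in)
  then have "AE x in lebesgue. x \<in> \<Omega> \<longrightarrow> x \<in> (\<Union>K\<in>T. interior K)"
  proof eventually_elim
    fix x assume x: "x \<notin> ?N"
    show "x \<in> \<Omega> \<longrightarrow> x \<in> (\<Union>K\<in>T. interior K)"
    proof
      assume "x \<in> \<Omega>"
      then obtain K where K: "K \<in> T" "x \<in> K" using T(4) by blast
      then have "x \<notin> frontier K" using x by blast
      then have "x \<in> interior K" using K T(3) by (auto simp: frontier_def)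
      then show "x \<in> (\<Union>K\<in>T. interior K)" using K by blast
    qed
  qed
  then show ?thesis using \<Omega> by (subst AE_restrict_space_iff) auto
qed

text \<open>
  The mesh size \<open>h0\<close> is chosen from three moduli: those of \<open>\<psi>\<close> and of its gradient, both uniformly
  continuous on the closure of \<open>\<Omega>\<close>, and the distance of the support of \<open>\<psi>\<close> to the complement of \<open>\<Omega>\<close>.
  The last one keeps the support of the interpolant inside \<open>\<Omega>\<close>.
\<close>
lemma interpolation:
  assumes \<Omega>: "open \<Omega>" "bounded \<Omega>" and \<psi>: "\<psi> \<in> C1_compact \<Omega>"
    and box: "\<epsilon> > 0" "k > 0" "\<And>x. - \<epsilon> \<le> \<psi> x \<and> \<psi> x \<le> k" and \<eta>: "\<eta> > 0" and \<sigma>: "\<sigma> \<ge> 0"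
  obtains h0 where "h0 > 0" and "\<And>T. \<lbrakk>triangulation_of \<Omega> T; \<And>K. K \<in> T \<Longrightarrow> diameter K < h0;
      \<And>K. K \<in> T \<Longrightarrow> diameter K / inball_diameter K \<le> \<sigma>\<rbrakk> \<Longrightarrow>
      \<exists>w\<in>P1_box \<Omega> T \<epsilon> k. L2_norm \<Omega> (\<lambda>x. w x - \<psi> x) \<le> \<eta> \<and>
        L2_norm \<Omega> (\<lambda>x. grad \<Omega> w x - cgrad \<psi> x) \<le> \<eta> \<and> (\<forall>x. - \<epsilon> \<le> w x \<and> w x \<le> k)"
proof -
  have m: "\<Omega> \<in> lmeasurable" using \<Omega> by (simp add: lmeasurable_open)
  define \<mu> where "\<mu> = sqrt (measure lebesgue \<Omega>)"
  have \<mu>: "\<mu> \<ge> 0" by (simp add: \<mu>_def)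
  \<comment> \<open>a uniform error \<open>e\<close> has \<open>L2\<close> norm at most \<open>e \<mu> \<le> \<eta>\<close>; the \<open>+ 1\<close> avoids division by zero\<close>
  define e where "e = \<eta> / (\<mu> + 1)"
  have e: "e > 0" "e * \<mu> \<le> \<eta>" using \<eta> \<mu> by (auto simp: e_def field_simps)
  \<comment> \<open>\<open>interpolation_gradient_error\<close> loses a factor \<open>2 \<sigma>\<close>\<close>
  define \<omega> where "\<omega> = e / (2 * (\<sigma> + 1))"
  have \<omega>: "\<omega> > 0" "2 * \<omega> * \<sigma> \<le> e" using e \<sigma> by (auto simp: \<omega>_def field_simps)
  let ?C = "closure \<Omega>" and ?S = "closure {x. \<psi> x \<noteq> 0}"
  have C: "compact ?C" using \<Omega>(2) by (simp add: compact_closure)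
  have C\<psi>: "C_k (Suc 0) \<psi>" and S: "compact ?S" "?S \<subseteq> \<Omega>" using \<psi> by (auto simp: C1_compact_def)
  have diff: "\<psi> differentiable at x" for x using C\<psi> by simp
  have "uniformly_continuous_on ?C \<psi>"
    by (intro compact_uniformly_continuous C C_k_imp_continuous[OF C\<psi>])
  then obtain d1 where d1: "d1 > 0" "\<And>x y. x \<in> ?C \<Longrightarrow> y \<in> ?C \<Longrightarrow> dist y x < d1 \<Longrightarrow> dist (\<psi> y) (\<psi> x) < e"
    unfolding uniformly_continuous_on_def using e(1) by metis
  have "uniformly_continuous_on ?C (cgrad \<psi>)"
    by (intro compact_uniformly_continuous C C_k_cgrad_continuous[OF C\<psi>])
  then obtain d2 where d2: "d2 > 0" "\<And>x y. x \<in> ?C \<Longrightarrow> y \<in> ?C \<Longrightarrow> dist y x < d2 \<Longrightarrow> dist (cgrad \<psi> y) (cgrad \<psi> x) < \<omega>"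
    unfolding uniformly_continuous_on_def using \<omega>(1) by metis
  obtain d3 where d3: "d3 > 0" "(\<Union>x\<in>?S. cball x d3) \<subseteq> \<Omega>"
    using compact_subset_open_imp_cball_epsilon_subset[OF S(1) \<Omega>(1) S(2)] by metis
  define N where "N = {x + y | x y. x \<in> ?S \<and> y \<in> cball 0 d3}"
  have N: "compact N" unfolding N_def by (intro compact_sums S) auto
  have N\<Omega>: "N \<subseteq> \<Omega>"
  proof
    fix z assume "z \<in> N"
    then obtain x y where "z = x + y" "x \<in> ?S" "norm y \<le> d3" by (auto simp: N_def)
    then have "z \<in> cball x d3" by (simp add: dist_norm)
    then show "z \<in> \<Omega>" using d3(2) \<open>x \<in> ?S\<close> by blast
  qed
  show ?thesis
  proof (rule that[of "min d1 (min d2 d3)"])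
    show "min d1 (min d2 d3) > 0" using d1 d2 d3 by simp
    fix T assume T: "triangulation_of \<Omega> T" and h: "\<And>K. K \<in> T \<Longrightarrow> diameter K < min d1 (min d2 d3)"
      and reg: "\<And>K. K \<in> T \<Longrightarrow> diameter K / inball_diameter K \<le> \<sigma>"
    have tri: "triangulation T" and simplex: "\<And>K. K \<in> T \<Longrightarrow> 2 simplex K" and cover: "\<Union>T = ?C"
      using T by (auto simp: triangulation_of_def)
    have fin: "finite T" using tri by (simp add: triangulation_def)
    have Kc: "compact K" "convex K" "closed K" if "K \<in> T" for K
      using simplex_compact_convex[OF simplex[OF that]] by auto
    have dK: "dist x y < min d1 (min d2 d3)" if "K \<in> T" "x \<in> K" "y \<in> K" for K x y
      using diameter_bounded_bound[OF compact_imp_bounded[OF Kc(1)[OF that(1)]] that(2,3)] h[OF that(1)] by simp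
    have extr: "p \<in> K" if "p extreme_point_of K" for p and K :: "(real^2) set"
      using that unfolding extreme_point_of_def by blast
    have KC: "x \<in> ?C" if "K \<in> T" "x \<in> K" for K x using cover that by blast
    obtain w A B where w: "\<And>K x. K \<in> T \<Longrightarrow> x \<in> K \<Longrightarrow> w x = A K \<bullet> x + B K"
      "\<And>K p. K \<in> T \<Longrightarrow> p extreme_point_of K \<Longrightarrow> w p = \<psi> p" "\<And>x. x \<notin> \<Union>T \<Longrightarrow> w x = 0"
      using piecewise_affine_interpolant[OF tri, of \<psi>] by metis
    have vert: "A K \<bullet> p + B K = \<psi> p" if "K \<in> T" "p extreme_point_of K" for K p
      using w(1)[OF that(1) extr[OF that(2)]] w(2)[OF that] by simp
    have wbox: "- \<epsilon> \<le> w x \<and> w x \<le> k" for x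
    proof (cases "x \<in> \<Union>T")
      case True
      then obtain K where K: "K \<in> T" "x \<in> K" by blast
      have "- \<epsilon> \<le> A K \<bullet> x + B K \<and> A K \<bullet> x + B K \<le> k"
        by (rule affine_bounds_from_extreme_points[OF Kc(1,2)[OF K(1)] _ K(2)]) (simp add: vert[OF K(1)] box(3))
      then show ?thesis by (simp add: w(1)[OF K])
    qed (use w(3) box in simp)
    have werr: "\<bar>w x - \<psi> x\<bar> \<le> e" if x: "x \<in> ?C" for x
    proof -
      obtain K where K: "K \<in> T" "x \<in> K" using cover x by blast
      have "\<psi> x - e \<le> A K \<bullet> x + B K \<and> A K \<bullet> x + B K \<le> \<psi> x + e"
      proof (rule affine_bounds_from_extreme_points[OF Kc(1,2)[OF K(1)] _ K(2)])
        fix p assume p: "p extreme_point_of K"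
        have "dist (\<psi> p) (\<psi> x) < e"
          using d1(2)[OF KC[OF K] KC[OF K(1) extr[OF p]]] dK[OF K(1) extr[OF p] K(2)] by simp
        then show "\<psi> x - e \<le> A K \<bullet> p + B K \<and> A K \<bullet> p + B K \<le> \<psi> x + e"
          unfolding vert[OF K(1) p] dist_real_def by linarith
      qed
      then show ?thesis unfolding w(1)[OF K] by linarith
    qed
    have gerr: "norm (A K - cgrad \<psi> x) \<le> e" if K: "K \<in> T" "x \<in> K" for K x
    proof -
      have "norm (A K - cgrad \<psi> x) \<le> 2 * \<omega> * \<sigma>"
      proof (rule interpolation_gradient_error[OF simplex[OF K(1)] reg[OF K(1)] diff _ _ vert[OF K(1)] K(2)])
        fix x y assume xy: "x \<in> K" "y \<in> K"
        then have "dist (cgrad \<psi> y) (cgrad \<psi> x) < \<omega>"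
          using d2(2)[OF KC[OF K(1)] KC[OF K(1)]] dK[OF K(1) xy(2,1)] by simp
        then show "norm (cgrad \<psi> y - cgrad \<psi> x) \<le> \<omega>" by (simp add: dist_norm)
      qed (use \<omega> in auto)
      then show ?thesis using \<omega>(2) by linarith
    qed
    have supp: "w x = 0" if x: "x \<notin> N" for x
    proof (cases "x \<in> \<Union>T")
      case True
      then obtain K where K: "K \<in> T" "x \<in> K" by blast
      have "\<psi> p = 0" if p: "p extreme_point_of K" for p
      proof (rule ccontr)
        assume "\<psi> p \<noteq> 0"
        then have "p \<in> ?S" using closure_subset[of "{x. \<psi> x \<noteq> 0}"] by blast
        moreover have "norm (x - p) \<le> d3" using dK[OF K extr[OF p]] by (simp add: dist_norm)
        ultimately have "p + (x - p) \<in> N" unfolding N_def by fastforce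
        then show False using x by simp
      qed
      then have "0 \<le> A K \<bullet> x + B K \<and> A K \<bullet> x + B K \<le> 0"
        by (intro affine_bounds_from_extreme_points[OF Kc(1,2)[OF K(1)] _ K(2)]) (simp add: vert[OF K(1)])
      then show ?thesis by (simp add: w(1)[OF K])
    qed (use w(3) in simp)
    define L where "L = (\<Sum>K\<in>T. norm (A K))"
    have L: "norm (A K) \<le> L" if "K \<in> T" for K
      unfolding L_def using that fin by (intro member_le_sum) auto
    have L0: "L \<ge> 0" by (simp add: L_def sum_nonneg)
    have lip: "\<bar>w x - w y\<bar> \<le> L * norm (x - y)" for x y
    proof (rule piecewise_affine_lipschitz[OF fin Kc(3) _ _ _ w(1) L L0])
      show "closed (- \<Omega>)" using \<Omega>(1) by (rule closed_Compl)
      show "- \<Omega> \<union> \<Union>T = UNIV" using cover closure_subset[of \<Omega>] by blast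
      show "w x = 0" if "x \<in> - \<Omega>" for x using supp that N\<Omega> by blast
    qed
    let ?I = "\<Union>K\<in>T. interior K"
    define g where "g = (\<lambda>x. A (SOME K. K \<in> T \<and> x \<in> interior K))"
    have AEI: "AE x in lebesgue_on \<Omega>. x \<in> ?I"
      using cover closure_subset[of \<Omega>] by (intro AE_interior_of_elements[OF \<Omega>(1) fin Kc(2,3)]) auto
    have g: "\<exists>K\<in>T. x \<in> interior K \<and> g x = A K" if "x \<in> ?I" for x
    proof -
      have "\<exists>K. K \<in> T \<and> x \<in> interior K" using that by blast
      from someI_ex[OF this] show ?thesis unfolding g_def by blast
    qed
    have tl: "test_limit \<Omega> w (\<lambda>x. if x \<in> ?I then g x else 0)"
    proof (rule locally_affine_compact_support_test_limit[OF \<Omega> lip N supp N\<Omega> _ AEI])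
      show "open ?I" by auto
      fix x assume "x \<in> ?I"
      then obtain K where K: "K \<in> T" "x \<in> interior K" "g x = A K" using g by blast
      then obtain r where "r > 0" "ball x r \<subseteq> K" using mem_interior by blast
      then show "\<exists>r>0. \<exists>b. \<forall>u\<in>ball x r. w u = g x \<bullet> u + b" using w(1)[OF K(1)] K(3) by auto
    qed
    note H = test_limit_imp_H1_0[OF \<Omega> tl]
    have "w \<in> H1 \<Omega>" using H(1) by (simp add: H1_0_def)
    note wL = H1_grad[OF \<Omega> this]
    have cw: "continuous_on UNIV w"
      by (rule lipschitz_on_continuous_on[of L]) (use lip L0 in \<open>auto simp: lipschitz_on_def dist_norm\<close>)
    note \<psi>L = C1_compact_L2[OF \<Omega> \<psi>]
    have "w \<in> P1_box \<Omega> T \<epsilon> k"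
      unfolding P1_box_def P1_space_def using H(1) wbox w(1) cw by (auto intro: continuous_on_subset)
    moreover have "L2_norm \<Omega> (\<lambda>x. w x - \<psi> x) \<le> e * \<mu>"
      unfolding \<mu>_def
    proof (rule L2_norm_bounded[OF m L2_spaceD(1)[OF L2_diff[OF wL(1) \<psi>L(1)]]])
      show "AE x in lebesgue_on \<Omega>. norm (w x - \<psi> x) \<le> e"
        using werr closure_subset[of \<Omega>] by (intro AE_I2) (auto simp: subset_iff)
    qed (use e in simp)
    moreover have "L2_norm \<Omega> (\<lambda>x. grad \<Omega> w x - cgrad \<psi> x) \<le> e * \<mu>"
      unfolding \<mu>_def
    proof (rule L2_norm_bounded[OF m L2_spaceD(1)[OF L2_diff[OF wL(2) \<psi>L(2)]]])
      show "AE x in lebesgue_on \<Omega>. norm (grad \<Omega> w x - cgrad \<psi> x) \<le> e"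
        using AEI H(2)
      proof eventually_elim
        fix x assume x: "x \<in> ?I" and eq: "grad \<Omega> w x = (if x \<in> ?I then g x else 0)"
        obtain K where K: "K \<in> T" "x \<in> interior K" "g x = A K" using g[OF x] by blast
        then have "x \<in> K" using interior_subset by blast
        have "grad \<Omega> w x = A K" using eq x K(3) by presburger
        then show "norm (grad \<Omega> w x - cgrad \<psi> x) \<le> e" using gerr[OF K(1) \<open>x \<in> K\<close>] by simp
      qed
    qed (use e in simp)
    ultimately show "\<exists>w\<in>P1_box \<Omega> T \<epsilon> k. L2_norm \<Omega> (\<lambda>x. w x - \<psi> x) \<le> \<eta> \<and>
        L2_norm \<Omega> (\<lambda>x. grad \<Omega> w x - cgrad \<psi> x) \<le> \<eta> \<and> (\<forall>x. - \<epsilon> \<le> w x \<and> w x \<le> k)"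
      using e(2) wbox by (intro bexI[of _ w]) auto
  qed
qed

section \<open>Vanishing boundary values\<close>

lemma integrable_square_difference:
  fixes V :: "'a::euclidean_space \<Rightarrow> real"
  assumes [measurable]: "V \<in> borel_measurable borel" and V: "integrable lborel (\<lambda>x. (V x)\<^sup>2)"
  shows "integrable lborel (\<lambda>x. (V (a + x) - V (b + x))\<^sup>2)"
proof (rule Bochner_Integration.integrable_bound)
  show "integrable lborel (\<lambda>x. 2 * (V (a + x))\<^sup>2 + 2 * (V (b + x))\<^sup>2)"
    by (intro Bochner_Integration.integrable_add integrable_mult_right lborel_integrable_translate[OF V])
  have "(V (a + x) - V (b + x))\<^sup>2 \<le> 2 * (V (a + x))\<^sup>2 + 2 * (V (b + x))\<^sup>2" for x
    using sum_squares_bound[of "V (a + x)" "- V (b + x)"] by (simp add: power2_diff)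
  then show "AE x in lborel. norm ((V (a + x) - V (b + x))\<^sup>2) \<le> norm (2 * (V (a + x))\<^sup>2 + 2 * (V (b + x))\<^sup>2)"
    by (intro AE_I2) simp
qed measurable

text \<open>
  Cutting the translation \<open>v\<close> into \<open>n\<close> equal steps bounds the square of the increment by \<open>n\<close> times the
  sum of the squares of \<open>n\<close> short increments, all with the same integral; in the limit the short
  increments become the derivative in direction \<open>v\<close>.
\<close>
lemma translation_estimate_C1:
  fixes \<phi> :: "'a::euclidean_space \<Rightarrow> real"
  assumes C1: "C_k (Suc 0) \<phi>" and K: "compact (closure {x. \<phi> x \<noteq> 0})"
  shows "(\<integral>x. (\<phi> (v + x) - \<phi> x)\<^sup>2 \<partial>lborel) \<le> (\<integral>x. (frechet_derivative \<phi> (at x) v)\<^sup>2 \<partial>lborel)"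
proof -
  have c: "continuous_on UNIV \<phi>" using C1 by (rule C_k_imp_continuous)
  then have [measurable]: "\<phi> \<in> borel_measurable borel" by (rule borel_measurable_continuous_onI)
  have "continuous_on UNIV (\<lambda>x. frechet_derivative \<phi> (at x) v)" using C1 by simp
  then have [measurable]: "(\<lambda>x. frechet_derivative \<phi> (at x) v) \<in> borel_measurable borel"
    by (rule borel_measurable_continuous_onI)
  have sq: "integrable lborel (\<lambda>x. (\<phi> x)\<^sup>2)"
    by (rule integrable_lborel_compact_support[OF _ K])
       (use closure_subset[of "{x. \<phi> x \<noteq> 0}"] in \<open>auto intro!: continuous_intros c\<close>)
  define s where "s = (\<lambda>n x. (\<phi> (x + (1 / real (Suc n)) *\<^sub>R v) - \<phi> x) * real (Suc n))"
  obtain B R where s: "\<And>n x. \<bar>s n x\<bar> \<le> indicator (cball 0 R) x *\<^sub>R B"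
    "\<And>x. (\<lambda>n. s n x) \<longlonglongrightarrow> frechet_derivative \<phi> (at x) v"
  proof (rule difference_quotients[OF C1 K, of v])
    fix B R
    assume "\<And>n x. \<bar>(\<phi> (x + (1 / real (Suc n)) *\<^sub>R v) - \<phi> x) * real (Suc n)\<bar> \<le> indicator (cball 0 R) x *\<^sub>R B"
      and "\<And>x. (\<lambda>n. (\<phi> (x + (1 / real (Suc n)) *\<^sub>R v) - \<phi> x) * real (Suc n)) \<longlonglongrightarrow> frechet_derivative \<phi> (at x) v"
    then show ?thesis by (intro that[of R B]) (simp_all only: s_def)
  qed
  have step: "(\<integral>x. (\<phi> (v + x) - \<phi> x)\<^sup>2 \<partial>lborel) \<le> (\<integral>x. (s n x)\<^sup>2 \<partial>lborel)" for n
  proof -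
    define m where "m = real (Suc n)"
    have m: "m > 0" by (simp add: m_def)
    define p where "p = (\<lambda>j::nat. (real j / m) *\<^sub>R v)"
    define w where "w = (1 / m) *\<^sub>R v"
    define I where "I = (\<integral>x. (\<phi> (w + x) - \<phi> x)\<^sup>2 \<partial>lborel)"
    have pS: "p (Suc j) + x = w + (p j + x)" for j x
      by (simp add: p_def w_def add_divide_distrib scaleR_left_distrib)
    have int: "integrable lborel (\<lambda>x. (\<phi> (p (Suc j) + x) - \<phi> (p j + x))\<^sup>2)" for j
      by (rule integrable_square_difference[OF _ sq]) simp
    have same: "(\<integral>x. (\<phi> (p (Suc j) + x) - \<phi> (p j + x))\<^sup>2 \<partial>lborel) = I" for j
    proof -
      have "(\<lambda>x. (\<phi> (w + x) - \<phi> x)\<^sup>2) \<in> borel_measurable borel" by measurable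
      from lborel_integral_translate[OF this, of "p j"] show ?thesis unfolding I_def pS .
    qed
    have "(\<phi> (v + x) - \<phi> x)\<^sup>2 \<le> m * (\<Sum>j<Suc n. (\<phi> (p (Suc j) + x) - \<phi> (p j + x))\<^sup>2)" for x
    proof -
      have "(\<Sum>j<Suc n. \<phi> (p (Suc j) + x) - \<phi> (p j + x)) = \<phi> (p (Suc n) + x) - \<phi> (p 0 + x)"
        by (rule sum_lessThan_telescope)
      also have "\<dots> = \<phi> (v + x) - \<phi> x" using m by (simp add: p_def m_def del: of_nat_Suc)
      finally show ?thesis
        using sum_squared_le_sum_of_squares[of "\<lambda>j. \<phi> (p (Suc j) + x) - \<phi> (p j + x)" "{..<Suc n}"]
        by (simp add: m_def mult.commute del: of_nat_Suc sum.lessThan_Suc)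
    qed
    then have "(\<integral>x. (\<phi> (v + x) - \<phi> x)\<^sup>2 \<partial>lborel) \<le> (\<integral>x. m * (\<Sum>j<Suc n. (\<phi> (p (Suc j) + x) - \<phi> (p j + x))\<^sup>2) \<partial>lborel)"
      using integrable_square_difference[OF _ sq, of v 0]
      by (intro integral_mono integrable_mult_right Bochner_Integration.integrable_sum int) auto
    also have "\<dots> = m * (\<Sum>j<Suc n. I)"
      using int by (simp add: same del: sum.lessThan_Suc sum_constant)
    also have "\<dots> = m\<^sup>2 * I" by (simp add: m_def power2_eq_square)
    also have "\<dots> = (\<integral>x. (s n x)\<^sup>2 \<partial>lborel)"
      by (simp add: I_def s_def w_def m_def power_mult_distrib add.commute mult.commute del: of_nat_Suc)
    finally show ?thesis .
  qed
  have "(\<lambda>n. \<integral>x. (s n x)\<^sup>2 \<partial>lborel) \<longlonglongrightarrow> (\<integral>x. (frechet_derivative \<phi> (at x) v)\<^sup>2 \<partial>lborel)"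
  proof (rule integral_dominated_convergence[where w="\<lambda>x. indicator (cball 0 R) x *\<^sub>R B\<^sup>2"])
    show "integrable lborel (\<lambda>x::'a. indicator (cball 0 R) x *\<^sub>R B\<^sup>2)"
      by (intro borel_integrable_compact) auto
    show "AE x in lborel. (\<lambda>n. (s n x)\<^sup>2) \<longlonglongrightarrow> (frechet_derivative \<phi> (at x) v)\<^sup>2"
      using s(2) by (intro AE_I2 tendsto_power)
    show "AE x in lborel. norm ((s n x)\<^sup>2) \<le> indicator (cball 0 R) x *\<^sub>R B\<^sup>2" for n
    proof (rule AE_I2)
      fix x
      have "(s n x)\<^sup>2 \<le> (indicator (cball 0 R) x *\<^sub>R B)\<^sup>2"
        using power_mono[OF s(1)[of n x] abs_ge_zero, of 2] by simp
      then show "norm ((s n x)\<^sup>2) \<le> indicator (cball 0 R) x *\<^sub>R B\<^sup>2"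
        by (cases "x \<in> cball 0 R") auto
    qed
  qed (auto simp: s_def)
  then show ?thesis by (rule LIMSEQ_le_const) (use step in blast)
qed

text \<open>
  Compare the extension by zero \<open>V\<close> with test functions \<open>\<phi> n\<close>, for which the previous lemma applies
  with gradients bounded in \<open>L2\<close>; the differences \<open>V - \<phi> n\<close>, at \<open>x\<close> and at \<open>v + x\<close>, disappear in the
  limit. The factor \<open>3\<close> comes from splitting the square of a sum of three terms.
\<close>
lemma translation_estimate:
  fixes u :: "'a::euclidean_space \<Rightarrow> real"
  assumes \<Omega>: "open \<Omega>" "bounded \<Omega>" and u: "u \<in> H1_0 \<Omega>"
    and V: "\<And>x. x \<in> \<Omega> \<Longrightarrow> V x = u x" "\<And>x. x \<notin> \<Omega> \<Longrightarrow> V x = 0" "V \<in> borel_measurable borel"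
  obtains C where "C \<ge> 0" "\<And>v. (\<integral>x. (V (v + x) - V x)\<^sup>2 \<partial>lborel) \<le> C * (norm v)\<^sup>2"
    "integrable lborel (\<lambda>x. (V x)\<^sup>2)"
proof -
  have ms: "\<Omega> \<in> sets lebesgue" using \<Omega> by (simp add: lmeasurable_open)
  note [measurable] = V(3)
  have "u \<in> H1 \<Omega>" using u by (simp add: H1_0_def)
  note uL = H1_grad[OF \<Omega> this]
  obtain \<phi> where \<phi>: "\<And>n::nat. \<phi> n \<in> test_functions \<Omega>"
    and l: "(\<lambda>n. L2_norm \<Omega> (\<lambda>x. \<phi> n x - u x)) \<longlonglongrightarrow> 0" "(\<lambda>n. L2_norm \<Omega> (\<lambda>x. cgrad (\<phi> n) x - grad \<Omega> u x)) \<longlonglongrightarrow> 0"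
    using H1_0_imp_test_limit[OF \<Omega> u] unfolding test_limit_def by blast
  note L = test_function_L2[OF \<Omega> \<phi>]
  have \<phi>C: "\<phi> n \<in> C1_compact \<Omega>" for n using \<phi> test_functions_subset_C1_compact by blast
  have \<phi>0: "\<phi> n x = 0" "cgrad (\<phi> n) x = 0" if "x \<notin> \<Omega>" for n x using C1_compact_zero[OF \<phi>C that] by auto
  have C1: "C_k (Suc 0) (\<phi> n)" and K: "compact (closure {x. \<phi> n x \<noteq> 0})" for n
    using \<phi>C[of n] by (auto simp: C1_compact_def)
  have c\<phi>: "continuous_on UNIV (\<phi> n)" for n using C1 by (rule C_k_imp_continuous)
  have [measurable]: "\<phi> n \<in> borel_measurable borel" for n by (rule borel_measurable_continuous_onI[OF c\<phi>])
  have [measurable]: "cgrad (\<phi> n) \<in> borel_measurable borel" for n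
    by (rule borel_measurable_continuous_onI[OF C_k_cgrad_continuous[OF C1]])
  have diff: "\<phi> n differentiable at x" for n x using C1[of n] by simp
  have transfer: "integrable lborel h" "(\<integral>x. h x \<partial>lborel) = (L2_norm \<Omega> w)\<^sup>2"
    if w: "w \<in> L2_space \<Omega>" and h: "\<And>x. x \<in> \<Omega> \<Longrightarrow> h x = (norm (w x))\<^sup>2" "\<And>x. x \<notin> \<Omega> \<Longrightarrow> h x = 0"
      and hm: "h \<in> borel_measurable borel" for h :: "'a \<Rightarrow> real" and w :: "'a \<Rightarrow> 'b::euclidean_space"
  proof -
    have "integrable (lebesgue_on \<Omega>) h"
      using L2_spaceD(2)[OF w] by (rule Bochner_Integration.integrable_cong[THEN iffD1, rotated 2]) (auto simp: h)
    then show "integrable lborel h" by (subst (asm) integrable_lebesgue_on_iff_lborel[OF ms hm h(2)])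
    have "(\<integral>x. h x \<partial>lborel) = (\<integral>x. h x \<partial>lebesgue_on \<Omega>)"
      by (rule integral_lebesgue_on_eq_lborel[OF ms hm h(2), symmetric])
    also have "\<dots> = (\<integral>x. (norm (w x))\<^sup>2 \<partial>lebesgue_on \<Omega>)"
      by (rule Bochner_Integration.integral_cong) (auto simp: h)
    finally show "(\<integral>x. h x \<partial>lborel) = (L2_norm \<Omega> w)\<^sup>2" by (simp add: L2_norm_def)
  qed
  have V2: "integrable lborel (\<lambda>x. (V x)\<^sup>2)"
    by (rule transfer(1)[OF uL(1)]) (auto simp: V)
  have \<phi>2: "integrable lborel (\<lambda>x. (\<phi> n x)\<^sup>2)" for n
    by (rule transfer(1)[OF L(1)[of n]]) (auto simp: \<phi>0)
  have e2: "integrable lborel (\<lambda>x. (V x - \<phi> n x)\<^sup>2)"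
    "(\<integral>x. (V x - \<phi> n x)\<^sup>2 \<partial>lborel) = (L2_norm \<Omega> (\<lambda>x. \<phi> n x - u x))\<^sup>2" for n
    by (rule transfer[OF L2_diff[OF L(1)[of n] uL(1)]]; auto simp: V \<phi>0 power2_commute)+
  obtain C0 where C0: "C0 > 0" "\<And>n. norm (L2_norm \<Omega> (cgrad (\<phi> n))) \<le> C0"
    using convergent_imp_Bseq[OF convergentI[OF L2_norm_tendsto[OF L(2) uL(2) l(2)]]] by (auto simp: Bseq_def)
  have est\<phi>: "(\<integral>x. (\<phi> n (v + x) - \<phi> n x)\<^sup>2 \<partial>lborel) \<le> C0\<^sup>2 * (norm v)\<^sup>2" for n v
  proof -
    have g2: "integrable lborel (\<lambda>x. (norm (cgrad (\<phi> n) x))\<^sup>2)"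
      "(\<integral>x. (norm (cgrad (\<phi> n) x))\<^sup>2 \<partial>lborel) = (L2_norm \<Omega> (cgrad (\<phi> n)))\<^sup>2"
      by (rule transfer[OF L(2)[of n]]; auto simp: \<phi>0)+
    have "(\<integral>x. (\<phi> n (v + x) - \<phi> n x)\<^sup>2 \<partial>lborel) \<le> (\<integral>x. (frechet_derivative (\<phi> n) (at x) v)\<^sup>2 \<partial>lborel)"
      by (rule translation_estimate_C1[OF C1 K])
    also have "\<dots> \<le> (\<integral>x. (norm v)\<^sup>2 * (norm (cgrad (\<phi> n) x))\<^sup>2 \<partial>lborel)"
    proof (rule integral_mono')
      show "integrable lborel (\<lambda>x. (norm v)\<^sup>2 * (norm (cgrad (\<phi> n) x))\<^sup>2)" using g2(1) by simp
      fix x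
      have "\<bar>cgrad (\<phi> n) x \<bullet> v\<bar> \<le> norm (cgrad (\<phi> n) x) * norm v" by (rule Cauchy_Schwarz_ineq2)
      then have "\<bar>cgrad (\<phi> n) x \<bullet> v\<bar>\<^sup>2 \<le> (norm (cgrad (\<phi> n) x) * norm v)\<^sup>2" by (rule power_mono) simp
      then show "(frechet_derivative (\<phi> n) (at x) v)\<^sup>2 \<le> (norm v)\<^sup>2 * (norm (cgrad (\<phi> n) x))\<^sup>2"
        by (simp add: cgrad_inner[OF diff] power_mult_distrib mult.commute)
    qed simp
    also have "\<dots> = (norm v)\<^sup>2 * (L2_norm \<Omega> (cgrad (\<phi> n)))\<^sup>2" by (simp add: g2(2))
    also have "\<dots> \<le> (norm v)\<^sup>2 * C0\<^sup>2" using C0(2)[of n] by (intro mult_left_mono power_mono) auto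
    finally show ?thesis by (simp add: mult.commute)
  qed
  have est: "(\<integral>x. (V (v + x) - V x)\<^sup>2 \<partial>lborel) \<le> (3 * C0\<^sup>2) * (norm v)\<^sup>2" for v
  proof (rule LIMSEQ_le_const)
    let ?a = "\<lambda>n. (L2_norm \<Omega> (\<lambda>x. \<phi> n x - u x))\<^sup>2"
    have "(\<lambda>n. 3 * (2 * ?a n + C0\<^sup>2 * (norm v)\<^sup>2)) \<longlonglongrightarrow> 3 * (2 * 0\<^sup>2 + C0\<^sup>2 * (norm v)\<^sup>2)"
      by (intro tendsto_intros l(1))
    then show "(\<lambda>n. 3 * (2 * ?a n + C0\<^sup>2 * (norm v)\<^sup>2)) \<longlonglongrightarrow> (3 * C0\<^sup>2) * (norm v)\<^sup>2" by (simp add: mult.assoc)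
    have "(\<integral>x. (V (v + x) - V x)\<^sup>2 \<partial>lborel) \<le> 3 * (2 * ?a n + C0\<^sup>2 * (norm v)\<^sup>2)" for n
    proof -
      let ?e = "\<lambda>x. (V x - \<phi> n x)\<^sup>2" and ?d = "\<lambda>x. (\<phi> n (v + x) - \<phi> n x)\<^sup>2"
      have "\<phi> n \<in> borel_measurable borel" by measurable
      from integrable_square_difference[OF this \<phi>2, of v 0] have id: "integrable lborel ?d" by simp
      have ie: "integrable lborel ?e" "integrable lborel (\<lambda>x. ?e (v + x))"
        using e2(1) lborel_integrable_translate[OF e2(1)] by auto
      have "(\<integral>x. (V (v + x) - V x)\<^sup>2 \<partial>lborel) \<le> (\<integral>x. 3 * (?e (v + x) + ?d x + ?e x) \<partial>lborel)"
      proof (rule integral_mono')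
        show "integrable lborel (\<lambda>x. 3 * (?e (v + x) + ?d x + ?e x))"
          by (intro integrable_mult_right Bochner_Integration.integrable_add ie id)
        fix x
        have sq3: "(a + b + c)\<^sup>2 \<le> 3 * (a\<^sup>2 + b\<^sup>2 + c\<^sup>2)" for a b c :: real
          using sum_squares_bound[of a b] sum_squares_bound[of b c] sum_squares_bound[of a c]
          by (simp add: power2_eq_square algebra_simps)
        show "(V (v + x) - V x)\<^sup>2 \<le> 3 * (?e (v + x) + ?d x + ?e x)"
          using sq3[of "V (v + x) - \<phi> n (v + x)" "\<phi> n (v + x) - \<phi> n x" "\<phi> n x - V x"]
          by (simp add: power2_commute)
      qed simp
      also have "\<dots> = 3 * ((\<integral>x. ?e (v + x) \<partial>lborel) + (\<integral>x. ?d x \<partial>lborel) + (\<integral>x. ?e x \<partial>lborel))"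
        using ie id by simp
      also have "(\<integral>x. ?e (v + x) \<partial>lborel) = (\<integral>x. ?e x \<partial>lborel)"
        by (rule lborel_integral_translate) measurable
      finally show ?thesis using est\<phi>[of n v] by (simp add: e2(2))
    qed
    then show "\<exists>N. \<forall>n\<ge>N. (\<integral>x. (V (v + x) - V x)\<^sup>2 \<partial>lborel) \<le> 3 * (2 * ?a n + C0\<^sup>2 * (norm v)\<^sup>2)" by blast
  qed
  show ?thesis by (rule that[OF _ est V2]) simp
qed

text \<open>
  Move from \<open>p\<close> against the vertical direction: the graph function does not see the vertical
  coordinate, so one gets strictly below the graph, and by continuity so do all nearby points.
\<close>
lemma lipschitz_boundary_exterior_point:
  fixes \<Omega> :: "'a::euclidean_space set"
  assumes \<Omega>: "open \<Omega>" "lipschitz_boundary \<Omega>" and p: "p \<in> frontier \<Omega>" and "r > 0"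
  obtains q where "q \<in> ball p r" "q \<notin> closure \<Omega>"
proof -
  obtain r0 e L \<gamma> where r0: "r0 > 0" and e: "norm e = 1" and lip: "lipschitz_on L {z. z \<bullet> e = 0} \<gamma>"
    and epi: "\<Omega> \<inter> ball p r0 = {y \<in> ball p r0. y \<bullet> e > \<gamma> (y - (y \<bullet> e) *\<^sub>R e)}"
    using \<Omega>(2) p unfolding lipschitz_boundary_def by blast
  have ee: "e \<bullet> e = 1" using e by (simp add: power2_norm_eq_inner[symmetric])
  define F where "F = (\<lambda>y. \<gamma> (y - (y \<bullet> e) *\<^sub>R e) - y \<bullet> e)"
  have "continuous_on {z. z \<bullet> e = 0} \<gamma>" using lip by (rule lipschitz_on_continuous_on)
  moreover have "continuous_on UNIV (\<lambda>y. y - (y \<bullet> e) *\<^sub>R e)" by (intro continuous_intros)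
  ultimately have "continuous_on UNIV (\<lambda>y. \<gamma> (y - (y \<bullet> e) *\<^sub>R e))"
    by (rule continuous_on_compose2) (auto simp: inner_diff_left ee)
  then have cF: "continuous_on UNIV F" unfolding F_def by (intro continuous_intros)
  define s where "s = min r r0 / 2"
  have s: "s > 0" "s < r" "s < r0" using \<open>r > 0\<close> r0 by (auto simp: s_def)
  define q where "q = p - s *\<^sub>R e"
  have dq: "dist p q = s" using s e by (simp add: q_def dist_norm)
  have "p \<notin> \<Omega>" using p \<Omega>(1) by (simp add: frontier_def interior_open)
  then have "p \<bullet> e \<le> \<gamma> (p - (p \<bullet> e) *\<^sub>R e)" using epi r0 by (metis (no_types, lifting) IntD1 centre_in_ball linorder_not_le mem_Collect_eq)
  moreover have "q - (q \<bullet> e) *\<^sub>R e = p - (p \<bullet> e) *\<^sub>R e" "q \<bullet> e = p \<bullet> e - s"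
    by (simp_all add: q_def inner_diff_left ee algebra_simps)
  ultimately have Fq: "F q > 0" using s(1) by (simp add: F_def)
  let ?O = "{y. F y > 0} \<inter> ball p r0"
  have "open ?O" by (intro open_Int open_ball open_Collect_less continuous_on_const cF)
  moreover have "q \<in> ?O" using Fq dq s by simp
  moreover have "x \<notin> \<Omega>" if x: "x \<in> ?O" for x
  proof
    assume "x \<in> \<Omega>"
    then have "x \<in> {y \<in> ball p r0. y \<bullet> e > \<gamma> (y - (y \<bullet> e) *\<^sub>R e)}" using x epi by blast
    then show False using x by (simp add: F_def)
  qed
  then have "?O \<inter> \<Omega> = {}" by blast
  ultimately have "q \<notin> closure \<Omega>" by (metis IntI empty_iff open_Int_closure_eq_empty)
  moreover have "q \<in> ball p r" using dq s by simp
  ultimately show ?thesis using that by blast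
qed

text \<open>
  If \<open>u\<close> did not vanish at a boundary point, its extension by zero would jump along every segment from
  a small ball outside the domain to one inside. Cutting such segments into \<open>m\<close> steps, one step makes
  an increment of at least \<open>c\<close>, whereas the integrals of the \<open>m\<close> squared increments sum to \<open>O(1/m)\<close>.
\<close>
lemma continuous_H1_0_zero_on_frontier:
  fixes u :: "'a::euclidean_space \<Rightarrow> real"
  assumes \<Omega>: "open \<Omega>" "bounded \<Omega>" "lipschitz_boundary \<Omega>" and u: "u \<in> H1_0 \<Omega>"
    and cu: "continuous_on (closure \<Omega>) u" and p: "p \<in> frontier \<Omega>"
  shows "u p = 0"
proof (rule ccontr)
  assume "u p \<noteq> 0"
  define c where "c = \<bar>u p\<bar> / 2"
  have c: "c > 0" using \<open>u p \<noteq> 0\<close> by (simp add: c_def)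
  have pc: "p \<in> closure \<Omega>" using p by (simp add: frontier_def)
  then obtain r where r: "r > 0" "\<And>x. x \<in> closure \<Omega> \<Longrightarrow> dist x p < r \<Longrightarrow> dist (u x) (u p) < c"
    using cu c unfolding continuous_on_iff by metis
  have large: "\<bar>u x\<bar> \<ge> c" if "x \<in> \<Omega>" "x \<in> ball p r" for x
  proof -
    have "dist (u x) (u p) < c" using r(2)[of x] that closure_subset[of \<Omega>] by (auto simp: dist_commute)
    then show ?thesis unfolding c_def dist_real_def by linarith
  qed
  define V where "V = (\<lambda>x. indicator \<Omega> x *\<^sub>R u x)"
  have V: "\<And>x. x \<in> \<Omega> \<Longrightarrow> V x = u x" "\<And>x. x \<notin> \<Omega> \<Longrightarrow> V x = 0" by (auto simp: V_def)
  have Vm[measurable]: "V \<in> borel_measurable borel"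
    unfolding V_def using continuous_on_subset[OF cu closure_subset] \<Omega>(1)
    by (intro borel_measurable_continuous_on_indicator) auto
  obtain C where C: "C \<ge> 0" "\<And>v. (\<integral>x. (V (v + x) - V x)\<^sup>2 \<partial>lborel) \<le> C * (norm v)\<^sup>2"
    and V2: "integrable lborel (\<lambda>x. (V x)\<^sup>2)"
    using translation_estimate[OF \<Omega>(1,2) u V Vm] by blast
  obtain q0 where q0: "q0 \<in> ball p r" "q0 \<notin> closure \<Omega>"
    using lipschitz_boundary_exterior_point[OF \<Omega>(1,3) p r(1)] by blast
  obtain q1 where q1: "q1 \<in> ball p r" "q1 \<in> \<Omega>"
    using pc r(1) by (metis closure_approachable dist_commute mem_ball)
  have "open (ball p r - closure \<Omega>)" "open (ball p r \<inter> \<Omega>)" using \<Omega>(1) by auto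
  then obtain s0 s1 where s01: "s0 > 0" "ball q0 s0 \<subseteq> ball p r - closure \<Omega>" "s1 > 0" "ball q1 s1 \<subseteq> ball p r \<inter> \<Omega>"
    using q0 q1 unfolding open_contains_ball by (metis DiffI IntI)
  define s where "s = min s0 s1"
  have s: "s > 0" "ball q0 s \<subseteq> ball p r - closure \<Omega>" "ball q1 s \<subseteq> ball p r \<inter> \<Omega>"
    using s01 by (auto simp: s_def)
  define e where "e = q1 - q0"
  define \<beta> where "\<beta> = measure lborel (ball q0 s)"
  have \<beta>: "\<beta> > 0" unfolding \<beta>_def using content_ball_pos[OF s(1)] by simp
  have key: "c\<^sup>2 * \<beta> \<le> C * (norm e)\<^sup>2 * (1 / real (Suc n))" for n
  proof -
    define m where "m = real (Suc n)"
    have m: "m > 0" by (simp add: m_def)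
    define P where "P = (\<lambda>j::nat. (real j / m) *\<^sub>R e)"
    define w where "w = (1 / m) *\<^sub>R e"
    have PS: "P (Suc j) + y = w + (P j + y)" for j y
      by (simp add: P_def w_def add_divide_distrib scaleR_left_distrib)
    let ?d = "\<lambda>j y. (V (P (Suc j) + y) - V (P j + y))\<^sup>2"
    have int: "integrable lborel (?d j)" for j by (rule integrable_square_difference[OF Vm V2])
    have bound: "(\<integral>y. ?d j y \<partial>lborel) \<le> C * (norm w)\<^sup>2" for j
    proof -
      have "(\<lambda>x. (V (w + x) - V x)\<^sup>2) \<in> borel_measurable borel" by measurable
      from lborel_integral_translate[OF this, of "P j"]
      have "(\<integral>y. ?d j y \<partial>lborel) = (\<integral>x. (V (w + x) - V x)\<^sup>2 \<partial>lborel)" unfolding PS .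
      then show ?thesis using C(2) by simp
    qed
    have jump: "c\<^sup>2 \<le> (\<Sum>j<Suc n. ?d j y)" if y: "y \<in> ball q0 s" for y
    proof -
      have y0: "P 0 + y \<notin> \<Omega>" using s(2) y closure_subset[of \<Omega>] by (auto simp: P_def)
      have "dist q1 (y + e) = dist q0 y" by (simp add: e_def dist_norm)
      then have "y + e \<in> ball q1 s" using y by simp
      then have ye: "y + e \<in> ball p r" "y + e \<in> \<Omega>" using s(3) by blast+
      have y1: "P (Suc n) + y \<in> \<Omega>" using ye m by (simp add: P_def m_def add.commute del: of_nat_Suc)
      \<comment> \<open>the first of the points \<open>P j + y\<close> inside \<open>\<Omega>\<close>; its predecessor is outside\<close>
      define k where "k = (LEAST j. P j + y \<in> \<Omega>)"
      have k: "P k + y \<in> \<Omega>" unfolding k_def using y1 by (rule LeastI)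
      have kn: "k \<le> Suc n" unfolding k_def using y1 by (rule Least_le)
      obtain j where j: "k = Suc j" using k y0 by (cases k) auto
      have nj: "P j + y \<notin> \<Omega>" using not_less_Least[of j "\<lambda>j. P j + y \<in> \<Omega>"] j by (simp add: k_def)
      have "P k + y \<in> ball p r"
      proof -
        have t: "0 \<le> real k / m" "real k / m \<le> 1" using kn m by (auto simp: m_def)
        \<comment> \<open>the step where the segment enters \<open>\<Omega>\<close> happens near \<open>p\<close>, where \<open>u\<close> is at least \<open>c\<close> in modulus\<close>
        have "(1 - real k / m) *\<^sub>R y + (real k / m) *\<^sub>R (y + e) \<in> ball p r"
          using t ye(1) s(2) y by (intro convexD[OF convex_ball]) auto
        then show ?thesis by (simp add: P_def algebra_simps)
      qed
      then have "\<bar>V (P (Suc j) + y)\<bar> \<ge> c" using large[OF k] V(1)[OF k] j by simp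
      then have "c\<^sup>2 \<le> ?d j y" using c power_mono[of c "\<bar>V (P (Suc j) + y)\<bar>" 2] by (simp add: V(2)[OF nj])
      also have "\<dots> \<le> (\<Sum>j<Suc n. ?d j y)" using kn j by (intro member_le_sum) auto
      finally show ?thesis .
    qed
    have "c\<^sup>2 * \<beta> = (\<integral>y. indicator (ball q0 s) y *\<^sub>R c\<^sup>2 \<partial>lborel)"
      by (simp add: \<beta>_def mult.commute)
    also have "\<dots> \<le> (\<integral>y. (\<Sum>j<Suc n. ?d j y) \<partial>lborel)"
    proof (rule integral_mono')
      show "integrable lborel (\<lambda>y. \<Sum>j<Suc n. ?d j y)" by (intro Bochner_Integration.integrable_sum int)
      fix y
      show nn: "0 \<le> (\<Sum>j<Suc n. ?d j y)" by (intro sum_nonneg) simp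
      show "indicator (ball q0 s) y *\<^sub>R c\<^sup>2 \<le> (\<Sum>j<Suc n. ?d j y)"
        using jump[of y] nn by (cases "y \<in> ball q0 s") (simp_all del: sum.lessThan_Suc)
    qed
    also have "\<dots> = (\<Sum>j<Suc n. \<integral>y. ?d j y \<partial>lborel)" by (rule Bochner_Integration.integral_sum[OF int])
    also have "\<dots> \<le> (\<Sum>j<Suc n. C * (norm w)\<^sup>2)" by (intro sum_mono bound)
    also have "\<dots> = m * (C * (norm w)\<^sup>2)" by (simp add: m_def)
    also have "\<dots> = C * (norm e)\<^sup>2 * (1 / m)"
      using m by (simp add: w_def power_divide power2_eq_square)
    finally show ?thesis by (simp only: m_def)
  qed
  have "(\<lambda>n. C * (norm e)\<^sup>2 * (1 / real (Suc n))) \<longlonglongrightarrow> C * (norm e)\<^sup>2 * 0"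
    by (intro tendsto_intros lim_1_over_n[THEN LIMSEQ_Suc])
  then have "c\<^sup>2 * \<beta> \<le> C * (norm e)\<^sup>2 * 0" by (rule LIMSEQ_le_const) (use key in blast)
  then show False using c \<beta> by (simp add: mult_le_0_iff)
qed

section \<open>Energy estimate and convergence\<close>

text \<open>
  On each triangle a bound at the vertices is a bound everywhere. Vertices in \<open>\<Omega>\<close> are internal nodes; the
  others lie on the frontier, where the function vanishes.
\<close>
lemma P1_box_bounds:
  assumes \<Omega>: "open \<Omega>" "bounded \<Omega>" "lipschitz_boundary \<Omega>" and \<epsilon>k: "0 < \<epsilon>" "0 < k"
    and T: "triangulation_of \<Omega> T" and w: "w \<in> P1_box \<Omega> T \<epsilon> k"
  shows "\<And>x. x \<in> \<Omega> \<Longrightarrow> - \<epsilon> \<le> w x \<and> w x \<le> k" "w \<in> H1_0_box \<Omega> \<epsilon> k"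
proof -
  have w': "continuous_on (closure \<Omega>) w" "w \<in> H1_0 \<Omega>"
    "\<And>K. K \<in> T \<Longrightarrow> \<exists>a b. \<forall>x\<in>K. w x = a \<bullet> x + b"
    "\<And>x. x \<in> internal_nodes \<Omega> T \<Longrightarrow> - \<epsilon> \<le> w x \<and> w x \<le> k"
    using w by (auto simp: P1_box_def P1_space_def)
  have simplex: "\<And>K. K \<in> T \<Longrightarrow> 2 simplex K" and cover: "\<Union>T = closure \<Omega>"
    using T by (auto simp: triangulation_of_def)
  show b: "- \<epsilon> \<le> w x \<and> w x \<le> k" if x: "x \<in> \<Omega>" for x
  proof -
    obtain K where K: "K \<in> T" "x \<in> K" using cover x closure_subset[of \<Omega>] by blast
    obtain a b where ab: "\<And>x. x \<in> K \<Longrightarrow> w x = a \<bullet> x + b" using w'(3)[OF K(1)] by blast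
    have "- \<epsilon> \<le> a \<bullet> x + b \<and> a \<bullet> x + b \<le> k"
    proof (rule affine_bounds_from_extreme_points[OF simplex_compact_convex(1,2)[OF simplex[OF K(1)]] _ K(2)])
      fix p assume p: "p extreme_point_of K"
      then have pK: "p \<in> K" unfolding extreme_point_of_def by blast
      have "- \<epsilon> \<le> w p \<and> w p \<le> k"
      proof (cases "p \<in> \<Omega>")
        case True
        then have "p \<in> internal_nodes \<Omega> T" using p K(1) by (auto simp: internal_nodes_def)
        then show ?thesis by (rule w'(4))
      next
        case False
        have "p \<in> closure \<Omega>" using cover K(1) pK by blast
        then have "p \<in> frontier \<Omega>" using False \<Omega>(1) by (simp add: frontier_def interior_open)
        then have "w p = 0" by (rule continuous_H1_0_zero_on_frontier[OF \<Omega> w'(2,1)])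
        then show ?thesis using \<epsilon>k by simp
      qed
      then show "- \<epsilon> \<le> a \<bullet> p + b \<and> a \<bullet> p + b \<le> k" by (simp add: ab[OF pK])
    qed
    then show ?thesis by (simp add: ab[OF K(2)])
  qed
  show "w \<in> H1_0_box \<Omega> \<epsilon> k"
    unfolding H1_0_box_def using w'(2) b by (auto intro!: AE_I2)
qed

lemma pairing_grad_diff:
  assumes \<Omega>: "open \<Omega>" "bounded \<Omega>" and u: "u \<in> H1 \<Omega>" and v: "v \<in> H1 \<Omega>" and g: "g \<in> L2_space \<Omega>"
  shows "pairing \<Omega> g (grad \<Omega> (\<lambda>x. u x - v x)) = pairing \<Omega> g (grad \<Omega> u) - pairing \<Omega> g (grad \<Omega> v)"
proof -
  note D = grad_diff_AE[OF \<Omega> u v]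
  note uL = H1_grad(2)[OF \<Omega> u] and vL = H1_grad(2)[OF \<Omega> v]
  have "pairing \<Omega> g (grad \<Omega> (\<lambda>x. u x - v x)) = pairing \<Omega> g (\<lambda>x. grad \<Omega> u x - grad \<Omega> v x)"
    by (rule pairing_cong_AE[OF g H1_grad(2)[OF \<Omega> D(1)] g L2_diff[OF uL vL] _ D(2)]) simp
  also have "\<dots> = pairing \<Omega> g (grad \<Omega> u) - pairing \<Omega> g (grad \<Omega> v)" by (rule pairing_diff_right[OF g uL vL])
  finally show ?thesis .
qed

lemma H1_seminorm_diff:
  assumes \<Omega>: "open \<Omega>" "bounded \<Omega>" and u: "u \<in> H1 \<Omega>" and v: "v \<in> H1 \<Omega>"
  shows "H1_seminorm \<Omega> (\<lambda>x. u x - v x) = L2_norm \<Omega> (\<lambda>x. grad \<Omega> u x - grad \<Omega> v x)"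
proof -
  note D = grad_diff_AE[OF \<Omega> u v]
  show ?thesis unfolding H1_seminorm_def
    by (rule L2_norm_cong_AE[OF L2_spaceD(1)[OF H1_grad(2)[OF \<Omega> D(1)]] _ D(2)])
       (rule L2_spaceD(1)[OF L2_diff[OF H1_grad(2)[OF \<Omega> u] H1_grad(2)[OF \<Omega> v]]])
qed

text \<open>
  Here \<open>y\<close> plays the role of the discrete solution with data \<open>g\<close>, and \<open>w\<close> is the competitor. In
  \<open>D\<^sup>2 = a(y,y) - 2 a(y,z) + a(z,z)\<close> insert and subtract \<open>a(y,w)\<close>: two of the resulting differences are
  bounded by the variational inequalities, and the third is \<open>a(y, w - z)\<close>.
\<close>
lemma energy_estimate:
  assumes \<Omega>: "open \<Omega>" "bounded \<Omega>" and zH: "z \<in> H1 \<Omega>" and yH: "y \<in> H1 \<Omega>" and wH: "w \<in> H1 \<Omega>"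
    and f: "f \<in> L2_space \<Omega>" and g: "integrable (lebesgue_on \<Omega>) g"
    and M: "\<And>x. x \<in> \<Omega> \<Longrightarrow> \<bar>w x - y x\<bar> \<le> M"
    and vi_y: "pairing \<Omega> (grad \<Omega> y) (grad \<Omega> (\<lambda>x. w x - y x)) \<ge> pairing \<Omega> g (\<lambda>x. w x - y x)"
    and vi_z: "pairing \<Omega> (grad \<Omega> z) (grad \<Omega> (\<lambda>x. y x - z x)) \<ge> pairing \<Omega> f (\<lambda>x. y x - z x)"
  shows "(H1_seminorm \<Omega> (\<lambda>x. y x - z x))\<^sup>2 \<le> 2 * M * L1_norm \<Omega> (\<lambda>x. g x - f x)
    + 2 * L2_norm \<Omega> f * L2_norm \<Omega> (\<lambda>x. w x - z x)
    + 2 * L2_norm \<Omega> (grad \<Omega> z) * H1_seminorm \<Omega> (\<lambda>x. w x - z x)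
    + (H1_seminorm \<Omega> (\<lambda>x. w x - z x))\<^sup>2"
proof -
  have m: "\<Omega> \<in> lmeasurable" using \<Omega> by (simp add: lmeasurable_open)
  note zL = H1_grad[OF \<Omega> zH] and yL = H1_grad[OF \<Omega> yH] and wL = H1_grad[OF \<Omega> wH]
  let ?a = "\<lambda>u v. pairing \<Omega> (grad \<Omega> u) (grad \<Omega> v)"
  define D where "D = L2_norm \<Omega> (\<lambda>x. grad \<Omega> y x - grad \<Omega> z x)"
  define A where "A = L2_norm \<Omega> (\<lambda>x. grad \<Omega> w x - grad \<Omega> z x)"
  have DA: "H1_seminorm \<Omega> (\<lambda>x. y x - z x) = D" "H1_seminorm \<Omega> (\<lambda>x. w x - z x) = A"
    unfolding D_def A_def by (rule H1_seminorm_diff[OF \<Omega>]; fact)+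
  have D2: "D\<^sup>2 = ?a y y - 2 * ?a y z + ?a z z"
    unfolding D_def L2_norm_square
    using yL(2) zL(2) L2_diff[OF yL(2) zL(2)]
    by (simp add: pairing_diff_right pairing_diff_left pairing_commute[of \<Omega> "grad \<Omega> z" "grad \<Omega> y"])
  have 1: "?a y w - ?a y y \<ge> pairing \<Omega> g (\<lambda>x. w x - y x)"
    using vi_y by (simp add: pairing_grad_diff[OF \<Omega> wH yH yL(2)])
  have 2: "?a y z - ?a z z \<ge> pairing \<Omega> f (\<lambda>x. y x - z x)"
    using vi_z by (simp add: pairing_grad_diff[OF \<Omega> yH zH zL(2)] pairing_commute[of \<Omega> "grad \<Omega> z" "grad \<Omega> y"])
  have fi: "integrable (lebesgue_on \<Omega>) f" by (rule L2_imp_integrable[OF m f])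
  have wy: "(\<lambda>x. w x - y x) \<in> L2_space \<Omega>" by (rule L2_diff[OF wL(1) yL(1)])
  have gfi: "integrable (lebesgue_on \<Omega>) (\<lambda>x. g x - f x)" using g fi by (rule Bochner_Integration.integrable_diff)
  have bound: "\<bar>(g x - f x) * (w x - y x)\<bar> \<le> M * \<bar>g x - f x\<bar>" if "x \<in> \<Omega>" for x
    using mult_left_mono[OF M[OF that] abs_ge_zero[of "g x - f x"]] by (simp add: abs_mult mult.commute)
  have gfw: "integrable (lebesgue_on \<Omega>) (\<lambda>x. (g x - f x) * (w x - y x))"
  proof (rule Bochner_Integration.integrable_bound)
    show "integrable (lebesgue_on \<Omega>) (\<lambda>x. M * \<bar>g x - f x\<bar>)" using gfi by simp
    show "(\<lambda>x. (g x - f x) * (w x - y x)) \<in> borel_measurable (lebesgue_on \<Omega>)"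
      using borel_measurable_integrable[OF gfi] L2_spaceD(1)[OF wy] by (rule borel_measurable_times)
    show "AE x in lebesgue_on \<Omega>. norm ((g x - f x) * (w x - y x)) \<le> norm (M * \<bar>g x - f x\<bar>)"
    proof (rule AE_I2)
      fix x assume "x \<in> space (lebesgue_on \<Omega>)"
      then have "x \<in> \<Omega>" by simp
      from order_trans[OF bound[OF this] abs_ge_self]
      show "norm ((g x - f x) * (w x - y x)) \<le> norm (M * \<bar>g x - f x\<bar>)" by simp
    qed
  qed
  have fwy: "integrable (lebesgue_on \<Omega>) (\<lambda>x. f x * (w x - y x))"
    using L2_inner_integrable[OF f wy] by simp
  have 3: "pairing \<Omega> g (\<lambda>x. w x - y x) = (\<integral>x. (g x - f x) * (w x - y x) \<partial>lebesgue_on \<Omega>) + pairing \<Omega> f (\<lambda>x. w x - y x)"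
  proof -
    have "pairing \<Omega> g (\<lambda>x. w x - y x) = (\<integral>x. (g x - f x) * (w x - y x) + f x * (w x - y x) \<partial>lebesgue_on \<Omega>)"
      by (simp add: pairing_def algebra_simps)
    also have "\<dots> = (\<integral>x. (g x - f x) * (w x - y x) \<partial>lebesgue_on \<Omega>) + (\<integral>x. f x * (w x - y x) \<partial>lebesgue_on \<Omega>)"
      using gfw fwy by (rule Bochner_Integration.integral_add)
    finally show ?thesis by (simp add: pairing_def)
  qed
  have 4: "\<bar>\<integral>x. (g x - f x) * (w x - y x) \<partial>lebesgue_on \<Omega>\<bar> \<le> M * L1_norm \<Omega> (\<lambda>x. g x - f x)"
  proof -
    have "\<bar>\<integral>x. (g x - f x) * (w x - y x) \<partial>lebesgue_on \<Omega>\<bar> \<le> (\<integral>x. \<bar>(g x - f x) * (w x - y x)\<bar> \<partial>lebesgue_on \<Omega>)"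
      by (rule integral_abs_bound)
    also have "\<dots> \<le> (\<integral>x. M * \<bar>g x - f x\<bar> \<partial>lebesgue_on \<Omega>)"
      using gfw gfi bound by (intro integral_mono) auto
    finally show ?thesis by (simp add: L1_norm_def)
  qed
  have 5: "pairing \<Omega> f (\<lambda>x. w x - y x) + pairing \<Omega> f (\<lambda>x. y x - z x) = pairing \<Omega> f (\<lambda>x. w x - z x)"
    by (simp add: pairing_diff_right[OF f] wL(1) yL(1) zL(1))
  have 6: "\<bar>pairing \<Omega> f (\<lambda>x. w x - z x)\<bar> \<le> L2_norm \<Omega> f * L2_norm \<Omega> (\<lambda>x. w x - z x)"
    by (rule L2_Cauchy_Schwarz[OF f L2_diff[OF wL(1) zL(1)]])
  have 7: "?a y w - ?a y z \<le> D * A + L2_norm \<Omega> (grad \<Omega> z) * A"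
  proof -
    let ?e = "\<lambda>x. grad \<Omega> w x - grad \<Omega> z x"
    have e: "?e \<in> L2_space \<Omega>" by (rule L2_diff[OF wL(2) zL(2)])
    have "\<bar>pairing \<Omega> (\<lambda>x. grad \<Omega> y x - grad \<Omega> z x) ?e\<bar> \<le> D * A"
      unfolding D_def A_def by (rule L2_Cauchy_Schwarz[OF L2_diff[OF yL(2) zL(2)] e])
    moreover have "\<bar>pairing \<Omega> (grad \<Omega> z) ?e\<bar> \<le> L2_norm \<Omega> (grad \<Omega> z) * A"
      unfolding A_def by (rule L2_Cauchy_Schwarz[OF zL(2) e])
    moreover have "?a y w - ?a y z = pairing \<Omega> (\<lambda>x. grad \<Omega> y x - grad \<Omega> z x) ?e + pairing \<Omega> (grad \<Omega> z) ?e"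
      by (simp add: pairing_diff_left[OF e yL(2) zL(2)] pairing_diff_right[OF yL(2) wL(2) zL(2)])
    ultimately show ?thesis by linarith
  qed
  have 8: "D * A \<le> D\<^sup>2 / 2 + A\<^sup>2 / 2" using sum_squares_bound[of D A] by simp
  have "D\<^sup>2 = - (?a y w - ?a y y) + (?a y w - ?a y z) - (?a y z - ?a z z)" using D2 by simp
  also have "\<dots> \<le> M * L1_norm \<Omega> (\<lambda>x. g x - f x) + L2_norm \<Omega> f * L2_norm \<Omega> (\<lambda>x. w x - z x)
      + (D\<^sup>2 / 2 + A\<^sup>2 / 2 + L2_norm \<Omega> (grad \<Omega> z) * A)"
    using 1 2 3 4 5 6 7 8 by linarith
  finally have "D\<^sup>2 \<le> 2 * (M * L1_norm \<Omega> (\<lambda>x. g x - f x)) + 2 * (L2_norm \<Omega> f * L2_norm \<Omega> (\<lambda>x. w x - z x))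
      + 2 * (L2_norm \<Omega> (grad \<Omega> z) * A) + A\<^sup>2" by linarith
  then show ?thesis unfolding DA by (simp only: mult.assoc)
qed

theorem lemma5p2:
  fixes \<Omega> :: "(real^2) set"
    and H :: "real set"
    and \<T> :: "real \<Rightarrow> (real^2) set set"
    and \<epsilon> k :: real
    and f z :: "real^2 \<Rightarrow> real"
    and f\<^sub>h z\<^sub>h :: "real \<Rightarrow> real^2 \<Rightarrow> real"
  assumes domain: "open \<Omega>" "connected \<Omega>" "\<Omega> \<noteq> {}" "bounded \<Omega>"
                  "polygonal \<Omega>" "lipschitz_boundary \<Omega>"
    and mesh_sizes: "H \<subseteq> {0<..}" "0 islimpt H"
    and meshes: "\<And>h. h \<in> H \<Longrightarrow> triangulation_of \<Omega> (\<T> h)"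
                "\<And>h. h \<in> H \<Longrightarrow> mesh_size (\<T> h) = h"
                "shape_regular (\<T> ` H)"
    and parameters: "0 < \<epsilon>" "0 < k" "\<epsilon> < k"
    and f: "f \<in> L2_space \<Omega>"
    and f\<^sub>h: "\<And>h. h \<in> H \<Longrightarrow> f\<^sub>h h \<in> L1_space \<Omega>"
    and f\<^sub>h_to_f: "((\<lambda>h. L1_norm \<Omega> (\<lambda>x. f\<^sub>h h x - f x)) \<longlongrightarrow> 0) (at 0 within H)"
    and z\<^sub>h: "\<And>h. h \<in> H \<Longrightarrow> z\<^sub>h h \<in> P1_box \<Omega> (\<T> h) \<epsilon> k"
    and z\<^sub>h_solves: "\<And>h v. h \<in> H \<Longrightarrow> v \<in> P1_box \<Omega> (\<T> h) \<epsilon> k \<Longrightarrow>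
           pairing \<Omega> (grad \<Omega> (z\<^sub>h h)) (grad \<Omega> (\<lambda>x. v x - z\<^sub>h h x))
             \<ge> pairing \<Omega> (f\<^sub>h h) (\<lambda>x. v x - z\<^sub>h h x)"
    and z: "z \<in> H1_0_box \<Omega> \<epsilon> k"
    and z_solves: "\<And>v. v \<in> H1_0_box \<Omega> \<epsilon> k \<Longrightarrow>
           pairing \<Omega> (grad \<Omega> z) (grad \<Omega> (\<lambda>x. v x - z x))
             \<ge> pairing \<Omega> f (\<lambda>x. v x - z x)"
  shows "((\<lambda>h. H1_seminorm \<Omega> (\<lambda>x. z\<^sub>h h x - z x)) \<longlongrightarrow> 0) (at 0 within H)"
proof -
  note \<Omega> = domain(1,4)
  have zH: "z \<in> H1 \<Omega>" using z by (simp add: H1_0_box_def H1_0_def)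
  note zL = H1_grad[OF \<Omega> zH]
  obtain \<sigma>0 where \<sigma>0: "\<And>h K. h \<in> H \<Longrightarrow> K \<in> \<T> h \<Longrightarrow> diameter K / inball_diameter K \<le> \<sigma>0"
    using meshes(3) unfolding shape_regular_def by blast
  \<comment> \<open>for an empty family of elements \<open>\<sigma>0\<close> could be negative\<close>
  define \<sigma> where "\<sigma> = max \<sigma>0 0"
  have \<sigma>: "\<sigma> \<ge> 0" "\<And>h K. h \<in> H \<Longrightarrow> K \<in> \<T> h \<Longrightarrow> diameter K / inball_diameter K \<le> \<sigma>"
    using \<sigma>0 by (auto simp: \<sigma>_def le_max_iff_disj)
  have diam: "diameter K \<le> h" if "h \<in> H" "K \<in> \<T> h" for h K
  proof -
    have "finite (\<T> h)" using meshes(1)[OF that(1)] by (simp add: triangulation_of_def triangulation_def)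
    then have "diameter K \<le> mesh_size (\<T> h)" unfolding mesh_size_def using that(2) by (intro Max_ge) auto
    then show ?thesis by (simp add: meshes(2)[OF that(1)])
  qed
  define c where "c = 4 * L2_norm \<Omega> f + 4 * L2_norm \<Omega> (grad \<Omega> z) + 4"
  have c: "c > 0" by (simp add: c_def add_nonneg_pos)
  have small: "\<forall>\<^sub>F h in at 0 within H. H1_seminorm \<Omega> (\<lambda>x. z\<^sub>h h x - z x) < \<eta>" if \<eta>: "\<eta> > 0" for \<eta>
  proof -
    \<comment> \<open>the competitor will be within \<open>2 \<delta>\<close> of \<open>z\<close>; as \<open>\<delta> \<le> 1\<close>, the terms it causes sum to at most \<open>c \<delta>\<close>\<close>
    define \<delta> where "\<delta> = min 1 (\<eta>\<^sup>2 / (2 * c))"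
    have \<delta>: "\<delta> > 0" "\<delta> \<le> 1" "c * \<delta> \<le> \<eta>\<^sup>2 / 2"
    proof -
      show "\<delta> > 0" "\<delta> \<le> 1" using \<eta> c by (auto simp: \<delta>_def)
      have "c * \<delta> \<le> c * (\<eta>\<^sup>2 / (2 * c))" using c by (intro mult_left_mono) (auto simp: \<delta>_def)
      then show "c * \<delta> \<le> \<eta>\<^sup>2 / 2" using c by simp
    qed
    obtain \<psi> where \<psi>: "\<psi> \<in> C1_compact \<Omega>" "\<And>x. - \<epsilon> \<le> \<psi> x \<and> \<psi> x \<le> k"
      "L2_norm \<Omega> (\<lambda>x. \<psi> x - z x) < \<delta>" "L2_norm \<Omega> (\<lambda>x. cgrad \<psi> x - grad \<Omega> z x) < \<delta>"
      using box_approximation[OF \<Omega> parameters(1,2) z \<delta>(1)] by blast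
    note \<psi>L = C1_compact_L2[OF \<Omega> \<psi>(1)]
    obtain h0 where h0: "h0 > 0" and ip: "\<And>T. \<lbrakk>triangulation_of \<Omega> T; \<And>K. K \<in> T \<Longrightarrow> diameter K < h0;
        \<And>K. K \<in> T \<Longrightarrow> diameter K / inball_diameter K \<le> \<sigma>\<rbrakk> \<Longrightarrow>
        \<exists>w\<in>P1_box \<Omega> T \<epsilon> k. L2_norm \<Omega> (\<lambda>x. w x - \<psi> x) \<le> \<delta> \<and>
          L2_norm \<Omega> (\<lambda>x. grad \<Omega> w x - cgrad \<psi> x) \<le> \<delta> \<and> (\<forall>x. - \<epsilon> \<le> w x \<and> w x \<le> k)"
      using interpolation[OF \<Omega> \<psi>(1) parameters(1,2) \<psi>(2) \<delta>(1) \<sigma>(1)] by blast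
    define M where "M = \<epsilon> + k"
    have M: "M > 0" using parameters by (simp add: M_def)
    have "\<forall>\<^sub>F h in at 0 within H. L1_norm \<Omega> (\<lambda>x. f\<^sub>h h x - f x) < \<eta>\<^sup>2 / (4 * M)"
      using f\<^sub>h_to_f by (rule order_tendstoD(2)) (use \<eta> M in simp)
    moreover have "\<forall>\<^sub>F h in at 0 within H. h < h0"
      using order_tendstoD(2)[OF tendsto_ident_at h0] by simp
    moreover have "\<forall>\<^sub>F h in at 0 within H. h \<in> H" by (simp add: eventually_at_filter)
    ultimately show ?thesis
    proof eventually_elim
      fix h assume E: "L1_norm \<Omega> (\<lambda>x. f\<^sub>h h x - f x) < \<eta>\<^sup>2 / (4 * M)" and "h < h0" and h: "h \<in> H"
      have "diameter K < h0" if "K \<in> \<T> h" for K using diam[OF h that] \<open>h < h0\<close> by linarith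
      then obtain w where w: "w \<in> P1_box \<Omega> (\<T> h) \<epsilon> k" "L2_norm \<Omega> (\<lambda>x. w x - \<psi> x) \<le> \<delta>"
        "L2_norm \<Omega> (\<lambda>x. grad \<Omega> w x - cgrad \<psi> x) \<le> \<delta>" "\<And>x. - \<epsilon> \<le> w x \<and> w x \<le> k"
        using ip[OF meshes(1)[OF h]] \<sigma>(2)[OF h] by blast
      have wH: "w \<in> H1 \<Omega>" using w(1) by (simp add: P1_box_def P1_space_def H1_0_def)
      have yH: "z\<^sub>h h \<in> H1 \<Omega>" using z\<^sub>h[OF h] by (simp add: P1_box_def P1_space_def H1_0_def)
      note wL = H1_grad[OF \<Omega> wH]
      note y = P1_box_bounds[OF \<Omega> domain(6) parameters(1,2) meshes(1)[OF h] z\<^sub>h[OF h]]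
      have wz: "L2_norm \<Omega> (\<lambda>x. w x - z x) \<le> 2 * \<delta>"
        using L2_norm_diff_triangle[OF wL(1) \<psi>L(1) zL(1)] w(2) \<psi>(3) by linarith
      have gwz: "H1_seminorm \<Omega> (\<lambda>x. w x - z x) \<le> 2 * \<delta>"
        unfolding H1_seminorm_diff[OF \<Omega> wH zH]
        using L2_norm_diff_triangle[OF wL(2) \<psi>L(2) zL(2)] w(3) \<psi>(4) by linarith
      have "(H1_seminorm \<Omega> (\<lambda>x. z\<^sub>h h x - z x))\<^sup>2 \<le> 2 * M * L1_norm \<Omega> (\<lambda>x. f\<^sub>h h x - f x)
        + 2 * L2_norm \<Omega> f * L2_norm \<Omega> (\<lambda>x. w x - z x)
        + 2 * L2_norm \<Omega> (grad \<Omega> z) * H1_seminorm \<Omega> (\<lambda>x. w x - z x)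
        + (H1_seminorm \<Omega> (\<lambda>x. w x - z x))\<^sup>2"
      proof (rule energy_estimate[OF \<Omega> zH yH wH f])
        show "integrable (lebesgue_on \<Omega>) (f\<^sub>h h)" using f\<^sub>h[OF h] by (simp add: L1_space_def)
        show "\<bar>w x - z\<^sub>h h x\<bar> \<le> M" if "x \<in> \<Omega>" for x
          using w(4)[of x] y(1)[OF that] unfolding M_def by linarith
      qed (rule z\<^sub>h_solves[OF h w(1)], rule z_solves[OF y(2)])
      also have "\<dots> < \<eta>\<^sup>2 / 2 + 2 * L2_norm \<Omega> f * (2 * \<delta>) + 2 * L2_norm \<Omega> (grad \<Omega> z) * (2 * \<delta>) + (2 * \<delta>)\<^sup>2"
      proof (intro add_less_le_mono)
        show "2 * M * L1_norm \<Omega> (\<lambda>x. f\<^sub>h h x - f x) < \<eta>\<^sup>2 / 2"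
          using E M by (simp add: field_simps)
        show "2 * L2_norm \<Omega> f * L2_norm \<Omega> (\<lambda>x. w x - z x) \<le> 2 * L2_norm \<Omega> f * (2 * \<delta>)"
          using wz by (intro mult_left_mono) auto
        show "2 * L2_norm \<Omega> (grad \<Omega> z) * H1_seminorm \<Omega> (\<lambda>x. w x - z x) \<le> 2 * L2_norm \<Omega> (grad \<Omega> z) * (2 * \<delta>)"
          using gwz by (intro mult_left_mono) auto
        show "(H1_seminorm \<Omega> (\<lambda>x. w x - z x))\<^sup>2 \<le> (2 * \<delta>)\<^sup>2"
          using gwz by (intro power_mono) (auto simp: H1_seminorm_def)
      qed
      also have "\<dots> \<le> \<eta>\<^sup>2 / 2 + c * \<delta>"
      proof -
        have "\<delta> * \<delta> \<le> 1 * \<delta>" using \<delta> by (intro mult_right_mono) auto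
        then show ?thesis by (simp add: c_def power2_eq_square algebra_simps)
      qed
      also have "\<dots> \<le> \<eta>\<^sup>2" using \<delta>(3) by simp
      finally show "H1_seminorm \<Omega> (\<lambda>x. z\<^sub>h h x - z x) < \<eta>"
        by (rule power2_less_imp_less) (use \<eta> in simp)
    qed
  qed
  show ?thesis
  proof (rule tendstoI)
    fix \<eta> :: real assume "0 < \<eta>"
    from small[OF this] show "\<forall>\<^sub>F h in at 0 within H. dist (H1_seminorm \<Omega> (\<lambda>x. z\<^sub>h h x - z x)) 0 < \<eta>"
      by eventually_elim (simp add: H1_seminorm_def)
  qed
qed

end
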